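(* Let $M$ be a finite-dimensional complex left Leibniz algebra with Leibniz kernel $N=C(M)$ and solvable radical $B=B(M)$. Suppose that $[BN]=0$. Then given any pair of Levi subalgebras $S_1$ and $S_2$ of $M$, there is a derivation $f$ of $M$ such that $\exp(f)(S_1)=S_2$.
   Context: A left Leibniz algebra is a (nonassociative) $\mathbb{C}$-algebra $M$ with product $[\ ]$ satisfying $[a[bc]]=[[ab]c]+[b[ac]]$ for all $a,b,c\in M$. All algebras are finite-dimensional over $\mathbb{C}$. For subsets $A,A'\subseteq M$, $[AA']$ denotes the subspace spanned by all $[aa']$ with $a\in A$, $a'\in A'$. The Leibniz kernel $C(M)$ is the span of all $[aa]$, $a\in M$; it is a $2$-sided ideal. A Lie subalgebra of $M$ is a subalgebra which is a Lie algebra under $[\ ]$ (i.e. $[aa]=0$ for all its elements $a$). Put $M^{(0)}=M$, $M^{(n+1)}=[M^{(n)}M^{(n)}]$; $M$ is solvable if $M^{(n)}=0$ for some $n\ge 0$. The solvable radical $B(M)$ is the unique maximal solvable ideal of $M$. A Levi subalgebra of $M$ is a semisimple Lie subalgebra $S$ with $M=B(M)\oplus S$ as vector spaces. A derivation of $M$ is a linear map $f:M\to M$ with $f([ab])=[f(a)b]+[af(b)]$ for all $a,b\in M$. *)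

theory Defs
  imports Complex_Main
begin

text \<open>The underlying vector space is the whole type; \<open>Basis\<close> is an arbitrary finite basis
  and only serves to express finite dimensionality (no definition below depends on it).\<close>

locale left_leibniz_algebra = finite_dimensional_vector_space scale Basis
  for scale :: "complex \<Rightarrow> 'a::ab_group_add \<Rightarrow> 'a" (infixr \<open>*s\<close> 75)
    and Basis :: "'a set" +
  fixes br :: "'a \<Rightarrow> 'a \<Rightarrow> 'a" (infixl \<open>\<cdot>\<close> 70)
  assumes linear_br_left: "Vector_Spaces.linear scale scale (\<lambda>a. a \<cdot> b)"
    and linear_br_right: "Vector_Spaces.linear scale scale (\<lambda>b. a \<cdot> b)"
    and leibniz: "a \<cdot> (b \<cdot> c) = (a \<cdot> b) \<cdot> c + b \<cdot> (a \<cdot> c)"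
begin

definition br_span :: "'a set \<Rightarrow> 'a set \<Rightarrow> 'a set" where
  "br_span A A' = span {a \<cdot> a' |a a'. a \<in> A \<and> a' \<in> A'}"

definition leibniz_kernel :: "'a set" where
  "leibniz_kernel = span {a \<cdot> a |a. True}"

definition subalgebra :: "'a set \<Rightarrow> bool" where
  "subalgebra A \<longleftrightarrow> subspace A \<and> (\<forall>a\<in>A. \<forall>b\<in>A. a \<cdot> b \<in> A)"

definition lie_subalgebra :: "'a set \<Rightarrow> bool" where
  "lie_subalgebra A \<longleftrightarrow> subalgebra A \<and> (\<forall>a\<in>A. a \<cdot> a = 0)"

definition two_sided_ideal :: "'a set \<Rightarrow> 'a set \<Rightarrow> bool" where
  "two_sided_ideal A I \<longleftrightarrow>
     subspace I \<and> I \<subseteq> A \<and> (\<forall>a\<in>A. \<forall>x\<in>I. a \<cdot> x \<in> I \<and> x \<cdot> a \<in> I)"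

primrec derived_series :: "'a set \<Rightarrow> nat \<Rightarrow> 'a set" where
  "derived_series A 0 = A"
| "derived_series A (Suc n) = br_span (derived_series A n) (derived_series A n)"

definition solvable :: "'a set \<Rightarrow> bool" where
  "solvable A \<longleftrightarrow> (\<exists>n. derived_series A n = {0})"

definition maximal_solvable_ideal :: "'a set \<Rightarrow> 'a set \<Rightarrow> bool" where
  "maximal_solvable_ideal A I \<longleftrightarrow>
     two_sided_ideal A I \<and> solvable I \<and>
     (\<forall>J. two_sided_ideal A J \<and> solvable J \<and> I \<subseteq> J \<longrightarrow> J = I)"

text \<open>The radical is taken relative to a subalgebra \<open>A\<close>, so that it also applies to
  subalgebras regarded as algebras in their own right; the whole algebra is \<open>UNIV\<close>.\<close>

definition solvable_radical :: "'a set \<Rightarrow> 'a set" where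
  "solvable_radical A = (THE I. maximal_solvable_ideal A I)"

definition semisimple_lie_subalgebra :: "'a set \<Rightarrow> bool" where
  "semisimple_lie_subalgebra S \<longleftrightarrow> lie_subalgebra S \<and> solvable_radical S = {0}"

definition levi_subalgebra :: "'a set \<Rightarrow> bool" where
  "levi_subalgebra S \<longleftrightarrow>
     semisimple_lie_subalgebra S \<and>
     solvable_radical UNIV \<inter> S = {0} \<and>
     {b + s |b s. b \<in> solvable_radical UNIV \<and> s \<in> S} = UNIV"

definition derivation :: "('a \<Rightarrow> 'a) \<Rightarrow> bool" where
  "derivation f \<longleftrightarrow>
     Vector_Spaces.linear scale scale f \<and> (\<forall>a b. f (a \<cdot> b) = f a \<cdot> b + a \<cdot> f b)"

text \<open>Convergence of a series in the canonical topology of a finite-dimensional complex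
  vector space: convergence under every linear functional.\<close>

definition vec_sums :: "(nat \<Rightarrow> 'a) \<Rightarrow> 'a \<Rightarrow> bool" where
  "vec_sums u y \<longleftrightarrow>
     (\<forall>\<phi>. Vector_Spaces.linear scale (*) \<phi> \<longrightarrow> (\<lambda>k. \<phi> (u k)) sums \<phi> y)"

definition lin_exp :: "('a \<Rightarrow> 'a) \<Rightarrow> 'a \<Rightarrow> 'a" where
  "lin_exp f x = (THE y. vec_sums (\<lambda>k. (1 / fact k) *s (f ^^ k) x) y)"

lemma linear_functional_rep: "Vector_Spaces.linear scale (*) (\<lambda>x. representation Basis x b)"
proof -
  interpret C: vector_space "(*) :: complex \<Rightarrow> complex \<Rightarrow> complex"
    by unfold_locales (auto simp: algebra_simps)
  show ?thesis
    by unfold_locales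
      (auto simp: independent_Basis span_Basis representation_add representation_scale)
qed

lemma rep_expand: "(\<Sum>b\<in>Basis. representation Basis x b *s b) = x"
  by (rule sum_representation_eq) (auto simp: independent_Basis span_Basis finite_Basis)

lemma vec_sums_unique:
  assumes "vec_sums u y" "vec_sums u z"
  shows "y = z"
proof -
  have "representation Basis y b = representation Basis z b" for b
  proof -
    have "(\<lambda>k. representation Basis (u k) b) sums representation Basis w b" if "vec_sums u w" for w
      using that[unfolded vec_sums_def, THEN spec, THEN mp, OF linear_functional_rep] .
    from this[OF assms(1)] this[OF assms(2)] show ?thesis by (rule sums_unique2)
  qed
  then have "(\<Sum>b\<in>Basis. representation Basis y b *s b) = (\<Sum>b\<in>Basis. representation Basis z b *s b)"
    by (simp only:)
  then show ?thesis by (simp only: rep_expand)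
qed

lemma vec_sums_lin_exp:
  assumes f: "Vector_Spaces.linear scale scale f"
  shows "vec_sums (\<lambda>k. (1 / fact k) *s (f ^^ k) x) (lin_exp f x)"
proof -
  interpret f: Vector_Spaces.linear scale scale f by (rule f)
  let ?r = "representation Basis"
  define n where "n x = (\<Sum>b\<in>Basis. cmod (?r x b))" for x
  define L where "L = (\<Sum>b\<in>Basis. n (f b))"
  have n_nonneg: "n x \<ge> 0" for x by (simp add: n_def sum_nonneg)
  have r_le: "cmod (?r x b) \<le> n x" if "b \<in> Basis" for x b
    unfolding n_def by (rule member_le_sum) (use that finite_Basis in auto)
  have r_f: "?r (f x) c = (\<Sum>b\<in>Basis. ?r x b * ?r (f b) c)" for x c
  proof -
    interpret R: Vector_Spaces.linear scale "(*)" "\<lambda>x. ?r x c" by (rule linear_functional_rep)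
    have "?r (f x) c = ?r (f (\<Sum>b\<in>Basis. ?r x b *s b)) c" by (simp add: rep_expand)
    also have "\<dots> = (\<Sum>b\<in>Basis. ?r x b * ?r (f b) c)"
      by (simp only: f.sum f.scale R.sum R.scale)
    finally show ?thesis .
  qed
  have n_f: "n (f x) \<le> L * n x" for x
  proof -
    have "n (f x) \<le> (\<Sum>c\<in>Basis. \<Sum>b\<in>Basis. cmod (?r x b) * cmod (?r (f b) c))"
      unfolding n_def[of "f x"] r_f[of x]
      by (intro sum_mono order_trans[OF norm_sum]) (simp add: norm_mult)
    also have "\<dots> = (\<Sum>b\<in>Basis. cmod (?r x b) * n (f b))"
      by (subst sum.swap) (simp add: n_def sum_distrib_left)
    also have "\<dots> \<le> (\<Sum>b\<in>Basis. n x * n (f b))"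
      by (intro sum_mono mult_right_mono r_le n_nonneg)
    also have "\<dots> = L * n x" by (simp add: L_def sum_distrib_left mult.commute)
    finally show ?thesis .
  qed
  have L: "L \<ge> 0" by (simp add: L_def sum_nonneg n_nonneg)
  have n_pow: "n ((f ^^ k) x) \<le> L ^ k * n x" for k
  proof (induction k)
    case (Suc k)
    have "n ((f ^^ Suc k) x) \<le> L * n ((f ^^ k) x)" using n_f by simp
    also have "\<dots> \<le> L * (L ^ k * n x)" by (rule mult_left_mono[OF Suc L])
    finally show ?case by simp
  qed simp
  define u where "u k = (1 / fact k) *s (f ^^ k) x" for k
  have "summable (\<lambda>k. ?r (u k) b)" if b: "b \<in> Basis" for b
  proof (rule summable_comparison_test)
    interpret R: Vector_Spaces.linear scale "(*)" "\<lambda>x. ?r x b" by (rule linear_functional_rep)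
    have "cmod (?r (u k) b) \<le> inverse (fact k) * L ^ k * n x" for k
    proof -
      have "cmod (?r (u k) b) = inverse (fact k) * cmod (?r ((f ^^ k) x) b)"
        by (simp only: u_def R.scale) (simp add: norm_mult norm_divide field_simps)
      also have "\<dots> \<le> inverse (fact k) * (L ^ k * n x)"
        by (intro mult_left_mono order_trans[OF r_le n_pow]) (use b in auto)
      finally show ?thesis by (simp add: mult.assoc)
    qed
    then show "\<exists>N. \<forall>k\<ge>N. norm (?r (u k) b) \<le> inverse (fact k) * L ^ k * n x" by blast
    show "summable (\<lambda>k. inverse (fact k) * L ^ k * n x)"
      by (rule summable_mult2) (rule summable_exp)
  qed
  then have S: "(\<lambda>k. ?r (u k) b) sums (\<Sum>k. ?r (u k) b)" if "b \<in> Basis" for b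
    using that by (simp add: summable_sums)
  have "vec_sums u (\<Sum>b\<in>Basis. (\<Sum>k. ?r (u k) b) *s b)"
    unfolding vec_sums_def
  proof (intro allI impI)
    fix \<phi> assume "Vector_Spaces.linear scale ((*) :: complex \<Rightarrow> _) \<phi>"
    then interpret P: Vector_Spaces.linear scale "(*)" \<phi> .
    have "(\<lambda>k. \<Sum>b\<in>Basis. ?r (u k) b * \<phi> b) sums (\<Sum>b\<in>Basis. (\<Sum>k. ?r (u k) b) * \<phi> b)"
      by (intro sums_sum sums_mult2 S)
    moreover have "\<phi> (u k) = (\<Sum>b\<in>Basis. ?r (u k) b * \<phi> b)" for k
      by (subst rep_expand[symmetric]) (simp only: P.sum P.scale)
    ultimately show "(\<lambda>k. \<phi> (u k)) sums \<phi> (\<Sum>b\<in>Basis. (\<Sum>k. ?r (u k) b) *s b)"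
      by (simp only: P.sum P.scale)
  qed
  then have "vec_sums u (THE y. vec_sums u y)"
    by (metis (mono_tags, lifting) vec_sums_unique the_equality)
  then show ?thesis unfolding lin_exp_def u_def .
qed

end

end

theory Submission
  imports Defs "HOL-Computational_Algebra.Fundamental_Theorem_Algebra"
begin

text \<open>For \<open>z\<close> in the nilpotent ideal \<open>[M, B] + N\<close> the exponential of left multiplication by \<open>z\<close> is an
  automorphism, and Whitehead's first lemma lets one choose \<open>z\<close> so that it carries \<open>S\<^sub>1\<close> into
  \<open>S\<^sub>2 + N\<close>; this is Malcev's theorem for the Lie algebra \<open>M / N\<close>. On \<open>S\<^sub>1\<close> the remaining defect
  is a map \<open>\<nu>\<close> into \<open>N\<close>. Because \<open>[N M] = 0\<close> and \<open>[B N] = 0\<close>, the map \<open>b + s \<mapsto> - \<nu> s\<close> is a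
  derivation \<open>g\<close> of \<open>M = B \<oplus> S\<^sub>1\<close> whose products with left multiplication by \<open>z\<close> and with itself
  vanish, so that \<open>exp (z + g) = exp z + g\<close> carries \<open>S\<^sub>1\<close> onto \<open>S\<^sub>2\<close>. Whitehead's lemma is
  proved with the Casimir operator, which rests on Cartan's criterion for solvability.\<close>

text \<open>The methods for Lie algebras stop at the kernel: its elements multiply to zero from the
  left, so changing \<open>z\<close> inside \<open>leibniz_kernel\<close> does not alter left
  multiplication by \<open>z\<close>, and the last defect calls for a derivation of another kind. A
  single derivation is wanted, and a composite of exponentials need not be the exponential of one.
  Therefore \<open>z\<close> is corrected additively, and \<open>g\<close> is arranged so that every
  mixed product with \<open>z\<close> vanishes and the exponentials simply add. No quotient algebra
  is formed. Statements about factors are congruences modulo subspaces of the one type, and a linear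
  projection replaces the quotient map where irreducibility is used. Inductions along chains of
  ideals become choices of a subspace of extremal dimension. The complex field enters through
  eigenvalues and through conjugation, which turns a vanishing trace into a vanishing sum of squared
  moduli.\<close>

locale complex_vs = finite_dimensional_vector_space scale Basis
  for scale :: "complex \<Rightarrow> 'a::ab_group_add \<Rightarrow> 'a" (infixr \<open>*s\<close> 75)
    and Basis :: "'a set"
begin

section \<open>Linear maps and subspaces of finite dimension\<close>

abbreviation endo :: "('a \<Rightarrow> 'a) \<Rightarrow> bool" where
  "endo f \<equiv> Vector_Spaces.linear scale scale f"

lemma endoI:
  assumes "\<And>x y. f (x + y) = f x + f y" "\<And>c x. f (c *s x) = c *s f x"
  shows "endo f"
  using assms by unfold_locales auto

lemma endo_add: "endo f \<Longrightarrow> f (x + y) = f x + f y"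
  and endo_scale: "endo f \<Longrightarrow> f (c *s x) = c *s f x"
  and endo_diff: "endo f \<Longrightarrow> f (x - y) = f x - f y"
  and endo_neg: "endo f \<Longrightarrow> f (- x) = - f x"
  and endo_zero: "endo f \<Longrightarrow> f 0 = 0"
  and endo_sum: "endo f \<Longrightarrow> f (sum g A) = (\<Sum>a\<in>A. f (g a))"
  by (simp_all add: linear_iff_module_hom module_hom.add module_hom.scale module_hom.diff
      module_hom.neg module_hom.zero module_hom.sum)

lemma endo_comp: "endo f \<Longrightarrow> endo g \<Longrightarrow> endo (\<lambda>x. f (g x))"
  by (rule endoI) (simp_all add: endo_add endo_scale)

lemma endo_plus: "endo f \<Longrightarrow> endo g \<Longrightarrow> endo (\<lambda>x. f x + g x)"
  by (rule endoI) (simp_all add: endo_add endo_scale algebra_simps)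

lemma endo_minus: "endo f \<Longrightarrow> endo g \<Longrightarrow> endo (\<lambda>x. f x - g x)"
  by (rule endoI) (simp_all add: endo_add endo_scale algebra_simps)

lemma endo_scaled: "endo f \<Longrightarrow> endo (\<lambda>x. c *s f x)"
  by (rule endoI) (simp_all add: endo_add endo_scale algebra_simps)

lemma endo_funpow: "endo f \<Longrightarrow> endo (f ^^ n)"
  by (induction n) (auto intro: endoI simp: endo_add endo_scale)

lemma endo_span_subset:
  assumes "endo f" "\<And>x. x \<in> X \<Longrightarrow> f x \<in> V" "subspace V" "x \<in> span X"
  shows "f x \<in> V"
  using assms(4)
proof (induction rule: span_induct_alt)
  case base then show ?case using assms by (simp add: endo_zero subspace_0)
next
  case (step c x y)
  then show ?case using assms by (simp add: endo_add endo_scale subspace_add subspace_scale)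
qed

lemma endo_image_subspace: "endo f \<Longrightarrow> subspace V \<Longrightarrow> subspace (f ` V)"
  by (simp add: linear_iff_module_hom module_hom.subspace_image)

lemma endo_vimage_subspace:
  assumes "endo f" "subspace V" "subspace W"
  shows "subspace {v \<in> V. f v \<in> W}"
  using assms by (auto simp: subspace_def endo_add endo_scale endo_zero)

lemma endo_extend:
  assumes "independent C"
  obtains f where "endo f" "\<And>b. b \<in> C \<Longrightarrow> f b = g b"
proof -
  interpret vector_space_pair scale scale ..
  from linear_independent_extend[OF assms] show ?thesis using that by blast
qed

lemma subspace_basis:
  assumes "subspace V"
  obtains C where "C \<subseteq> V" "independent C" "span C = V" "finite C" "card C = dim V"
  by (metis assms basis_exists finiteI_independent span_minimal subset_antisym)

text \<open>Dimensions are bounded, and a subspace of greatest dimension with property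
  \<open>P\<close> cannot be enlarged. Together with its dual below, this replaces all chain
  conditions.\<close>

lemma ex_maximal_subspace:
  assumes "P W0" and sub: "\<And>W. P W \<Longrightarrow> subspace W"
  shows "\<exists>W. P W \<and> (\<forall>W'. P W' \<longrightarrow> W \<subseteq> W' \<longrightarrow> W' = W)"
proof -
  have "\<forall>W. P W \<longrightarrow> dim W < Suc dimension"
    using dim_subset_UNIV by (simp add: less_Suc_eq_le)
  then obtain W where W: "P W" "\<And>W'. P W' \<Longrightarrow> dim W' \<le> dim W"
    using ex_has_greatest_nat[of P W0 dim] assms(1) by blast
  then have "W' = W" if "P W'" "W \<subseteq> W'" for W'
    using that sub subspace_dim_equal[of W W'] by blast
  then show ?thesis using W(1) by blast
qed

lemma ex_minimal_subspace:
  assumes "P W0" and sub: "\<And>W. P W \<Longrightarrow> subspace W"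
  shows "\<exists>W. P W \<and> (\<forall>W'. P W' \<longrightarrow> W' \<subseteq> W \<longrightarrow> W' = W)"
proof -
  obtain W where W: "P W" "\<And>W'. P W' \<Longrightarrow> dim W \<le> dim W'"
    using ex_has_least_nat[of P W0 dim] assms(1) by blast
  then have "W' = W" if "P W'" "W' \<subseteq> W" for W'
    using that sub subspace_dim_equal[of W' W] by blast
  then show ?thesis using W(1) by blast
qed

text \<open>The images of a basis of \<open>V\<close> span a space containing \<open>V\<close>; by
  counting they stay distinct and independent.\<close>

lemma endo_surj_imp_inj:
  assumes f: "endo f" and V: "subspace V" "V \<subseteq> f ` V" "v \<in> V" "f v = 0"
  shows "v = 0"
proof -
  interpret f: Vector_Spaces.linear scale scale f by (rule f)
  obtain C where C: "C \<subseteq> V" "independent C" "span C = V" "finite C" "card C = dim V"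
    using subspace_basis[OF V(1)] .
  have "V \<subseteq> span (f ` C)" using V(2) C(3) by (simp add: f.span_image)
  then have "dim V \<le> card (f ` C)" using C(4) by (simp add: dim_le_card)
  then have card: "card (f ` C) = card C" using C(4,5) card_image_le[of C f] by simp
  then have inj: "inj_on f C" using C(4) by (simp add: eq_card_imp_inj_on)
  have "dim (span (f ` C)) \<ge> dim V" using \<open>V \<subseteq> span (f ` C)\<close> dim_mono by simp
  then have "independent (f ` C)"
    using C card by (intro card_le_dim_spanning[of _ "span (f ` C)"]) (auto simp: span_superset)
  then have "inj_on f (span C)" using inj f.inj_on_span_independent_image by blast
  then show ?thesis using V C(3) by (metis f.zero inj_onD span_zero)
qed

lemma endo_inj_imp_surj:
  assumes f: "endo f" and V: "subspace V" "\<And>v. v \<in> V \<Longrightarrow> f v \<in> V" "\<And>v. v \<in> V \<Longrightarrow> f v = 0 \<Longrightarrow> v = 0"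
  shows "f ` V = V"
proof -
  interpret f: Vector_Spaces.linear scale scale f by (rule f)
  obtain C where C: "C \<subseteq> V" "independent C" "span C = V" "finite C" "card C = dim V"
    using subspace_basis[OF V(1)] .
  have inj: "inj_on f (span C)"
    using V C by (simp add: f.inj_on_iff_eq_0)
  then have "independent (f ` C)" using C(2) f.independent_injective_image by blast
  moreover have "card (f ` C) = card C"
    by (rule card_image) (use inj C inj_on_subset in blast)
  ultimately have "dim (f ` V) = dim V"
    using C by (metis f.span_image dim_span_eq_card_independent)
  then show ?thesis
    by (intro subspace_dim_equal) (use V f endo_image_subspace in auto)
qed

text \<open>Otherwise \<open>Suc dimension\<close> terms would be independent. Applied to iterates
  of an operator, it yields annihilating polynomials and the first linear dependence in
  \<open>lie_invariance\<close>.\<close>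

lemma sequence_dependent: "\<exists>k. w k \<in> span (w ` {..<k})" for w :: "nat \<Rightarrow> 'a"
proof (rule ccontr)
  assume *: "\<not> ?thesis"
  have "independent (w ` {..<k}) \<and> card (w ` {..<k}) = k" for k
  proof (induction k)
    case (Suc k)
    have "w k \<notin> span (w ` {..<k})" using * by blast
    then have "independent (insert (w k) (w ` {..<k}))" "w k \<notin> w ` {..<k}"
      using Suc independent_insertI[of "w k"] span_base[of "w k"] by (simp, metis)
    then show ?case using Suc by (auto simp: lessThan_Suc card_insert_disjoint)
  qed (simp add: independent_empty)
  from this[of "Suc dimension"] show False
    using independent_card_le_dim[of "w ` {..<Suc dimension}" UNIV] dim_subset_UNIV[of UNIV]
    by (metis not_less_eq_eq order_trans subset_UNIV)
qed

lemma span_sequence_sum: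
  "x \<in> span (w ` {..<k::nat}) \<Longrightarrow> \<exists>c. x = (\<Sum>i<k. c i *s w i)"
proof (induction k arbitrary: x)
  case (Suc k)
  then obtain a where "x - a *s w k \<in> span (w ` {..<k})"
    using span_breakdown_eq by (auto simp: lessThan_Suc)
  with Suc.IH obtain c where c: "x - a *s w k = (\<Sum>i<k. c i *s w i)" by blast
  show ?case
    by (rule exI[of _ "c(k := a)"]) (use c in \<open>simp add: diff_eq_eq\<close>)
qed simp

subsection \<open>Generalised eigenvectors\<close>

text \<open>The union of the kernels of the powers of \<open>T - c\<close>, encoded inductively so
  that rule induction replaces bookkeeping of exponents.\<close>

inductive_set gen_eig :: "('a \<Rightarrow> 'a) \<Rightarrow> complex \<Rightarrow> 'a set"
  for T :: "'a \<Rightarrow> 'a" and c :: complex where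
  gen_eig_zero: "0 \<in> gen_eig T c"
| gen_eig_step: "T v - c *s v \<in> gen_eig T c \<Longrightarrow> v \<in> gen_eig T c"

lemma gen_eig_shift:
  assumes "endo T" "v \<in> gen_eig T c" shows "T v - c *s v \<in> gen_eig T c"
  using assms(2) by cases (use assms(1) in \<open>auto simp: endo_zero gen_eig_zero\<close>)

lemma subspace_gen_eig:
  assumes T: "endo T" shows "subspace (gen_eig T c)"
  unfolding subspace_def
proof (intro conjI ballI allI gen_eig_zero)
  fix u v assume "u \<in> gen_eig T c" "v \<in> gen_eig T c"
  then show "u + v \<in> gen_eig T c"
  proof (induction arbitrary: v)
    case (gen_eig_step u)
    have "T (u + v) - c *s (u + v) = (T u - c *s u) + (T v - c *s v)"
      by (simp add: endo_add[OF T] algebra_simps)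
    then show ?case
      using gen_eig_step.IH[OF gen_eig_shift[OF T gen_eig_step.prems]]
      by (metis gen_eig.gen_eig_step)
  qed simp
next
  fix a u assume "u \<in> gen_eig T c"
  then show "a *s u \<in> gen_eig T c"
  proof induction
    case (gen_eig_step u)
    have "T (a *s u) - c *s (a *s u) = a *s (T u - c *s u)"
      by (simp add: endo_scale[OF T] algebra_simps)
    then show ?case using gen_eig_step.IH by (metis gen_eig.gen_eig_step)
  qed (simp add: gen_eig_zero)
qed

text \<open>\<open>T - c\<close> is invertible on the generalised eigenspace of another eigenvalue:
  if \<open>w\<close> solves the equation for \<open>T u - d *s u\<close>, then \<open>T - c\<close>
  sends \<open>u - w\<close> to \<open>(d - c) *s u\<close>, since \<open>T - c\<close> is
  \<open>(T - d) + (d - c)\<close>.\<close>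

lemma gen_eig_solve:
  assumes T: "endo T" and V: "subspace V" "\<And>v. v \<in> V \<Longrightarrow> T v \<in> V" and "c \<noteq> d"
    and "u \<in> gen_eig T d" "u \<in> V"
  shows "\<exists>w \<in> gen_eig T d \<inter> V. T w - c *s w = u"
  using assms(5,6)
proof induction
  case gen_eig_zero
  show ?case by (rule bexI[of _ 0]) (use V T in \<open>auto simp: subspace_0 endo_zero gen_eig.gen_eig_zero\<close>)
next
  case (gen_eig_step u)
  have u: "u \<in> gen_eig T d" using gen_eig_step.hyps by (rule gen_eig.gen_eig_step)
  from gen_eig_step V obtain w where w: "w \<in> gen_eig T d \<inter> V" "T w - c *s w = T u - d *s u"
    by (meson subspace_diff subspace_scale)
  let ?w = "(1 / (d - c)) *s (u - w)"
  have "T ?w - c *s ?w = (1 / (d - c)) *s ((T u - c *s u) - (T w - c *s w))"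
    by (simp add: endo_scale[OF T] endo_diff[OF T] algebra_simps)
  also have "\<dots> = (1 / (d - c)) *s ((d - c) *s u)"
    by (simp add: w(2) algebra_simps)
  also have "\<dots> = u" using \<open>c \<noteq> d\<close> by simp
  finally show ?case
    using w(1) u gen_eig_step.prems V(1) subspace_gen_eig[OF T, of d]
    by (intro bexI[of _ ?w]) (auto intro!: subspace_scale subspace_diff)
qed

definition gen_eig_others :: "('a \<Rightarrow> 'a) \<Rightarrow> 'a set \<Rightarrow> complex \<Rightarrow> 'a set" where
  "gen_eig_others T V c = span (\<Union>d\<in>-{c}. gen_eig T d \<inter> V)"

text \<open>\<open>T - c\<close> maps the sum of the other eigenspaces onto itself by
  \<open>gen_eig_solve\<close>, hence is injective there; induction on \<open>v\<close> first kills
  \<open>T v - c *s v\<close>, then \<open>v\<close>.\<close>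

lemma gen_eig_independent:
  assumes T: "endo T" and V: "subspace V" "\<And>v. v \<in> V \<Longrightarrow> T v \<in> V"
    and "v \<in> gen_eig T c" "v \<in> gen_eig_others T V c"
  shows "v = 0"
proof -
  let ?U = "gen_eig_others T V c" and ?f = "\<lambda>v. T v - c *s v"
  have f: "endo ?f" using T by (intro endo_minus endo_scaled) (auto simp: linear_ident)
  have U: "subspace ?U" by (simp add: gen_eig_others_def)
  have surj: "?U \<subseteq> ?f ` ?U"
    unfolding gen_eig_others_def
  proof (rule span_minimal)
    show "subspace (?f ` span (\<Union>d\<in>- {c}. gen_eig T d \<inter> V))"
      using f by (simp add: endo_image_subspace)
    show "(\<Union>d\<in>- {c}. gen_eig T d \<inter> V) \<subseteq> ?f ` span (\<Union>d\<in>- {c}. gen_eig T d \<inter> V)"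
    proof
      fix u assume "u \<in> (\<Union>d\<in>- {c}. gen_eig T d \<inter> V)"
      then obtain d where d: "d \<noteq> c" "u \<in> gen_eig T d" "u \<in> V" by auto
      then obtain w where "w \<in> gen_eig T d \<inter> V" "?f w = u"
        using gen_eig_solve[OF T V] by metis
      then show "u \<in> ?f ` span (\<Union>d\<in>- {c}. gen_eig T d \<inter> V)"
        using d(1) by (intro image_eqI[of _ _ w]) (auto intro!: span_base)
    qed
  qed
  have Uf: "?f u \<in> ?U" if "u \<in> ?U" for u
    using that unfolding gen_eig_others_def
  proof (rule endo_span_subset[OF f, rotated 2])
    fix x assume "x \<in> (\<Union>d\<in>- {c}. gen_eig T d \<inter> V)"
    then obtain d where d: "d \<noteq> c" "x \<in> gen_eig T d \<inter> V" by auto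
    have "T x - d *s x \<in> gen_eig T d \<inter> V"
      using d gen_eig_shift[OF T] V by (auto intro!: subspace_diff subspace_scale)
    then have "(T x - d *s x) + (d - c) *s x \<in> gen_eig T d \<inter> V"
      using d V subspace_gen_eig[OF T] by (auto intro!: subspace_add subspace_scale)
    then have "?f x \<in> gen_eig T d \<inter> V" by (simp add: algebra_simps)
    then show "?f x \<in> span (\<Union>d\<in>- {c}. gen_eig T d \<inter> V)" using d(1) by (auto intro!: span_base)
  qed simp
  from assms(4,5) show ?thesis
  proof induction
    case (gen_eig_step v)
    then have "?f v = 0" using Uf by simp
    then show ?case using endo_surj_imp_inj[OF f U surj] gen_eig_step.prems by simp
  qed simp
qed

text \<open>Primary decomposition without coprime polynomials. The \<open>fold\<close> is a product
  of factors \<open>T - c\<close> applied to \<open>v\<close>; they are undone one at a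
  time.\<close>

lemma fold_shift_gen_eig:
  assumes T: "endo T" and V: "subspace V" "\<And>v. v \<in> V \<Longrightarrow> T v \<in> V"
  shows "v \<in> V \<Longrightarrow> fold (\<lambda>c w. T w - c *s w) cs v = 0 \<Longrightarrow> v \<in> span (\<Union>c. gen_eig T c \<inter> V)"
proof (induction cs arbitrary: v)
  case Nil then show ?case by (simp add: span_zero)
next
  case (Cons c cs)
  let ?S = "span (\<Union>c. gen_eig T c \<inter> V)" and ?f = "\<lambda>v. T v - c *s v"
  have f: "endo ?f" using T by (intro endo_minus endo_scaled) (auto simp: linear_ident)
  have "?f v \<in> V" using Cons.prems V by (auto intro!: subspace_diff subspace_scale)
  then have fv: "?f v \<in> ?S" using Cons by simp
  \<comment> \<open>Up to \<open>gen_eig T c\<close>, every element of the sum is a value of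
    \<open>T - c\<close>: the component for \<open>c\<close> is absorbed, the others are solved for
    by \<open>gen_eig_solve\<close>. Subtracting such a \<open>w\<close> from \<open>v\<close>
    leaves a vector of \<open>gen_eig T c\<close>.\<close>
  have "\<exists>w\<in>?S \<inter> V. x - ?f w \<in> gen_eig T c" if "x \<in> ?S" for x
    using that
  proof (induction rule: span_induct_alt)
    case base show ?case
      by (rule bexI[of _ 0]) (use V f in \<open>auto simp: endo_zero[OF T] gen_eig_zero span_zero subspace_0\<close>)
  next
    case (step a x y)
    then obtain w where w: "w \<in> ?S \<inter> V" "y - ?f w \<in> gen_eig T c" by auto
    have "\<exists>u\<in>?S \<inter> V. x - ?f u \<in> gen_eig T c"
    proof -
      from step obtain d where d: "x \<in> gen_eig T d \<inter> V" by auto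
      show ?thesis
      proof (cases "d = c")
        case True
        then show ?thesis using d
          by (intro bexI[of _ 0]) (use V f in \<open>auto simp: endo_zero[OF T] gen_eig_zero span_zero subspace_0\<close>)
      next
        case False
        then obtain u where "u \<in> gen_eig T d \<inter> V" "?f u = x"
          using d gen_eig_solve[OF T V, of c d x] by auto
        then show ?thesis by (intro bexI[of _ u]) (auto simp: gen_eig_zero intro: span_base)
      qed
    qed
    then obtain u where u: "u \<in> ?S \<inter> V" "x - ?f u \<in> gen_eig T c" by blast
    have "(a *s x + y) - ?f (a *s u + w) = a *s (x - ?f u) + (y - ?f w)"
      by (simp add: endo_add[OF f] endo_scale[OF f] endo_add[OF T] endo_scale[OF T] algebra_simps)
    also have "\<dots> \<in> gen_eig T c"
      using u w by (intro subspace_add subspace_scale subspace_gen_eig T)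
    finally show ?case
      using u w V(1) by (intro bexI[of _ "a *s u + w"])
        (auto intro: subspace_add subspace_scale span_add span_scale)
  qed
  from this[OF fv] obtain w where w: "w \<in> ?S" "w \<in> V" "?f v - ?f w \<in> gen_eig T c" by blast
  then have "?f (v - w) \<in> gen_eig T c" by (simp only: endo_diff[OF f])
  then have "v - w \<in> gen_eig T c" by (rule gen_eig_step)
  moreover have "v - w \<in> V" using w Cons.prems V(1) by (simp add: subspace_diff)
  ultimately have "v - w \<in> ?S" by (auto intro: span_base)
  from span_add[OF this w(1)] show ?case by simp
qed

section \<open>Annihilating polynomials, eigenvectors and triangular form\<close>

definition poly_act :: "complex poly \<Rightarrow> ('a \<Rightarrow> 'a) \<Rightarrow> 'a \<Rightarrow> 'a" where
  "poly_act p T v = fold_coeffs (\<lambda>a w. a *s v + T w) p 0"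

lemma poly_act_0 [simp]: "poly_act 0 T v = 0"
  by (simp add: poly_act_def)

lemma poly_act_pCons:
  assumes "endo T" shows "poly_act (pCons a p) T v = a *s v + T (poly_act p T v)"
  by (cases "p = 0 \<and> a = 0") (auto simp: poly_act_def endo_zero[OF assms])

lemma poly_act_add:
  assumes "endo T" shows "poly_act (p + q) T v = poly_act p T v + poly_act q T v"
  by (induction p q rule: poly_induct2)
    (simp_all add: poly_act_pCons[OF assms] endo_add[OF assms] algebra_simps)

lemma poly_act_smult:
  assumes "endo T" shows "poly_act (smult c p) T v = c *s poly_act p T v"
  by (induction p) (simp_all add: poly_act_pCons[OF assms] endo_scale[OF assms] algebra_simps)

lemma poly_act_sum:
  assumes "endo T" shows "poly_act (sum p A) T v = (\<Sum>i\<in>A. poly_act (p i) T v)"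
  by (induction A rule: infinite_finite_induct) (simp_all add: poly_act_add[OF assms])

lemma poly_act_monom:
  assumes "endo T" shows "poly_act (monom c n) T v = c *s (T ^^ n) v"
  by (induction n) (simp_all add: monom_0 monom_Suc poly_act_pCons[OF assms] endo_zero endo_scale assms)

lemma poly_act_linear:
  assumes T: "endo T" shows "endo (poly_act p T)"
  by (rule endoI; induction p)
    (simp_all add: poly_act_pCons[OF T] endo_add[OF T] endo_scale[OF T] algebra_simps)

lemma poly_act_commute:
  assumes T: "endo T" shows "poly_act p T (T v) = T (poly_act p T v)"
  by (induction p) (simp_all add: poly_act_pCons[OF T] endo_zero endo_add endo_scale T)

lemma poly_act_linear_factor:
  assumes T: "endo T"
  shows "poly_act ([:- r, 1:] * q) T v = poly_act q T (T v - r *s v)"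
proof -
  have "[:- r, 1:] * q = smult (- r) q + pCons 0 q" by simp
  then have "poly_act ([:- r, 1:] * q) T v = poly_act q T (T v) - r *s poly_act q T v"
    by (simp only: poly_act_add[OF T] poly_act_smult[OF T] poly_act_pCons[OF T] poly_act_commute[OF T])
      simp
  then show ?thesis by (simp add: endo_diff[OF poly_act_linear[OF T]] endo_scale[OF poly_act_linear[OF T]])
qed

text \<open>A root \<open>r\<close> splits off a factor, and the cofactor then annihilates
  \<open>T v - r *s v\<close>; the roots found in this order form the list.\<close>

lemma poly_act_zero_factors:
  assumes T: "endo T"
  shows "p \<noteq> 0 \<Longrightarrow> poly_act p T v = 0 \<Longrightarrow> \<exists>cs. fold (\<lambda>c w. T w - c *s w) cs v = 0"
proof (induction "degree p" arbitrary: p v)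
  case 0
  then obtain a where "p = [:a:]" using degree_eq_zeroE by metis
  with 0 have "v = 0" by (simp add: poly_act_pCons[OF T] endo_zero[OF T])
  then show ?case by (intro exI[of _ "[]"]) simp
next
  case (Suc n)
  have "\<not> constant (poly p)" using Suc(2) by (simp add: constant_degree)
  then obtain r where "poly p r = 0" using fundamental_theorem_of_algebra by blast
  then obtain q where q: "p = [:- r, 1:] * q" by (auto simp: poly_eq_0_iff_dvd dvd_def)
  then have "q \<noteq> 0" using Suc by auto
  then have "degree p = degree q + 1" unfolding q by (subst degree_mult_eq) auto
  with Suc(1)[of q "T v - r *s v"] Suc obtain cs
    where "fold (\<lambda>c w. T w - c *s w) cs (T v - r *s v) = 0"
    using \<open>q \<noteq> 0\<close> by (auto simp: q poly_act_linear_factor[OF T] simp del: mult_pCons_left)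
  then show ?case by (intro exI[of _ "r # cs"]) simp
qed

text \<open>The first dependence among the iterates of \<open>T\<close> on \<open>v\<close> gives a
  monic polynomial killing \<open>v\<close>, which splits over the complex numbers.\<close>

lemma gen_eig_span:
  assumes T: "endo T" and V: "subspace V" "\<And>v. v \<in> V \<Longrightarrow> T v \<in> V" "v \<in> V"
  shows "v \<in> span (\<Union>c. gen_eig T c \<inter> V)"
proof -
  obtain k where "(T ^^ k) v \<in> span ((\<lambda>i. (T ^^ i) v) ` {..<k})"
    using sequence_dependent[of "\<lambda>i. (T ^^ i) v"] by auto
  then obtain c where c: "(T ^^ k) v = (\<Sum>i<k. c i *s (T ^^ i) v)"
    using span_sequence_sum by blast
  define p where "p = monom 1 k - (\<Sum>i<k. monom (c i) i)"
  have "coeff p k = 1" by (simp add: p_def coeff_sum)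
  then have "p \<noteq> 0" by auto
  have "p = monom 1 k + smult (- 1) (\<Sum>i<k. monom (c i) i)" by (simp add: p_def)
  then have "poly_act p T v = 0"
    by (simp only: poly_act_add[OF T] poly_act_smult[OF T] poly_act_sum[OF T] poly_act_monom[OF T])
      (simp add: c)
  with \<open>p \<noteq> 0\<close> obtain cs where "fold (\<lambda>c w. T w - c *s w) cs v = 0"
    using poly_act_zero_factors[OF T] by blast
  then show ?thesis using fold_shift_gen_eig[OF T V(1,2)] V(3) by blast
qed

text \<open>Some generalised eigenspace meets \<open>V\<close> nontrivially; following
  \<open>T - c\<close> from a nonzero vector there, the last nonzero vector is an
  eigenvector.\<close>

lemma eigenvector_exists:
  assumes T: "endo T" and V: "subspace V" "\<And>v. v \<in> V \<Longrightarrow> T v \<in> V" "V \<noteq> {0}"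
  obtains v c where "v \<in> V" "v \<noteq> 0" "T v = c *s v"
proof -
  obtain x where x: "x \<in> V" "x \<noteq> 0" using V(1,3) subspace_0 by blast
  have "\<exists>c v. v \<in> gen_eig T c \<inter> V \<and> v \<noteq> 0"
  proof (rule ccontr)
    assume "\<not> ?thesis"
    then have "span (\<Union>c. gen_eig T c \<inter> V) \<subseteq> {0}"
      by (intro span_minimal) auto
    then show False using gen_eig_span[OF T V(1,2) x(1)] x(2) by auto
  qed
  then obtain c v where "v \<in> gen_eig T c" "v \<in> V" "v \<noteq> 0" by blast
  then have "\<exists>v\<in>V. v \<noteq> 0 \<and> T v = c *s v"
  proof induction
    case (gen_eig_step v)
    show ?case
    proof (cases "T v - c *s v = 0")
      case True then show ?thesis using gen_eig_step by auto
    next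
      case False
      then show ?thesis using gen_eig_step V by (auto intro!: subspace_diff subspace_scale)
    qed
  qed simp
  then show ?thesis using that by blast
qed

text \<open>An upper triangular form whose basis vectors are also generalised eigenvectors, which a
  bare flag of invariant subspaces would not give. The basis is extended from an invariant proper
  subspace by one vector outside it.\<close>

lemma triangular_basis:
  assumes T: "endo T"
  shows "subspace V \<Longrightarrow> (\<And>v. v \<in> V \<Longrightarrow> T v \<in> V) \<Longrightarrow>
    \<exists>C a. C \<subseteq> V \<and> independent C \<and> span C = V \<and>
      (\<forall>b\<in>C. b \<in> gen_eig T (a b) \<and> representation C (T b) b = a b)"
proof (induction "dim V" arbitrary: V rule: less_induct)
  case less
  show ?case
  proof (cases "V = {0}")
    case True
    then show ?thesis by (intro exI[of _ "{}"]) (auto simp: independent_empty)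
  next
    case False
    obtain v c where v: "v \<in> V" "v \<noteq> 0" "T v = c *s v"
      using eigenvector_exists[OF T less.prems False] .
    let ?f = "\<lambda>v. T v - c *s v"
    have f: "endo ?f" using T by (intro endo_minus endo_scaled) (auto simp: linear_ident)
    have fV: "?f ` V \<subseteq> V" using less.prems by (auto intro!: subspace_diff subspace_scale)
    have "?f ` V \<noteq> V"
      using endo_surj_imp_inj[OF f less.prems(1) _ v(1)] v by auto
    then have "subspace (?f ` V) \<and> ?f ` V \<subseteq> ?f ` V \<and> ?f ` V \<subset> V"
      using endo_image_subspace[OF f less.prems(1)] fV by auto
    \<comment> \<open>Any subspace between the image of \<open>T - c\<close> and \<open>V\<close> is
      invariant, because \<open>T w\<close> is \<open>(T - c) w + c *s w\<close>. The image is
      proper because \<open>c\<close> has an eigenvector.\<close>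
    from ex_maximal_subspace[of "\<lambda>W. subspace W \<and> ?f ` V \<subseteq> W \<and> W \<subset> V", OF this]
    obtain W where W: "subspace W" "?f ` V \<subseteq> W" "W \<subset> V"
      and Wmax: "\<And>W'. subspace W' \<and> ?f ` V \<subseteq> W' \<and> W' \<subset> V \<Longrightarrow> W \<subseteq> W' \<Longrightarrow> W' = W"
      by auto
    have TW: "T w \<in> W" if "w \<in> W" for w
    proof -
      have "?f w \<in> W" using that W by auto
      from subspace_add[OF W(1) this subspace_scale[OF W(1) that, of c]] show ?thesis by simp
    qed
    have "dim W < dim V" using W less.prems(1) by (metis dim_psubset span_eq_iff)
    from less.hyps[OF this W(1) TW] obtain C a where C: "C \<subseteq> W" "independent C" "span C = W"
      "\<And>b. b \<in> C \<Longrightarrow> b \<in> gen_eig T (a b) \<and> representation C (T b) b = a b" by blast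
    have "\<exists>b \<in> V - W. \<exists>d. b \<in> gen_eig T d"
    proof (rule ccontr)
      assume "\<not> ?thesis"
      then have "span (\<Union>c. gen_eig T c \<inter> V) \<subseteq> W" by (intro span_minimal W) auto
      then show False using W(3) gen_eig_span[OF T less.prems] by blast
    qed
    then obtain b d where b: "b \<in> V" "b \<notin> W" "b \<in> gen_eig T d" by blast
    \<comment> \<open>Otherwise \<open>b\<close> would be a value of \<open>T - c\<close> and so lie
      in \<open>W\<close>. Equality makes the new diagonal entry agree with the eigenvalue of
      \<open>b\<close>.\<close>
    have "d = c"
    proof (rule ccontr)
      assume "d \<noteq> c"
      then obtain w where "w \<in> V" "?f w = b"
        using gen_eig_solve[OF T less.prems, of c d b] b by auto
      then show False using W(2) b(2) by auto
    qed
    have ind: "independent (insert b C)" using C b by (simp add: independent_insertI)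
    have span: "span (insert b C) = V"
    proof (rule ccontr)
      assume *: "span (insert b C) \<noteq> V"
      have "span (insert b C) \<subseteq> V" using b C W less.prems by (intro span_minimal) auto
      moreover have "W \<subseteq> span (insert b C)" using C(3) span_mono[of C "insert b C"] by auto
      ultimately have "span (insert b C) = W" using * W by (intro Wmax) auto
      then show False using b(2) span_base[of b "insert b C"] by simp
    qed
    have rep: "representation (insert b C) w = representation C w" if "w \<in> W" for w
      using representation_extend[OF ind, of w C] that C(3) by auto
    have bC: "b \<notin> C" using C b by auto
    have "b \<in> span (insert b C)" "?f b \<in> span (insert b C)"
      using b W C(3) span by (auto intro: span_base)
    then have "representation (insert b C) (?f b + c *s b) b
        = representation (insert b C) (?f b) b + c * representation (insert b C) b b"
      by (simp only: representation_add[OF ind] representation_scale[OF ind] span_scale)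
    also have "?f b \<in> W" using b W by auto
    then have "representation (insert b C) (?f b) b = 0"
      using rep[of "?f b"] bC representation_ne_zero[of C "?f b" b] by auto
    also have "representation (insert b C) b b = 1" by (simp add: representation_basis[OF ind])
    finally have "representation (insert b C) (T b) b = c" by simp
    then show ?thesis
      using span ind C b bC W \<open>d = c\<close> rep[OF TW]
      by (intro exI[of _ "insert b C"] exI[of _ "a(b := c)"]) auto
  qed
qed

text \<open>The operator \<open>y\<close> is diagonal in the triangular basis of \<open>T\<close>,
  with conjugate entries. It acts by the right scalar on whole generalised eigenspaces because their
  vectors have no components along basis vectors of other eigenvalues.\<close>

lemma conjugate_operator:
  assumes T: "endo T" and sV: "subspace V" and TV: "\<forall>v\<in>V. T v \<in> V"
  shows "\<exists>C a y. C \<subseteq> V \<and> independent C \<and> span C = V \<and> endo y \<and>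
    (\<forall>b\<in>C. b \<in> gen_eig T (a b) \<and> representation C (T b) b = a b) \<and>
    (\<forall>c. \<forall>v\<in>V. v \<in> gen_eig T c \<longrightarrow> y v = cnj c *s v)"
proof -
  note V = sV TV[rule_format]
  obtain C a where C: "C \<subseteq> V" "independent C" "span C = V"
      "\<And>b. b \<in> C \<Longrightarrow> b \<in> gen_eig T (a b) \<and> representation C (T b) b = a b"
    using triangular_basis[OF T V] by blast
  obtain y where y: "endo y" "\<And>b. b \<in> C \<Longrightarrow> y b = cnj (a b) *s b"
    using endo_extend[OF C(2), of "\<lambda>b. cnj (a b) *s b"] by blast
  have fin: "finite C" using C(2) by (rule finiteI_independent)
  have "y v = cnj c *s v" if v: "v \<in> V" "v \<in> gen_eig T c" for c v
  proof -
    let ?r = "representation C v"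
    have sum: "(\<Sum>b\<in>C. ?r b *s b) = v"
      using sum_representation_eq[OF C(2) _ fin] C(3) v by simp
    define C1 where "C1 = {b\<in>C. a b = c}"
    have C1: "C1 \<subseteq> C" "finite C1" "finite (C - C1)" using fin by (auto simp: C1_def)
    have split: "v = (\<Sum>b\<in>C1. ?r b *s b) + (\<Sum>b\<in>C - C1. ?r b *s b)"
      using sum.subset_diff[OF C1(1) fin, of "\<lambda>b. ?r b *s b"] sum by (simp add: add.commute)
    have "(\<Sum>b\<in>C1. ?r b *s b) \<in> gen_eig T c"
      using C(4) by (intro subspace_sum subspace_scale subspace_gen_eig T) (auto simp: C1_def)
    then have "v - (\<Sum>b\<in>C1. ?r b *s b) \<in> gen_eig T c"
      using v by (intro subspace_diff subspace_gen_eig T)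
    moreover have "v - (\<Sum>b\<in>C1. ?r b *s b) = (\<Sum>b\<in>C - C1. ?r b *s b)"
      using split by (simp add: diff_eq_eq add.commute)
    moreover have "(\<Sum>b\<in>C - C1. ?r b *s b) \<in> gen_eig_others T V c"
      unfolding gen_eig_others_def
      using C(1,4) by (intro span_sum span_scale span_base) (force simp: C1_def)
    ultimately have "(\<Sum>b\<in>C - C1. ?r b *s b) = 0"
      using gen_eig_independent[OF T V] by metis
    then have v1: "v = (\<Sum>b\<in>C1. ?r b *s b)" using split by simp
    have "y (\<Sum>b\<in>C1. ?r b *s b) = (\<Sum>b\<in>C1. cnj c *s (?r b *s b))"
      unfolding endo_sum[OF y(1)]
      by (rule sum.cong) (auto simp: C1_def y endo_scale[OF y(1)] algebra_simps)
    then show ?thesis using v1 by (simp only: scale_sum_right[symmetric])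
  qed
  then show ?thesis using C y(1) by blast
qed

subsection \<open>Traces on invariant subspaces\<close>

text \<open>Coordinates are taken in a basis of the whole space extending a basis of \<open>V\<close>, which makes
  the trace linear in \<open>f\<close> even for operators that do not preserve \<open>V\<close>.\<close>

definition trace_on :: "'a set \<Rightarrow> ('a \<Rightarrow> 'a) \<Rightarrow> complex" where
  "trace_on V f = (let C = (SOME C. C \<subseteq> V \<and> independent C \<and> span C = V)
     in \<Sum>b\<in>C. representation (extend_basis C) (f b) b)"

lemma representation_endo:
  assumes C: "independent C" "span C = V" and f: "endo f" "\<And>v. v \<in> V \<Longrightarrow> f v \<in> V" "u \<in> V"
  shows "representation C (f u) b = (\<Sum>c\<in>C. representation C u c * representation C (f c) b)"
proof -
  have fin: "finite C" using C(1) by (rule finiteI_independent)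
  have sum: "(\<Sum>c\<in>C. representation C u c *s c) = u"
    using sum_representation_eq[OF C(1) _ fin] C(2) f by simp
  have "representation C (f u) b = representation C (\<Sum>c\<in>C. representation C u c *s f c) b"
    by (subst sum[symmetric]) (simp add: endo_sum[OF f(1)] endo_scale[OF f(1)])
  also have "\<dots> = (\<Sum>c\<in>C. representation C u c * representation C (f c) b)"
    using C f by (subst representation_sum) (auto simp: representation_scale span_scale span_base)
  finally show ?thesis .
qed

text \<open>Expanding each \<open>b\<close> in \<open>C\<close> along \<open>C'\<close> gives a
  double sum; performed over \<open>C\<close> first, it collapses to coordinates in
  \<open>C'\<close>.\<close>

lemma trace_basis_independent:
  assumes C: "independent C" "span C = V" and C': "independent C'" "span C' = V"
    and f: "endo f" "\<And>v. v \<in> V \<Longrightarrow> f v \<in> V"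
  shows "(\<Sum>b\<in>C. representation C (f b) b) = (\<Sum>b\<in>C'. representation C' (f b) b)"
proof -
  have fin: "finite C" "finite C'" using C C' by (auto intro: finiteI_independent)
  have fC': "f w \<in> span C" if "w \<in> C'" for w
    using C C' f(2)[of w] that by (auto intro: span_base)
  have fb: "representation C (f b) b = (\<Sum>w\<in>C'. representation C' b w * representation C (f w) b)"
    if "b \<in> C" for b
  proof -
    have sum: "(\<Sum>w\<in>C'. representation C' b w *s w) = b"
      using sum_representation_eq[OF C'(1) _ fin(2)] C' C that by (metis order_refl span_base)
    have "representation C (f b) b = representation C (\<Sum>w\<in>C'. representation C' b w *s f w) b"
      using arg_cong[OF sum, of "\<lambda>u. representation C (f u) b"]
      by (simp add: endo_sum[OF f(1)] endo_scale[OF f(1)])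
    also have "\<dots> = (\<Sum>w\<in>C'. representation C' b w * representation C (f w) b)"
      using C(1) fC'
      by (subst representation_sum) (auto simp: representation_scale span_scale intro!: sum.cong)
    finally show ?thesis .
  qed
  have fw: "(\<Sum>b\<in>C. representation C u b * representation C' b w) = representation C' u w"
    if "u \<in> V" for u w
  proof -
    have sum: "(\<Sum>b\<in>C. representation C u b *s b) = u"
      using sum_representation_eq[OF C(1) _ fin(1)] C that by simp
    have "representation C' u w = representation C' (\<Sum>b\<in>C. representation C u b *s b) w"
      by (simp add: sum)
    also have "\<dots> = (\<Sum>b\<in>C. representation C u b * representation C' b w)"
    proof -
      have "b \<in> span C'" if "b \<in> C" for b using that C C' by (metis span_base)
      with C'(1) show ?thesis
        by (subst representation_sum) (auto simp: representation_scale span_scale intro!: sum.cong)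
    qed
    finally show ?thesis by simp
  qed
  have "(\<Sum>b\<in>C. representation C (f b) b)
      = (\<Sum>w\<in>C'. \<Sum>b\<in>C. representation C (f w) b * representation C' b w)"
    by (subst sum.swap) (simp add: fb mult.commute)
  also have "\<dots> = (\<Sum>w\<in>C'. representation C' (f w) w)"
    using C' f by (intro sum.cong refl fw) (auto intro: span_base)
  finally show ?thesis .
qed

lemma trace_on_basis:
  assumes V: "subspace V" and C: "independent C" "span C = V"
    and f: "endo f" "\<And>v. v \<in> V \<Longrightarrow> f v \<in> V"
  shows "trace_on V f = (\<Sum>b\<in>C. representation C (f b) b)"
proof -
  define C0 where "C0 = (SOME C. C \<subseteq> V \<and> independent C \<and> span C = V)"
  have "\<exists>C. C \<subseteq> V \<and> independent C \<and> span C = V" using subspace_basis[OF V] by metis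
  then have C0: "independent C0" "span C0 = V"
    unfolding C0_def by (rule someI2_ex, blast)+
  have "representation (extend_basis C0) (f b) = representation C0 (f b)" if "b \<in> C0" for b
    using C0 f that
    by (intro representation_extend independent_extend_basis extend_basis_superset) (auto intro: span_base)
  then have "trace_on V f = (\<Sum>b\<in>C0. representation C0 (f b) b)"
    by (simp add: trace_on_def C0_def[symmetric] Let_def)
  with trace_basis_independent[OF C0 C f] show ?thesis by simp
qed

lemma trace_on_linear:
  assumes V: "subspace V"
  shows trace_on_add: "trace_on V (\<lambda>v. f v + g v) = trace_on V f + trace_on V g"
    and trace_on_diff: "trace_on V (\<lambda>v. f v - g v) = trace_on V f - trace_on V g"
    and trace_on_scale: "trace_on V (\<lambda>v. c *s f v) = c * trace_on V f"
proof -
  define C0 where "C0 = (SOME C. C \<subseteq> V \<and> independent C \<and> span C = V)"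
  have "\<exists>C. C \<subseteq> V \<and> independent C \<and> span C = V" using subspace_basis[OF V] by metis
  then have "independent C0" unfolding C0_def by (rule someI2_ex) blast
  then have "independent (extend_basis C0)" "span (extend_basis C0) = UNIV"
    by (auto simp: independent_extend_basis)
  then show "trace_on V (\<lambda>v. f v + g v) = trace_on V f + trace_on V g"
    "trace_on V (\<lambda>v. f v - g v) = trace_on V f - trace_on V g"
    "trace_on V (\<lambda>v. c *s f v) = c * trace_on V f"
    by (simp_all add: trace_on_def C0_def[symmetric] Let_def representation_add representation_diff
        representation_scale sum.distrib sum_subtractf sum_distrib_left)
qed

lemma trace_on_cong:
  assumes V: "subspace V" and fg: "\<And>v. v \<in> V \<Longrightarrow> f v = g v"
  shows "trace_on V f = trace_on V g"
proof -
  define C0 where "C0 = (SOME C. C \<subseteq> V \<and> independent C \<and> span C = V)"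
  have "\<exists>C. C \<subseteq> V \<and> independent C \<and> span C = V" using subspace_basis[OF V] by metis
  then have "C0 \<subseteq> V" unfolding C0_def by (rule someI2_ex) blast
  then show ?thesis
    using fg by (auto simp: trace_on_def C0_def[symmetric] Let_def intro!: sum.cong)
qed

lemma trace_on_comm:
  assumes V: "subspace V" and f: "endo f" "\<And>v. v \<in> V \<Longrightarrow> f v \<in> V"
    and g: "endo g" "\<And>v. v \<in> V \<Longrightarrow> g v \<in> V"
  shows "trace_on V (\<lambda>v. f (g v)) = trace_on V (\<lambda>v. g (f v))"
proof -
  obtain C where C: "C \<subseteq> V" "independent C" "span C = V" using subspace_basis[OF V] .
  have "(\<Sum>b\<in>C. representation C (f (g b)) b)
      = (\<Sum>b\<in>C. \<Sum>c\<in>C. representation C (g b) c * representation C (f c) b)"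
    using C f g by (intro sum.cong refl representation_endo[OF C(2,3)]) auto
  also have "\<dots> = (\<Sum>c\<in>C. \<Sum>b\<in>C. representation C (f c) b * representation C (g b) c)"
    by (subst sum.swap) (simp add: mult.commute)
  also have "\<dots> = (\<Sum>b\<in>C. representation C (g (f b)) b)"
    using C f g by (intro sum.cong refl representation_endo[OF C(2,3), symmetric]) auto
  finally show ?thesis
    using trace_on_basis[OF V C(2,3), of "\<lambda>v. f (g v)"] trace_on_basis[OF V C(2,3), of "\<lambda>v. g (f v)"] f g
    by (simp add: endo_comp)
qed

lemma trace_on_scalar:
  assumes V: "subspace V"
  shows "trace_on V (\<lambda>v. c *s v) = c * of_nat (dim V)"
proof -
  obtain C where C: "C \<subseteq> V" "independent C" "span C = V" "finite C" "card C = dim V"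
    using subspace_basis[OF V] .
  have "trace_on V (\<lambda>v. c *s v) = (\<Sum>b\<in>C. representation C (c *s b) b)"
    using V by (intro trace_on_basis C) (auto simp: subspace_scale)
  also have "\<dots> = (\<Sum>b\<in>C. c)"
    using C by (intro sum.cong) (auto simp: representation_scale representation_basis span_base)
  finally show ?thesis using C by simp
qed

lemma projection_exists:
  assumes "subspace W"
  obtains p where "endo p" "\<And>w. w \<in> W \<Longrightarrow> p w = 0" "\<And>v. p v - v \<in> W"
proof -
  obtain C where C: "C \<subseteq> W" "independent C" "span C = W" using subspace_basis[OF assms] .
  let ?D = "extend_basis C"
  have D: "C \<subseteq> ?D" "independent ?D" "span ?D = UNIV"
    using C by (auto simp: extend_basis_superset[THEN subsetD] independent_extend_basis)
  obtain p where p: "endo p" "\<And>b. b \<in> ?D \<Longrightarrow> p b = (if b \<in> C then 0 else b)"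
    using endo_extend[OF D(2), of "\<lambda>b. if b \<in> C then 0 else b"] by blast
  have "p w = 0" if "w \<in> W" for w
  proof -
    have "p x \<in> {0}" if "x \<in> C" for x using p(2)[of x] D(1) that by auto
    from endo_span_subset[OF p(1) this] show ?thesis using C(3) that by auto
  qed
  moreover have "p v - v \<in> W" for v
  proof (rule endo_span_subset[OF endo_minus[OF p(1) linear_ident] _ assms])
    show "v \<in> span ?D" using D by simp
    show "p b - b \<in> W" if "b \<in> ?D" for b
      using p(2)[OF that] C(1) assms by (auto simp: subspace_neg subspace_0)
  qed
  ultimately show ?thesis using that p by blast
qed

subsection \<open>Dual bases and complements\<close>

definition bilinear_form :: "('a \<Rightarrow> 'a \<Rightarrow> complex) \<Rightarrow> bool" where
  "bilinear_form \<beta> \<longleftrightarrow>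
     (\<forall>x. Vector_Spaces.linear scale (*) (\<beta> x)) \<and> (\<forall>y. Vector_Spaces.linear scale (*) (\<lambda>x. \<beta> x y))"

lemma bilinear_formI:
  assumes "\<And>x y z. \<beta> (x + y) z = \<beta> x z + \<beta> y z" "\<And>c x y. \<beta> (c *s x) y = c * \<beta> x y"
    "\<And>x y z. \<beta> x (y + z) = \<beta> x y + \<beta> x z" "\<And>c x y. \<beta> x (c *s y) = c * \<beta> x y"
  shows "bilinear_form \<beta>"
proof -
  interpret C: vector_space "(*) :: complex \<Rightarrow> complex \<Rightarrow> complex"
    by unfold_locales (auto simp: algebra_simps)
  show ?thesis
    unfolding bilinear_form_def by (intro conjI allI; unfold_locales) (auto simp: assms)
qed

lemma bilinear_form_simps:
  assumes "bilinear_form \<beta>"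
  shows "\<beta> (x + y) z = \<beta> x z + \<beta> y z" "\<beta> (c *s x) z = c * \<beta> x z" "\<beta> (x - y) z = \<beta> x z - \<beta> y z"
    "\<beta> (- x) z = - \<beta> x z" "\<beta> 0 z = 0" "\<beta> (sum g A) z = (\<Sum>a\<in>A. \<beta> (g a) z)"
    "\<beta> x (y + z) = \<beta> x y + \<beta> x z" "\<beta> x (c *s z) = c * \<beta> x z" "\<beta> x (y - z) = \<beta> x y - \<beta> x z"
    "\<beta> x (- z) = - \<beta> x z" "\<beta> x 0 = 0" "\<beta> x (sum g A) = (\<Sum>a\<in>A. \<beta> x (g a))"
proof -
  interpret l: Vector_Spaces.linear scale "(*)" "\<lambda>x. \<beta> x z"
    using assms by (simp add: bilinear_form_def)
  interpret r: Vector_Spaces.linear scale "(*)" "\<beta> x"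
    using assms by (simp add: bilinear_form_def)
  show "\<beta> (x + y) z = \<beta> x z + \<beta> y z" "\<beta> (c *s x) z = c * \<beta> x z" "\<beta> (x - y) z = \<beta> x z - \<beta> y z"
    "\<beta> (- x) z = - \<beta> x z" "\<beta> 0 z = 0" "\<beta> (sum g A) z = (\<Sum>a\<in>A. \<beta> (g a) z)"
    "\<beta> x (y + z) = \<beta> x y + \<beta> x z" "\<beta> x (c *s z) = c * \<beta> x z" "\<beta> x (y - z) = \<beta> x y - \<beta> x z"
    "\<beta> x (- z) = - \<beta> x z" "\<beta> x 0 = 0" "\<beta> x (sum g A) = (\<Sum>a\<in>A. \<beta> x (g a))"
    by (fact l.add l.scale l.diff l.neg l.zero l.sum r.add r.scale r.diff r.neg r.zero r.sum)+
qed

text \<open>Here \<open>d\<close> sends a basis vector to its dual. The two expansions yield the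
  invariance of the Casimir sum, the diagonal values and the cardinality its trace.\<close>

definition dual_bases :: "('a \<Rightarrow> 'a \<Rightarrow> complex) \<Rightarrow> 'a set \<Rightarrow> 'a set \<Rightarrow> ('a \<Rightarrow> 'a) \<Rightarrow> bool" where
  "dual_bases \<beta> U E d \<longleftrightarrow> E \<subseteq> U \<and> finite E \<and> card E = dim U \<and> (\<forall>e\<in>E. d e \<in> U) \<and>
     (\<forall>e\<in>E. \<beta> e (d e) = 1) \<and>
     (\<forall>x\<in>U. x = (\<Sum>e\<in>E. \<beta> x (d e) *s e)) \<and> (\<forall>y\<in>U. y = (\<Sum>e\<in>E. \<beta> e y *s d e))"

text \<open>The auxiliary map \<open>g\<close> is the map from \<open>U\<close> to its dual induced
  by the form, written in coordinates. Nondegeneracy makes it bijective on \<open>U\<close>, and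
  \<open>d e\<close> is the preimage of \<open>e\<close>.\<close>

lemma dual_bases_exist:
  assumes b: "bilinear_form \<beta>" and U: "subspace U"
    and nondeg: "\<And>y. y \<in> U \<Longrightarrow> (\<And>x. x \<in> U \<Longrightarrow> \<beta> x y = 0) \<Longrightarrow> y = 0"
  shows "\<exists>E d. dual_bases \<beta> U E d"
proof -
  note bs = bilinear_form_simps[OF b]
  obtain E where E: "E \<subseteq> U" "independent E" "span E = U" "finite E" "card E = dim U"
    using subspace_basis[OF U] .
  define g where "g y = (\<Sum>e\<in>E. \<beta> e y *s e)" for y
  have g: "endo g"
    by (rule endoI) (simp_all add: g_def bs scale_left_distrib sum.distrib scale_sum_right)
  have coeffs: "u = v" if "(\<Sum>e\<in>E. u e *s e) = (\<Sum>e\<in>E. v e *s e)" "\<And>e. e \<notin> E \<Longrightarrow> u e = v e"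
    for u v :: "'a \<Rightarrow> complex"
  proof
    fix e
    have "(\<Sum>e\<in>E. (u e - v e) *s e) = 0"
      using that(1) by (simp add: scale_left_diff_distrib sum_subtractf)
    from independentD[OF E(2,4) _ this] show "u e = v e" using that(2) by (cases "e \<in> E") auto
  qed
  have span0: "y = 0" if y: "y \<in> U" "\<And>e. e \<in> E \<Longrightarrow> \<beta> e y = 0" for y
  proof (rule nondeg[OF y(1)])
    fix x assume "x \<in> U"
    then have "x \<in> span E" using E by simp
    then show "\<beta> x y = 0" by (induction rule: span_induct_alt) (auto simp: bs y)
  qed
  have "g ` U = U"
  proof (rule endo_inj_imp_surj[OF g U])
    fix y assume "y \<in> U"
    show "g y \<in> U" unfolding g_def using E U by (intro subspace_sum subspace_scale) auto
    assume "g y = 0"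
    then have "\<beta> e y = 0" if "e \<in> E" for e
      using independentD[OF E(2,4), of "\<lambda>e. \<beta> e y" e] that by (simp add: g_def)
    with \<open>y \<in> U\<close> show "y = 0" using span0 by blast
  qed
  then have "\<forall>e\<in>E. \<exists>y\<in>U. g y = e" using E(1) by (metis (no_types, lifting) imageE subsetD)
  then obtain d where d: "\<And>e. e \<in> E \<Longrightarrow> d e \<in> U \<and> g (d e) = e" by metis
  have delta: "\<beta> e (d f) = (if e = f then 1 else 0)" if "e \<in> E" "f \<in> E" for e f
  proof -
    \<comment> \<open>\<open>coeffs\<close> compares coefficient functions on the whole type, so the
      left one is padded with zero outside \<open>E\<close>.\<close>
    have "(\<Sum>e\<in>E. (if e \<in> E then \<beta> e (d f) else 0) *s e) = (\<Sum>e\<in>E. (if e = f then 1 else 0) *s e)"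
      using d[OF that(2)] that(2) E(4) by (simp add: g_def if_distrib[of "\<lambda>c. c *s _"] cong: if_cong)
    then have "(\<lambda>e. if e \<in> E then \<beta> e (d f) else 0) = (\<lambda>e. if e = f then 1 else 0)"
      by (rule coeffs) (use that in auto)
    from fun_cong[OF this, of e] show ?thesis using that(1) by simp
  qed
  have right: "y = (\<Sum>e\<in>E. \<beta> e y *s d e)" if y: "y \<in> U" for y
  proof -
    have "y - (\<Sum>e\<in>E. \<beta> e y *s d e) = 0"
    proof (rule span0)
      show "y - (\<Sum>e\<in>E. \<beta> e y *s d e) \<in> U"
        using y d U by (intro subspace_diff subspace_sum subspace_scale) auto
      fix f assume f: "f \<in> E"
      have "(\<Sum>e\<in>E. \<beta> e y * \<beta> f (d e)) = (\<Sum>e\<in>E. if e = f then \<beta> e y else 0)"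
        by (rule sum.cong) (auto simp: delta f)
      then show "\<beta> f (y - (\<Sum>e\<in>E. \<beta> e y *s d e)) = 0" using f E(4) by (simp add: bs)
    qed
    then show ?thesis by simp
  qed
  have left: "x = (\<Sum>e\<in>E. \<beta> x (d e) *s e)" if x: "x \<in> U" for x
  proof -
    have "x \<in> span E" using x E by simp
    then obtain r where r: "x = (\<Sum>e\<in>E. r e *s e)" using span_finite[OF E(4)] by auto
    have "\<beta> x (d f) = r f" if f: "f \<in> E" for f
    proof -
      have "\<beta> x (d f) = (\<Sum>e\<in>E. if e = f then r e else 0)"
        unfolding r bs by (rule sum.cong) (auto simp: delta f)
      then show ?thesis using f E(4) by simp
    qed
    then show ?thesis unfolding r by (intro sum.cong) auto
  qed
  show ?thesis
    unfolding dual_bases_def using E d delta left right by (intro exI[of _ E] exI[of _ d]) auto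
qed

text \<open>The projection to \<open>U\<close> is read off from dual bases; \<open>x\<close> itself
  may lie outside \<open>U\<close>.\<close>

lemma orthogonal_complement:
  assumes b: "bilinear_form \<beta>" and U: "subspace U"
    and nondeg: "\<And>y. y \<in> U \<Longrightarrow> (\<And>x. x \<in> U \<Longrightarrow> \<beta> x y = 0) \<Longrightarrow> y = 0"
  shows "\<exists>u\<in>U. \<forall>y\<in>U. \<beta> (x - u) y = 0"
proof -
  note bs = bilinear_form_simps[OF b]
  obtain E d where Ed: "dual_bases \<beta> U E d" using dual_bases_exist[OF assms] by blast
  let ?u = "\<Sum>e\<in>E. \<beta> x (d e) *s e"
  have u: "?u \<in> U" using Ed U by (intro subspace_sum subspace_scale) (auto simp: dual_bases_def)
  have "\<beta> (x - ?u) y = 0" if "y \<in> U" for y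
  proof -
    have y: "y = (\<Sum>e\<in>E. \<beta> e y *s d e)" using Ed that by (simp add: dual_bases_def)
    have "\<beta> x y = (\<Sum>e\<in>E. \<beta> x (d e) * \<beta> e y)" by (subst y) (simp add: bs mult.commute)
    then show ?thesis by (simp add: bs)
  qed
  with u show ?thesis by blast
qed

text \<open>Invariance of the tensor \<open>\<Sum>e. e \<otimes> d e\<close> under a skew operator:
  its matrices in the two bases are negative transposes of each other. The arbitrary bilinear
  \<open>F\<close> serves both the Casimir operator and its variant with a cocycle in the second
  slot.\<close>

lemma dual_bases_invariant:
  assumes b: "bilinear_form \<beta>" and Ed: "dual_bases \<beta> U E d"
    and T: "\<And>y. y \<in> U \<Longrightarrow> T y \<in> U" "\<And>x y. x \<in> U \<Longrightarrow> y \<in> U \<Longrightarrow> \<beta> (T x) y = - \<beta> x (T y)"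
    and F: "\<And>y. endo (\<lambda>x. F x y)" "\<And>x. endo (F x)"
  shows "(\<Sum>e\<in>E. F (T e) (d e)) + (\<Sum>e\<in>E. F e (T (d e))) = 0"
proof -
  have E: "\<And>e. e \<in> E \<Longrightarrow> e \<in> U" "\<And>e. e \<in> E \<Longrightarrow> d e \<in> U" using Ed by (auto simp: dual_bases_def)
  have 1: "F (T e) (d e) = (\<Sum>f\<in>E. \<beta> (T e) (d f) *s F f (d e))" if "e \<in> E" for e
  proof -
    have "T e = (\<Sum>f\<in>E. \<beta> (T e) (d f) *s f)"
      using Ed T(1)[OF E(1)[OF that]] unfolding dual_bases_def by blast
    then have "F (T e) (d e) = F (\<Sum>f\<in>E. \<beta> (T e) (d f) *s f) (d e)" by simp
    then show ?thesis
      by (simp add: endo_sum[OF F(1), of _ _ "d e"] endo_scale[OF F(1), of _ _ "d e"])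
  qed
  have 2: "F e (T (d e)) = (\<Sum>f\<in>E. - (\<beta> (T f) (d e) *s F e (d f)))" if "e \<in> E" for e
  proof -
    have "T (d e) = (\<Sum>f\<in>E. \<beta> f (T (d e)) *s d f)"
      using Ed T(1)[OF E(2)[OF that]] unfolding dual_bases_def by blast
    also have "\<dots> = (\<Sum>f\<in>E. (- \<beta> (T f) (d e)) *s d f)"
      using T E that by (intro sum.cong) auto
    finally have "F e (T (d e)) = F e (\<Sum>f\<in>E. (- \<beta> (T f) (d e)) *s d f)" by simp
    then show ?thesis by (simp add: endo_sum[OF F(2)] endo_scale[OF F(2)] endo_neg[OF F(2)])
  qed
  have "(\<Sum>e\<in>E. F e (T (d e))) = (\<Sum>e\<in>E. \<Sum>f\<in>E. - (\<beta> (T f) (d e) *s F e (d f)))"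
    by (rule sum.cong) (auto simp: 2)
  also have "\<dots> = (\<Sum>f\<in>E. \<Sum>e\<in>E. - (\<beta> (T f) (d e) *s F e (d f)))" by (rule sum.swap)
  finally have "(\<Sum>e\<in>E. F e (T (d e))) = (\<Sum>f\<in>E. \<Sum>e\<in>E. - (\<beta> (T f) (d e) *s F e (d f)))" .
  moreover have "(\<Sum>e\<in>E. F (T e) (d e)) = (\<Sum>e\<in>E. \<Sum>f\<in>E. \<beta> (T e) (d f) *s F f (d e))"
    by (rule sum.cong) (auto simp: 1)
  ultimately show ?thesis by (simp add: sum_negf)
qed

text \<open>In a minimal invariant subspace the eigenspace of each operator is again invariant,
  hence everything, so all of \<open>F\<close> acts there by scalars.\<close>

lemma commuting_eigenvector:
  assumes V: "subspace V" "V \<noteq> {0}"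
    and F: "\<And>f. f \<in> F \<Longrightarrow> endo f" "\<And>f v. f \<in> F \<Longrightarrow> v \<in> V \<Longrightarrow> f v \<in> V"
    and comm: "\<And>f g v. f \<in> F \<Longrightarrow> g \<in> F \<Longrightarrow> v \<in> V \<Longrightarrow> f (g v) = g (f v)"
  shows "\<exists>v\<in>V. v \<noteq> 0 \<and> (\<forall>f\<in>F. \<exists>c. f v = c *s v)"
proof -
  let ?P = "\<lambda>W. subspace W \<and> W \<noteq> {0} \<and> W \<subseteq> V \<and> (\<forall>f\<in>F. \<forall>w\<in>W. f w \<in> W)"
  have "?P V" using V F by auto
  then have "\<exists>W. ?P W \<and> (\<forall>W'. ?P W' \<longrightarrow> W' \<subseteq> W \<longrightarrow> W' = W)"
    by (rule ex_minimal_subspace) auto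
  then obtain W where W: "?P W" and min: "\<And>W'. ?P W' \<Longrightarrow> W' \<subseteq> W \<Longrightarrow> W' = W"
    by (elim exE conjE) simp
  have "\<exists>c. \<forall>w\<in>W. f w = c *s w" if f: "f \<in> F" for f
  proof -
    obtain v c where v: "v \<in> W" "v \<noteq> 0" "f v = c *s v"
      by (rule eigenvector_exists[OF F(1)[OF f], of W]) (use W f in auto)
    let ?W = "{w \<in> W. f w = c *s w}"
    have "?P ?W"
    proof (intro conjI ballI)
      show "subspace ?W" using W
        by (auto simp: subspace_def endo_add[OF F(1)[OF f]] endo_scale[OF F(1)[OF f]]
            endo_zero[OF F(1)[OF f]] scale_right_distrib scale_left_commute)
      show "?W \<noteq> {0}" using v by auto
      show "?W \<subseteq> V" using W by auto
      fix g w assume "g \<in> F" "w \<in> ?W"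
      then show "g w \<in> ?W" using W comm[OF f, of g w] endo_scale[OF F(1), of g c w] by auto
    qed
    then have "?W = W" by (rule min) auto
    then show ?thesis by blast
  qed
  moreover obtain w where "w \<in> W" "w \<noteq> 0" using W subspace_0 by blast
  moreover have "w \<in> V" using W \<open>w \<in> W\<close> by auto
  ultimately show ?thesis by (intro bexI[of _ w]) auto
qed

lemma direct_sum_projection:
  assumes B: "subspace B" and S: "subspace S" and BS: "B \<inter> S = {0}"
    and sum: "\<And>v. \<exists>b\<in>B. \<exists>s\<in>S. v = b + s"
  shows "\<exists>P. endo P \<and> (\<forall>v. P v \<in> S \<and> v - P v \<in> B)"
proof -
  have "\<forall>v. \<exists>s. s \<in> S \<and> v - s \<in> B" using sum by (metis add_diff_cancel_right')
  then obtain P where P: "\<And>v. P v \<in> S \<and> v - P v \<in> B" by metis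
  have uniq: "P v = s" if "s \<in> S" "v - s \<in> B" for v s
  proof -
    have "P v - s \<in> S" using P that S by (simp add: subspace_diff)
    moreover have "(v - s) - (v - P v) \<in> B"
      using subspace_diff[OF B that(2), of "v - P v"] P[of v] by blast
    then have "P v - s \<in> B" by simp
    ultimately have "P v - s \<in> B \<inter> S" by simp
    then show ?thesis using BS by simp
  qed
  have "endo P"
  proof (rule endoI)
    fix x y c
    have "(x - P x) + (y - P y) \<in> B" using P B by (intro subspace_add) auto
    then show "P (x + y) = P x + P y"
      using P S by (intro uniq) (auto simp: subspace_add algebra_simps)
    have "c *s (x - P x) \<in> B" using P B by (intro subspace_scale) auto
    then show "P (c *s x) = c *s P x"
      using P S by (intro uniq) (auto simp: subspace_scale algebra_simps)
  qed
  then show ?thesis using P by blast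
qed

end

sublocale left_leibniz_algebra \<subseteq> complex_vs
  by unfold_locales

context left_leibniz_algebra
begin

subsection \<open>The Leibniz kernel and solvable ideals\<close>

lemma br_simps:
  "(a + b) \<cdot> c = a \<cdot> c + b \<cdot> c" "(k *s a) \<cdot> c = k *s (a \<cdot> c)" "(a - b) \<cdot> c = a \<cdot> c - b \<cdot> c"
  "(- a) \<cdot> c = - (a \<cdot> c)" "0 \<cdot> c = 0"
  "a \<cdot> (b + c) = a \<cdot> b + a \<cdot> c" "a \<cdot> (k *s c) = k *s (a \<cdot> c)" "a \<cdot> (b - c) = a \<cdot> b - a \<cdot> c"
  "a \<cdot> (- c) = - (a \<cdot> c)" "a \<cdot> 0 = 0"
  by (fact endo_add[OF linear_br_left] endo_scale[OF linear_br_left] endo_diff[OF linear_br_left]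
    endo_neg[OF linear_br_left] endo_zero[OF linear_br_left]
    endo_add[OF linear_br_right] endo_scale[OF linear_br_right] endo_diff[OF linear_br_right]
    endo_neg[OF linear_br_right] endo_zero[OF linear_br_right])+

lemma br_br_left: "(a \<cdot> b) \<cdot> c = a \<cdot> (b \<cdot> c) - b \<cdot> (a \<cdot> c)"
  by (simp add: leibniz[of a b c])

text \<open>By \<open>br_br_left\<close> the product of \<open>a \<cdot> a\<close> with
  \<open>b\<close> is a difference of equal terms. Hence left multiplication depends only on the
  class modulo the kernel.\<close>

lemma kernel_mult_left: "n \<in> leibniz_kernel \<Longrightarrow> n \<cdot> b = 0"
  unfolding leibniz_kernel_def
  by (induction rule: span_induct_alt) (auto simp: br_simps br_br_left)

lemma subspace_kernel: "subspace leibniz_kernel"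
  by (simp add: leibniz_kernel_def)

lemma kernel_sq: "a \<cdot> a \<in> leibniz_kernel"
  unfolding leibniz_kernel_def by (rule span_base) auto

text \<open>Polarisation of squares: modulo the kernel the product is anticommutative.\<close>

lemma kernel_sym: "a \<cdot> b + b \<cdot> a \<in> leibniz_kernel"
proof -
  have "a \<cdot> b + b \<cdot> a = (a + b) \<cdot> (a + b) - a \<cdot> a - b \<cdot> b" by (simp add: br_simps)
  then show ?thesis using kernel_sq by (simp add: subspace_diff subspace_kernel)
qed

lemma kernel_mult_right:
  assumes "n \<in> leibniz_kernel" shows "x \<cdot> n \<in> leibniz_kernel"
proof (rule endo_span_subset[OF linear_br_right _ subspace_kernel assms[unfolded leibniz_kernel_def]])
  fix y assume "y \<in> {a \<cdot> a |a. True}"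
  then obtain a where "y = a \<cdot> a" by auto
  then show "x \<cdot> y \<in> leibniz_kernel" by (simp only: leibniz[of x a a] kernel_sym)
qed

lemma subspace_br_span [simp]: "subspace (br_span A B)"
  by (simp add: br_span_def)

lemma br_spanI: "a \<in> A \<Longrightarrow> b \<in> B \<Longrightarrow> a \<cdot> b \<in> br_span A B"
  unfolding br_span_def by (rule span_base) blast

lemma br_span_least:
  "(\<And>a b. a \<in> A \<Longrightarrow> b \<in> B \<Longrightarrow> a \<cdot> b \<in> W) \<Longrightarrow> subspace W \<Longrightarrow> br_span A B \<subseteq> W"
  unfolding br_span_def by (rule span_minimal) auto

lemma br_span_mono: "A \<subseteq> A' \<Longrightarrow> B \<subseteq> B' \<Longrightarrow> br_span A B \<subseteq> br_span A' B'"
  by (intro br_span_least) (auto intro: br_spanI)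

lemma derived_series_Suc': "derived_series A (Suc n) = derived_series (br_span A A) n"
  by (induction n) auto

lemma derived_series_add: "derived_series A (m + n) = derived_series (derived_series A m) n"
  by (induction n) auto

lemma derived_series_mono: "A \<subseteq> B \<Longrightarrow> derived_series A n \<subseteq> derived_series B n"
  by (induction n) (auto intro: br_span_mono[THEN subsetD])

lemma derived_series_0_mem: "0 \<in> A \<Longrightarrow> 0 \<in> derived_series A n"
  by (cases n) (auto simp: subspace_0)

lemma solvableI:
  assumes "0 \<in> A" "derived_series A n \<subseteq> J" "solvable J"
  shows "solvable A"
proof -
  from assms(3) obtain m where "derived_series J m = {0}" by (auto simp: solvable_def)
  then have "derived_series A (n + m) \<subseteq> {0}"
    using derived_series_mono[OF assms(2), of m] by (simp add: derived_series_add)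
  then show ?thesis using derived_series_0_mem[OF assms(1)] unfolding solvable_def by blast
qed

lemma solvable_zero: "solvable {0}"
  unfolding solvable_def by (rule exI[of _ 0]) simp

lemma derived_series_perfect: "br_span D D = D \<Longrightarrow> derived_series D n = D"
  by (induction n) auto

lemma ideal_derived:
  assumes "two_sided_ideal A I" shows "two_sided_ideal A (br_span I I)"
  unfolding two_sided_ideal_def
proof (intro conjI ballI subspace_br_span)
  have I: "subspace I" "I \<subseteq> A" "\<And>a x. a \<in> A \<Longrightarrow> x \<in> I \<Longrightarrow> a \<cdot> x \<in> I \<and> x \<cdot> a \<in> I"
    using assms by (auto simp: two_sided_ideal_def)
  show "br_span I I \<subseteq> A" using br_span_least[of I I I] I by blast
  fix a x assume a: "a \<in> A" and x: "x \<in> br_span I I"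
  have aI: "a \<cdot> y \<in> I" "y \<cdot> a \<in> I" if "y \<in> I" for y using I a that by auto
  have 1: "a \<cdot> (y \<cdot> z) \<in> br_span I I" if "y \<in> I" "z \<in> I" for y z
    unfolding leibniz[of a y z] by (intro subspace_add[OF subspace_br_span] br_spanI aI that)
  have 2: "(y \<cdot> z) \<cdot> a \<in> br_span I I" if "y \<in> I" "z \<in> I" for y z
    unfolding br_br_left[of y z a] by (intro subspace_diff[OF subspace_br_span] br_spanI aI that)
  show "a \<cdot> x \<in> br_span I I"
    by (rule endo_span_subset[OF linear_br_right _ subspace_br_span x[unfolded br_span_def]]) (use 1 in auto)
  show "x \<cdot> a \<in> br_span I I"
    by (rule endo_span_subset[OF linear_br_left _ subspace_br_span x[unfolded br_span_def]]) (use 2 in auto)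
qed

lemma ideal_derived_series: "two_sided_ideal A I \<Longrightarrow> two_sided_ideal A (derived_series I n)"
  by (induction n) (auto intro: ideal_derived)

text \<open>The derived series of the sum stays inside the derived series of \<open>I\<close> plus
  \<open>J\<close>, so it falls into \<open>J\<close> once that of \<open>I\<close> is exhausted;
  this avoids a quotient by \<open>J\<close>.\<close>

lemma solvable_ideal_sum:
  assumes A: "subspace A" and I: "two_sided_ideal A I" "solvable I"
    and J: "two_sided_ideal A J" "solvable J"
  defines "K \<equiv> {x + y |x y. x \<in> I \<and> y \<in> J}"
  shows "two_sided_ideal A K" "solvable K"
proof -
  have sub: "subspace I" "subspace J" "I \<subseteq> A" "J \<subseteq> A"
    and II: "\<And>a y. a \<in> A \<Longrightarrow> y \<in> I \<Longrightarrow> a \<cdot> y \<in> I \<and> y \<cdot> a \<in> I"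
    and JJ: "\<And>a y. a \<in> A \<Longrightarrow> y \<in> J \<Longrightarrow> a \<cdot> y \<in> J \<and> y \<cdot> a \<in> J"
    using I J by (auto simp: two_sided_ideal_def)
  show "two_sided_ideal A K"
    unfolding two_sided_ideal_def
  proof (intro conjI ballI)
    show "subspace K" unfolding K_def using sub by (intro subspace_sums)
    show "K \<subseteq> A" unfolding K_def using sub A by (auto intro: subspace_add)
    fix a x assume "a \<in> A" "x \<in> K"
    then show "a \<cdot> x \<in> K" "x \<cdot> a \<in> K"
      unfolding K_def using II JJ by (auto simp: br_simps; blast)+
  qed
  have "derived_series K n \<subseteq> {x + y |x y. x \<in> derived_series I n \<and> y \<in> J}" for n
  proof (induction n)
    case 0 show ?case by (simp add: K_def)
  next
    case (Suc n)
    let ?I = "derived_series I n"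
    have dI: "?I \<subseteq> A" using ideal_derived_series[OF I(1), of n] by (simp add: two_sided_ideal_def)
    have "a \<cdot> b \<in> {x + y |x y. x \<in> br_span ?I ?I \<and> y \<in> J}"
      if "a \<in> derived_series K n" "b \<in> derived_series K n" for a b
    proof -
      obtain x y x' y' where xy: "x \<in> ?I" "y \<in> J" "a = x + y" "x' \<in> ?I" "y' \<in> J" "b = x' + y'"
        using Suc \<open>a \<in> _\<close> \<open>b \<in> _\<close> by blast
      have "a \<cdot> b = x \<cdot> x' + (x \<cdot> y' + (y \<cdot> x' + y \<cdot> y'))" by (simp add: xy br_simps)
      moreover have "x \<cdot> y' + (y \<cdot> x' + y \<cdot> y') \<in> J"
        using xy JJ dI sub by (intro subspace_add) auto
      moreover have "x \<cdot> x' \<in> br_span ?I ?I" using xy by (intro br_spanI)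
      ultimately show ?thesis by blast
    qed
    then show ?case
      unfolding derived_series.simps by (intro br_span_least subspace_sums sub) auto
  qed
  moreover obtain m where "derived_series I m = {0}" using I by (auto simp: solvable_def)
  ultimately have "derived_series K m \<subseteq> J" by force
  moreover have "0 \<in> K"
    using \<open>two_sided_ideal A K\<close> by (simp add: two_sided_ideal_def subspace_0)
  ultimately show "solvable K" using J by (metis solvableI)
qed

text \<open>Justifies the definite description: a maximal solvable ideal exists by dimension, and
  because sums of solvable ideals are solvable it contains every other one.\<close>

lemma radical_properties:
  assumes A: "subspace A"
  shows radical_maximal: "maximal_solvable_ideal A (solvable_radical A)"
    and solvable_ideal_le_radical: "two_sided_ideal A I \<Longrightarrow> solvable I \<Longrightarrow> I \<subseteq> solvable_radical A"
proof -
  let ?P = "\<lambda>I. two_sided_ideal A I \<and> solvable I"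
  have "?P {0}"
    using A by (auto simp: two_sided_ideal_def br_simps solvable_zero subspace_0)
  then have "\<exists>W. ?P W \<and> (\<forall>W'. ?P W' \<longrightarrow> W \<subseteq> W' \<longrightarrow> W' = W)"
    by (rule ex_maximal_subspace) (auto simp: two_sided_ideal_def)
  then obtain W where W: "?P W" "\<And>W'. ?P W' \<Longrightarrow> W \<subseteq> W' \<Longrightarrow> W' = W"
    by (elim exE conjE) simp
  have sub0: "0 \<in> X" if "?P X" for X using that by (simp add: two_sided_ideal_def subspace_0)
  have le: "I \<subseteq> J" if "?P I" "maximal_solvable_ideal A J" for I J
  proof -
    have J: "?P J" using that(2) by (simp add: maximal_solvable_ideal_def)
    let ?K = "{x + y |x y. x \<in> I \<and> y \<in> J}"
    have K: "?P ?K" using solvable_ideal_sum[OF A, of I J] that(1) J by blast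
    have "I \<subseteq> ?K" "J \<subseteq> ?K" using sub0[OF that(1)] sub0[OF J] by force+
    with K have "?K = J" using that(2) by (simp add: maximal_solvable_ideal_def)
    with \<open>I \<subseteq> ?K\<close> show ?thesis by simp
  qed
  have max: "maximal_solvable_ideal A W" using W by (auto simp: maximal_solvable_ideal_def)
  have "J = W" if "maximal_solvable_ideal A J" for J
    using le[of J W] le[of W J] that max W(1) by (auto simp: maximal_solvable_ideal_def)
  with max have "solvable_radical A = W" unfolding solvable_radical_def by (rule the_equality)
  with max show M: "maximal_solvable_ideal A (solvable_radical A)" by simp
  show "two_sided_ideal A I \<Longrightarrow> solvable I \<Longrightarrow> I \<subseteq> solvable_radical A"
    using le M by blast
qed

subsection \<open>Modules and solvable ideals acting on them\<close>

text \<open>Linearity is required on the whole type, the module laws only on \<open>A\<close> and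
  \<open>V\<close>. Restriction to a subalgebra and composition with a projection then stay within
  the same format.\<close>

definition module_on :: "'a set \<Rightarrow> ('a \<Rightarrow> 'a \<Rightarrow> 'a) \<Rightarrow> 'a set \<Rightarrow> bool" where
  "module_on A \<rho> V \<longleftrightarrow> subspace V \<and> (\<forall>x. endo (\<rho> x)) \<and> (\<forall>v. endo (\<lambda>x. \<rho> x v)) \<and>
     (\<forall>x\<in>A. \<forall>v\<in>V. \<rho> x v \<in> V) \<and>
     (\<forall>x\<in>A. \<forall>y\<in>A. \<forall>v\<in>V. \<rho> (x \<cdot> y) v = \<rho> x (\<rho> y v) - \<rho> y (\<rho> x v))"

definition submodule :: "'a set \<Rightarrow> ('a \<Rightarrow> 'a \<Rightarrow> 'a) \<Rightarrow> 'a set \<Rightarrow> bool" where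
  "submodule A \<rho> U \<longleftrightarrow> subspace U \<and> (\<forall>x\<in>A. \<forall>u\<in>U. \<rho> x u \<in> U)"

definition irreducible_module :: "'a set \<Rightarrow> ('a \<Rightarrow> 'a \<Rightarrow> 'a) \<Rightarrow> 'a set \<Rightarrow> bool" where
  "irreducible_module A \<rho> V \<longleftrightarrow>
     V \<noteq> {0} \<and> (\<forall>U. submodule A \<rho> U \<longrightarrow> U \<subseteq> V \<longrightarrow> U = {0} \<or> U = V)"

definition maximal_submodule :: "'a set \<Rightarrow> ('a \<Rightarrow> 'a \<Rightarrow> 'a) \<Rightarrow> 'a set \<Rightarrow> 'a set \<Rightarrow> bool" where
  "maximal_submodule A \<rho> V W \<longleftrightarrow> submodule A \<rho> W \<and> W \<subset> V \<and>
     (\<forall>U. submodule A \<rho> U \<longrightarrow> W \<subseteq> U \<longrightarrow> U \<subseteq> V \<longrightarrow> U = W \<or> U = V)"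

lemma module_onD:
  assumes "module_on A \<rho> V"
  shows "subspace V" "endo (\<rho> x)" "endo (\<lambda>x. \<rho> x v)"
    "x \<in> A \<Longrightarrow> v \<in> V \<Longrightarrow> \<rho> x v \<in> V"
    "x \<in> A \<Longrightarrow> y \<in> A \<Longrightarrow> v \<in> V \<Longrightarrow> \<rho> (x \<cdot> y) v = \<rho> x (\<rho> y v) - \<rho> y (\<rho> x v)"
  using assms unfolding module_on_def by blast+

lemma module_simps:
  assumes "module_on A \<rho> V"
  shows "\<rho> (x + y) v = \<rho> x v + \<rho> y v" "\<rho> (c *s x) v = c *s \<rho> x v" "\<rho> 0 v = 0"
    "\<rho> x (v + w) = \<rho> x v + \<rho> x w" "\<rho> x (c *s v) = c *s \<rho> x v" "\<rho> x 0 = 0"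
    "\<rho> (x - y) v = \<rho> x v - \<rho> y v" "\<rho> x (v - w) = \<rho> x v - \<rho> x w"
    "\<rho> (- x) v = - \<rho> x v" "\<rho> x (- v) = - \<rho> x v"
  using endo_add[OF module_onD(3)[OF assms]] endo_scale[OF module_onD(3)[OF assms]]
    endo_zero[OF module_onD(3)[OF assms]] endo_add[OF module_onD(2)[OF assms]]
    endo_scale[OF module_onD(2)[OF assms]] endo_zero[OF module_onD(2)[OF assms]]
    endo_diff[OF module_onD(3)[OF assms]] endo_diff[OF module_onD(2)[OF assms]]
    endo_neg[OF module_onD(3)[OF assms]] endo_neg[OF module_onD(2)[OF assms]]
  by simp_all

lemma module_on_subset: "module_on A \<rho> V \<Longrightarrow> A' \<subseteq> A \<Longrightarrow> module_on A' \<rho> V"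
  unfolding module_on_def by blast

lemma left_mult_module: "subspace V \<Longrightarrow> (\<And>x v. x \<in> A \<Longrightarrow> v \<in> V \<Longrightarrow> x \<cdot> v \<in> V) \<Longrightarrow> module_on A (\<cdot>) V"
  unfolding module_on_def using linear_br_left linear_br_right br_br_left by blast

lemma ex_maximal_submodule:
  assumes "submodule A \<rho> W0" "W0 \<subset> V"
  shows "\<exists>W. maximal_submodule A \<rho> V W \<and> W0 \<subseteq> W"
proof -
  let ?P = "\<lambda>W. submodule A \<rho> W \<and> W0 \<subseteq> W \<and> W \<subset> V"
  have "?P W0" using assms by simp
  then have "\<exists>W. ?P W \<and> (\<forall>W'. ?P W' \<longrightarrow> W \<subseteq> W' \<longrightarrow> W' = W)"
    by (rule ex_maximal_subspace) (auto simp: submodule_def)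
  then obtain W where "?P W" "\<forall>W'. ?P W' \<longrightarrow> W \<subseteq> W' \<longrightarrow> W' = W" by (elim exE conjE) simp
  then show ?thesis unfolding maximal_submodule_def by (intro exI[of _ W]) auto
qed

text \<open>The quotient of a module by a submodule is realised on a linear complement: \<open>p\<close> is the
  projection along the submodule.\<close>

lemma quotient_module:
  assumes V: "module_on A \<rho> V" and W: "maximal_submodule A \<rho> V W"
  shows "\<exists>p. endo p \<and> (\<forall>v. p v = 0 \<longleftrightarrow> v \<in> W) \<and> (\<forall>x\<in>A. \<forall>v. p (\<rho> x (p v)) = p (\<rho> x v)) \<and>
    module_on A (\<lambda>x v. p (\<rho> x v)) (p ` V) \<and> irreducible_module A (\<lambda>x v. p (\<rho> x v)) (p ` V)"
proof -
  note ms = module_simps[OF V] and md = module_onD[OF V]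
  have WV: "subspace W" "W \<subset> V" "\<And>x w. x \<in> A \<Longrightarrow> w \<in> W \<Longrightarrow> \<rho> x w \<in> W"
    and max: "\<And>U. submodule A \<rho> U \<Longrightarrow> W \<subseteq> U \<Longrightarrow> U \<subseteq> V \<Longrightarrow> U = W \<or> U = V"
    using W by (auto simp: maximal_submodule_def submodule_def)
  obtain p where p: "endo p" "\<And>w. w \<in> W \<Longrightarrow> p w = 0" "\<And>v. p v - v \<in> W"
    by (rule projection_exists[OF WV(1)], rule that; blast)
  have p0: "p v = 0 \<longleftrightarrow> v \<in> W" for v
    using p(2)[of v] p(3)[of v] subspace_neg[OF WV(1), of "p v - v"] by auto
  have pp: "p (\<rho> x (p v)) = p (\<rho> x v)" if "x \<in> A" for x v
  proof -
    have "\<rho> x (p v - v) \<in> W" using WV p that by blast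
    then have "p (\<rho> x (p v - v)) = 0" by (rule p(2))
    then show ?thesis by (simp add: ms endo_diff[OF p(1)])
  qed
  have ppp: "p (p v) = p v" for v using p(2)[OF p(3)[of v]] by (simp add: endo_diff[OF p(1)])
  have pV: "p v \<in> V" if "v \<in> V" for v
  proof -
    have "(p v - v) + v \<in> V" using p(3)[of v] WV(2) that by (intro subspace_add md) auto
    then show ?thesis by simp
  qed
  have mod: "module_on A (\<lambda>x v. p (\<rho> x v)) (p ` V)"
    unfolding module_on_def
  proof (intro conjI allI ballI)
    show "subspace (p ` V)" by (rule endo_image_subspace) (fact p md)+
    show "endo (\<lambda>v. p (\<rho> x v))" for x by (rule endo_comp[OF p(1) md(2)])
    show "endo (\<lambda>x. p (\<rho> x v))" for v by (rule endo_comp[OF p(1) md(3)])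
    show "p (\<rho> x v) \<in> p ` V" if "x \<in> A" "v \<in> p ` V" for x v
      using that md(4) pV by blast
    show "p (\<rho> (x \<cdot> y) v) = p (\<rho> x (p (\<rho> y v))) - p (\<rho> y (p (\<rho> x v)))"
      if "x \<in> A" "y \<in> A" "v \<in> p ` V" for x y v
    proof -
      have "v \<in> V" using that pV by auto
      then show ?thesis using that by (simp add: md pp endo_diff[OF p(1)])
    qed
  qed
  have irr: "irreducible_module A (\<lambda>x v. p (\<rho> x v)) (p ` V)"
    unfolding irreducible_module_def
  proof (intro conjI allI impI)
    show "p ` V \<noteq> {0}" using WV(2) p0 by blast
    fix U assume U: "submodule A (\<lambda>x v. p (\<rho> x v)) U" "U \<subseteq> p ` V"
    define U' where "U' = {v \<in> V. p v \<in> U}"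
    have "submodule A \<rho> U'"
      unfolding submodule_def
    proof (intro conjI ballI)
      show "subspace U'" unfolding U'_def
        using U by (intro endo_vimage_subspace p md) (auto simp: submodule_def)
      fix x u assume "x \<in> A" "u \<in> U'"
      then have "p (\<rho> x (p u)) \<in> U" "\<rho> x u \<in> V" using U md(4) by (auto simp: submodule_def U'_def)
      then show "\<rho> x u \<in> U'" using pp[OF \<open>x \<in> A\<close>, of u] by (simp add: U'_def)
    qed
    moreover have "W \<subseteq> U'"
      using WV(2) p(2) U by (auto simp: U'_def submodule_def subspace_0)
    ultimately have "U' = W \<or> U' = V" by (rule max) (auto simp: U'_def)
    moreover have img: "p ` U' = U"
      using U(2) ppp pV by (force simp: U'_def)
    ultimately show "U = {0} \<or> U = p ` V"
    proof (elim disjE)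
      assume "U' = W"
      then have "U \<subseteq> {0}" using img p(2) by auto
      then show ?thesis using U(1) by (auto simp: submodule_def dest: subspace_0)
    qed (use img in auto)
  qed
  show ?thesis using p(1) p0 pp mod irr by (intro exI[of _ p] conjI) auto
qed

text \<open>With \<open>w\<^sub>i = x\<^sup>i v\<close> one has \<open>r w\<^sub>i \<equiv> \<mu> r w\<^sub>i + i \<mu>([r, x]) w\<^bsub>i-1\<^esub>\<close> modulo
  \<open>w\<^sub>0, \<dots>, w\<^bsub>i-2\<^esub>\<close>; comparing both sides at the first linear dependence between the \<open>w\<^sub>i\<close>
  forces \<open>\<mu>([r, x]) = 0\<close>.\<close>

lemma lie_invariance:
  assumes V: "module_on A \<rho> V" and R: "R \<subseteq> A" "\<And>r x. r \<in> R \<Longrightarrow> x \<in> A \<Longrightarrow> r \<cdot> x \<in> R"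
    and v: "v \<in> V" "v \<noteq> 0" "\<And>r. r \<in> R \<Longrightarrow> \<rho> r v = \<mu> r *s v" and x: "x \<in> A" and r: "r \<in> R"
  shows "\<mu> (r \<cdot> x) = 0"
proof -
  note ms = module_simps[OF V] and md = module_onD[OF V]
  define w where "w i = (\<rho> x ^^ i) v" for i
  define U where "U i = span (w ` {..<i})" for i
  have wS: "w (Suc i) = \<rho> x (w i)" for i by (simp add: w_def)
  have wV: "w i \<in> V" for i by (induction i) (simp_all add: w_def v md x)
  have subU: "subspace (U i)" for i by (simp add: U_def)
  have wU: "w i \<in> U j" if "i < j" for i j unfolding U_def using that by (intro span_base) auto
  have mono: "U i \<subseteq> U j" if "i \<le> j" for i j unfolding U_def using that by (intro span_mono) auto
  have shift: "\<rho> x u \<in> U (Suc i)" if "u \<in> U i" for u i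
    using that unfolding U_def
    by (rule endo_span_subset[OF md(2), rotated 2]) (auto simp: wS[symmetric] intro!: span_base)
  define d where "d r i = \<rho> r (w i) - \<mu> r *s w i" for r i
  \<comment> \<open>At \<open>i = 0\<close> the truncated index \<open>i - 1\<close> is harmless:
    the coefficient \<open>of_nat i\<close> vanishes, and \<open>U 0\<close> is the zero
    space.\<close>
  have step: "d r i - (of_nat i * \<mu> (r \<cdot> x)) *s w (i - 1) \<in> U (i - 1)" if "r \<in> R" for r i
    using that
  proof (induction i arbitrary: r)
    case 0 then show ?case by (simp add: d_def w_def v subspace_0[OF subU])
  next
    case (Suc i)
    have dU: "d s i \<in> U i" if "s \<in> R" for s
    proof (cases i)
      case 0 then show ?thesis using that by (simp add: d_def w_def v subspace_0[OF subU])
    next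
      case (Suc j)
      have "d s i - (of_nat i * \<mu> (s \<cdot> x)) *s w j \<in> U i" "w j \<in> U i"
        using Suc.IH[OF that] mono[of j i] wU[of j i] Suc by auto
      then show ?thesis using subspace_add[OF subU _ subspace_scale[OF subU]] by (metis diff_add_cancel)
    qed
    have rx: "r \<cdot> x \<in> R" using Suc.prems x R by blast
    have "r \<in> A" using Suc.prems R by blast
    then have comm: "\<rho> (r \<cdot> x) (w i) = \<rho> r (\<rho> x (w i)) - \<rho> x (\<rho> r (w i))"
      using x wV by (simp add: md)
    have x1: "\<rho> x (d r i - (of_nat i * \<mu> (r \<cdot> x)) *s w (i - 1)) \<in> U i"
    proof (cases i)
      case 0 then show ?thesis using Suc.prems by (simp add: d_def w_def v ms subspace_0[OF subU])
    next
      case (Suc j) then show ?thesis using Suc.IH[OF Suc.prems] shift[of _ j] by simp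
    qed
    have "of_nat i *s \<rho> x (w (i - 1)) = of_nat i *s w i" by (cases i) (simp_all add: wS)
    then have wi: "(of_nat i * c) *s \<rho> x (w (i - 1)) = (of_nat i * c) *s w i" for c
      by (metis mult.commute scale_scale)
    have "d r (Suc i) - (of_nat (Suc i) * \<mu> (r \<cdot> x)) *s w i
        = \<rho> x (d r i - (of_nat i * \<mu> (r \<cdot> x)) *s w (i - 1)) + d (r \<cdot> x) i"
      unfolding ms wi by (simp add: d_def comm wS ms algebra_simps)
    also have "\<dots> \<in> U i" using x1 dU[OF rx] by (rule subspace_add[OF subU])
    finally show ?case by simp
  qed
  have dU: "d r i \<in> U i" for i
  proof (cases i)
    case 0 then show ?thesis using r by (simp add: d_def w_def v subspace_0[OF subU])
  next
    case (Suc j)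
    then have "d r i - (of_nat i * \<mu> (r \<cdot> x)) *s w j \<in> U i" "w j \<in> U i"
      using step[OF r, of i] mono[of j i] wU[of j i] by auto
    then show ?thesis using subspace_add[OF subU _ subspace_scale[OF subU]] by (metis diff_add_cancel)
  qed
  define n where "n = (LEAST k. w k \<in> U k)"
  have "\<exists>k. w k \<in> U k" using sequence_dependent[of w] by (simp add: U_def)
  then have n: "w n \<in> U n" unfolding n_def by (rule LeastI_ex)
  have "n \<noteq> 0"
  proof
    assume "n = 0"
    with n show False using v by (simp add: U_def w_def)
  qed
  then obtain m where m: "n = Suc m" by (cases n) auto
  have wm: "w m \<notin> U m" using not_less_Least[of m "\<lambda>k. w k \<in> U k"] m by (simp add: n_def)
  \<comment> \<open>The space \<open>U n\<close> is spanned by \<open>w 0\<close>, ...,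
    \<open>w m\<close>, each of which this operator sends into \<open>U m\<close>. As
    \<open>w n\<close> lies in \<open>U n\<close>, the leading term given by \<open>step\<close>
    must itself lie in \<open>U m\<close>.\<close>
  have "\<rho> r u - \<mu> r *s u \<in> U m" if "u \<in> U n" for u
  proof (rule endo_span_subset[OF _ _ subU that[unfolded U_def]])
    show "endo (\<lambda>u. \<rho> r u - \<mu> r *s u)" by (intro endo_minus md endo_scaled linear_ident)
    fix y assume "y \<in> w ` {..<n}"
    then obtain i where "i \<le> m" "y = w i" using m by (auto simp: less_Suc_eq_le)
    then show "\<rho> r y - \<mu> r *s y \<in> U m" using dU[of i] mono[of i m] by (auto simp: d_def)
  qed
  from this[OF n] have "d r n \<in> U m" by (simp add: d_def)
  from subspace_diff[OF subU this] step[OF r, of n] m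
  have "(of_nat n * \<mu> (r \<cdot> x)) *s w m \<in> U m" by fastforce
  then have *: "inverse (of_nat n * \<mu> (r \<cdot> x)) *s (of_nat n * \<mu> (r \<cdot> x)) *s w m \<in> U m"
    by (rule subspace_scale[OF subU])
  show ?thesis
  proof (rule ccontr)
    assume "\<mu> (r \<cdot> x) \<noteq> 0"
    then have "inverse (of_nat n * \<mu> (r \<cdot> x)) * (of_nat n * \<mu> (r \<cdot> x)) = 1"
      using m by (intro left_inverse) (simp del: of_nat_Suc)
    then show False using * wm by (metis scale_scale scale_one)
  qed
qed

lemma irreducible_dim: "module_on A \<rho> V \<Longrightarrow> irreducible_module A \<rho> V \<Longrightarrow> dim V \<noteq> 0"
  using dim_eq_0[of V] subspace_0[OF module_onD(1)] by (auto simp: irreducible_module_def)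

lemma trace_commutator:
  assumes V: "module_on A \<rho> V" and xy: "x \<in> A" "y \<in> A"
  shows "trace_on V (\<rho> (x \<cdot> y)) = 0"
proof -
  note md = module_onD[OF V]
  have "trace_on V (\<rho> (x \<cdot> y)) = trace_on V (\<lambda>v. \<rho> x (\<rho> y v) - \<rho> y (\<rho> x v))"
    using xy by (intro trace_on_cong md)
  also have "\<dots> = trace_on V (\<lambda>v. \<rho> x (\<rho> y v)) - trace_on V (\<lambda>v. \<rho> y (\<rho> x v))"
    by (rule trace_on_diff[OF md(1)])
  also have "trace_on V (\<lambda>v. \<rho> x (\<rho> y v)) = trace_on V (\<lambda>v. \<rho> y (\<rho> x v))"
    using xy by (intro trace_on_comm md)
  finally show ?thesis by simp
qed

text \<open>A form of Lie's theorem, by induction on derived length. Once brackets in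
  \<open>B\<close> act as zero, \<open>B\<close> acts by commuting operators with a common
  eigenvector; its weight space is a submodule by \<open>lie_invariance\<close>, hence all of
  \<open>V\<close>.\<close>

lemma solvable_ideal_scalar:
  assumes V: "module_on A \<rho> V" and irr: "irreducible_module A \<rho> V"
    and B: "two_sided_ideal A B" "solvable B" and r: "r \<in> B"
  shows "\<exists>c. \<forall>v\<in>V. \<rho> r v = c *s v"
proof -
  note ms = module_simps[OF V] and md = module_onD[OF V]
  obtain n where "derived_series B n = {0}" using B(2) by (auto simp: solvable_def)
  with B(1) r show ?thesis
  proof (induction n arbitrary: B r)
    case 0
    then show ?case by (intro exI[of _ 0]) (auto simp: ms)
  next
    case (Suc n)
    have BA: "B \<subseteq> A" and BI: "\<And>a x. a \<in> A \<Longrightarrow> x \<in> B \<Longrightarrow> a \<cdot> x \<in> B \<and> x \<cdot> a \<in> B"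
      using Suc.prems by (auto simp: two_sided_ideal_def)
    have comm: "\<rho> x (\<rho> y v) = \<rho> y (\<rho> x v)" if xy: "x \<in> B" "y \<in> B" and v: "v \<in> V" for x y v
    proof -
      obtain c where c: "\<forall>v\<in>V. \<rho> (x \<cdot> y) v = c *s v"
        using Suc.IH[OF ideal_derived[OF Suc.prems(1)] br_spanI[OF xy]] Suc.prems(3)
        unfolding derived_series_Suc' by blast
      \<comment> \<open>A bracket acts with trace zero, so in characteristic zero the scalar by
        which it acts vanishes.\<close>
      have "c * of_nat (dim V) = trace_on V (\<rho> (x \<cdot> y))"
        using c trace_on_cong[OF md(1), of "\<rho> (x \<cdot> y)" "\<lambda>v. c *s v"] trace_on_scalar[OF md(1)] by simp
      also have "\<dots> = 0" using BA xy by (intro trace_commutator[OF V]) auto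
      finally have "c = 0" using irreducible_dim[OF V irr] by simp
      then show ?thesis using c v md(5)[of x y v] xy BA by auto
    qed
    have "V \<noteq> {0}" using irr by (simp add: irreducible_module_def)
    have "\<exists>v\<in>V. v \<noteq> 0 \<and> (\<forall>f\<in>\<rho> ` B. \<exists>c. f v = c *s v)"
      by (rule commuting_eigenvector[OF md(1) \<open>V \<noteq> {0}\<close>]) (use md comm BA in auto)
    then obtain v \<mu> where v: "v \<in> V" "v \<noteq> 0" "\<And>r. r \<in> B \<Longrightarrow> \<rho> r v = \<mu> r *s v"
      by simp metis
    define U where "U = {u \<in> V. \<forall>r\<in>B. \<rho> r u = \<mu> r *s u}"
    have "submodule A \<rho> U"
      unfolding submodule_def
    proof (intro conjI ballI)
      show "subspace U"
        using md(1) by (auto simp: U_def subspace_def ms scale_right_distrib scale_left_commute)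
      fix x u assume x: "x \<in> A" and u: "u \<in> U"
      have "\<rho> r (\<rho> x u) = \<mu> r *s \<rho> x u" if r: "r \<in> B" for r
      proof -
        have "\<mu> (r \<cdot> x) = 0" using lie_invariance[OF V BA _ v x r] BI by blast
        then have "\<rho> (r \<cdot> x) u = 0" using u BI[OF x r] by (auto simp: U_def)
        then show ?thesis using md(5)[of r x u] r BA x u by (auto simp: U_def ms)
      qed
      then show "\<rho> x u \<in> U" using x u md(4) by (auto simp: U_def)
    qed
    moreover have "U \<noteq> {0}" using v by (auto simp: U_def)
    ultimately have "U = V" using irr by (auto simp: irreducible_module_def U_def)
    then show ?case using Suc.prems(2) by (auto simp: U_def)
  qed
qed

lemma solvable_ideal_scalar_quotient:
  assumes V: "module_on A \<rho> V" and W: "maximal_submodule A \<rho> V W"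
    and B: "two_sided_ideal A B" "solvable B" and r: "r \<in> B"
  shows "\<exists>c. \<forall>v\<in>V. \<rho> r v - c *s v \<in> W"
proof -
  obtain p where p: "endo p" "module_on A (\<lambda>x v. p (\<rho> x v)) (p ` V)"
    "irreducible_module A (\<lambda>x v. p (\<rho> x v)) (p ` V)"
    and p0: "\<forall>v. p v = 0 \<longleftrightarrow> v \<in> W" and pp: "\<forall>x\<in>A. \<forall>v. p (\<rho> x (p v)) = p (\<rho> x v)"
    using quotient_module[OF V W] by (elim exE conjE) (rule that)
  obtain c where c: "\<forall>v\<in>p ` V. p (\<rho> r v) = c *s v"
    using solvable_ideal_scalar[OF p(2,3) B r] by blast
  have "r \<in> A" using B r by (auto simp: two_sided_ideal_def)
  have "p (\<rho> r v - c *s v) = 0" if "v \<in> V" for v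
    using c that pp[rule_format, OF \<open>r \<in> A\<close>, of v] by (simp add: endo_diff[OF p(1)] endo_scale[OF p(1)])
  then show ?thesis using p0 by blast
qed

section \<open>Engel's theorem in a form yielding solvability\<close>

lemma lie_anticomm:
  assumes "lie_subalgebra K" "x \<in> K" "y \<in> K" shows "x \<cdot> y = - (y \<cdot> x)"
proof -
  have K: "subspace K" "\<And>z. z \<in> K \<Longrightarrow> z \<cdot> z = 0"
    using assms(1) by (auto simp: lie_subalgebra_def subalgebra_def)
  have "(x + y) \<cdot> (x + y) = 0" using K assms by (simp add: subspace_add)
  then show ?thesis using K assms by (simp add: br_simps eq_neg_iff_add_eq_0 add.commute)
qed

text \<open>A maximal solvable subalgebra \<open>H\<close> acts by scalars on a minimal step
  \<open>U\<close> above it; nilpotence makes these zero, so adjoining one vector of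
  \<open>U\<close> to \<open>H\<close> gives a larger solvable subalgebra.\<close>

lemma engel_solvable:
  assumes K: "lie_subalgebra K" and nil: "\<And>x. x \<in> K \<Longrightarrow> K \<subseteq> gen_eig (\<lambda>y. x \<cdot> y) 0"
  shows "solvable K"
proof -
  have sK: "subspace K" and KK: "\<And>a b. a \<in> K \<Longrightarrow> b \<in> K \<Longrightarrow> a \<cdot> b \<in> K"
    and sq: "\<And>a. a \<in> K \<Longrightarrow> a \<cdot> a = 0"
    using K by (auto simp: lie_subalgebra_def subalgebra_def)
  let ?P = "\<lambda>H. subalgebra H \<and> H \<subseteq> K \<and> solvable H"
  have "?P {0}" using sK by (auto simp: subalgebra_def br_simps solvable_zero subspace_0)
  then have "\<exists>H. ?P H \<and> (\<forall>H'. ?P H' \<longrightarrow> H \<subseteq> H' \<longrightarrow> H' = H)"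
    by (rule ex_maximal_subspace) (auto simp: subalgebra_def)
  then obtain H where H: "?P H" and max: "\<And>H'. ?P H' \<Longrightarrow> H \<subseteq> H' \<Longrightarrow> H' = H"
    by (elim exE conjE) simp
  have sH: "subspace H" and HH: "\<And>a b. a \<in> H \<Longrightarrow> b \<in> H \<Longrightarrow> a \<cdot> b \<in> H" and HK: "H \<subseteq> K"
    using H by (auto simp: subalgebra_def)
  have "H = K"
  proof (rule ccontr)
    assume "H \<noteq> K"
    let ?Q = "\<lambda>U. submodule H (\<cdot>) U \<and> H \<subset> U \<and> U \<subseteq> K"
    have "?Q K" using sK KK HK \<open>H \<noteq> K\<close> by (auto simp: submodule_def)
    then have "\<exists>U. ?Q U \<and> (\<forall>U'. ?Q U' \<longrightarrow> U' \<subseteq> U \<longrightarrow> U' = U)"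
      by (rule ex_minimal_subspace) (auto simp: submodule_def)
    then obtain U where U: "?Q U" and min: "\<And>U'. ?Q U' \<Longrightarrow> U' \<subseteq> U \<Longrightarrow> U' = U"
      by (elim exE conjE) simp
    have sU: "subspace U" and HU: "\<And>h u. h \<in> H \<Longrightarrow> u \<in> U \<Longrightarrow> h \<cdot> u \<in> U"
      using U by (auto simp: submodule_def)
    have mod: "module_on H (\<cdot>) U" using sU HU by (rule left_mult_module)
    have maxsub: "maximal_submodule H (\<cdot>) U H"
      unfolding maximal_submodule_def
    proof (intro conjI allI impI)
      show "submodule H (\<cdot>) H" using sH HH by (simp add: submodule_def)
      show "H \<subset> U" using U by simp
      fix X assume "submodule H (\<cdot>) X" "H \<subseteq> X" "X \<subseteq> U"
      then show "X = H \<or> X = U" using min[of X] U by auto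
    qed
    have idl: "two_sided_ideal H H" using sH HH by (simp add: two_sided_ideal_def)
    have HUH: "h \<cdot> u \<in> H" if h: "h \<in> H" and u: "u \<in> U" for h u
    proof -
      obtain c where c: "\<forall>u\<in>U. h \<cdot> u - c *s u \<in> H"
        using solvable_ideal_scalar_quotient[OF mod maxsub idl _ h] H by blast
      \<comment> \<open>With a nonzero scalar modulo \<open>H\<close>, \<open>h \<cdot> z\<close> in
        \<open>H\<close> would force \<open>z\<close> in \<open>H\<close>; climbing the nilpotent
        chain of \<open>h\<close> would put all of \<open>U\<close> into \<open>H\<close>.\<close>
      have "c = 0"
      proof (rule ccontr)
        assume "c \<noteq> 0"
        have "z \<in> H" if "z \<in> gen_eig (\<lambda>y. h \<cdot> y) 0" "z \<in> U" for z
          using that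
        proof induction
          case gen_eig_zero show ?case using sH by (rule subspace_0)
        next
          case (gen_eig_step z)
          then have "h \<cdot> z \<in> H" using HU[OF h] by simp
          from subspace_diff[OF sH this] c gen_eig_step.prems
          have "h \<cdot> z - (h \<cdot> z - c *s z) \<in> H" by blast
          then have "c *s z \<in> H" by simp
          from subspace_scale[OF sH this, of "inverse c"] show ?case using \<open>c \<noteq> 0\<close> by simp
        qed
        then have "U \<subseteq> H" using nil[of h] h HK U by blast
        then show False using U by blast
      qed
      then show ?thesis using c u by auto
    qed
    obtain u where u: "u \<in> U" "u \<notin> H" using U by blast
    then have uK: "u \<in> K" using U by blast
    let ?H = "span (insert u H)"
    have mem: "\<exists>k h. h \<in> H \<and> z = h + k *s u" if z: "z \<in> ?H" for z
    proof -
      obtain k where "z - k *s u \<in> span H" using z unfolding span_breakdown_eq by blast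
      then have "z - k *s u \<in> H" using sH by (metis span_eq_iff)
      then show ?thesis by (intro exI[of _ k] exI[of _ "z - k *s u"]) simp
    qed
    have prod: "a \<cdot> b \<in> H" if ab: "a \<in> ?H" "b \<in> ?H" for a b
    proof -
      obtain h k h' k' where hk: "h \<in> H" "a = h + k *s u" "h' \<in> H" "b = h' + k' *s u"
        using mem[OF ab(1)] mem[OF ab(2)] by blast
      have uh: "u \<cdot> h' = - (h' \<cdot> u)" using lie_anticomm[OF K uK] hk HK by blast
      have "a \<cdot> b = h \<cdot> h' + k' *s (h \<cdot> u) - k *s (h' \<cdot> u)"
        by (simp add: hk br_simps uh sq[OF uK])
      also have "\<dots> \<in> H"
        using hk HH HUH[OF _ u(1)] sH by (intro subspace_diff subspace_add subspace_scale) auto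
      finally show ?thesis .
    qed
    have HH': "H \<subseteq> ?H" by (auto intro: span_base)
    have "?P ?H"
    proof (intro conjI)
      show "subalgebra ?H" using prod HH' by (auto simp: subalgebra_def)
      show "?H \<subseteq> K" using uK HK sK by (intro span_minimal) auto
      have "derived_series ?H 1 \<subseteq> H" using prod sH by (simp add: br_span_least)
      then show "solvable ?H" using H span_zero by (meson solvableI)
    qed
    then have "?H = H" using HH' by (rule max)
    then show False using u(2) span_base[of u "insert u H"] by auto
  qed
  then show ?thesis using H by simp
qed

subsection \<open>Cartan's criterion\<close>

text \<open>Eigenvalues add, because \<open>x - (a + b)\<close> applied to \<open>\<rho> u w\<close>
  is the sum of the terms with \<open>x - a\<close> applied to \<open>u\<close> and with
  \<open>x - b\<close> applied to \<open>w\<close>. The induction is nested: on \<open>u\<close> for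
  all \<open>w\<close>, then on \<open>w\<close>.\<close>

lemma gen_eig_module_shift:
  assumes V: "module_on A \<rho> V" and x: "x \<in> A"
    and A: "\<And>y. y \<in> A \<Longrightarrow> x \<cdot> y \<in> A" "subspace A"
    and u: "u \<in> gen_eig (\<lambda>y. x \<cdot> y) a" "u \<in> A" and w: "w \<in> gen_eig (\<rho> x) b" "w \<in> V"
  shows "\<rho> u w \<in> gen_eig (\<rho> x) (a + b)"
proof -
  note ms = module_simps[OF V] and md = module_onD[OF V]
  from u w show ?thesis
  proof (induction arbitrary: w)
    case gen_eig_zero then show ?case by (simp add: ms gen_eig.gen_eig_zero)
  next
    case (gen_eig_step u)
    have Au: "x \<cdot> u - a *s u \<in> A"
      using A gen_eig_step.prems by (intro subspace_diff subspace_scale) auto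
    from gen_eig_step.prems(2,3) show ?case
    proof (induction w)
      case gen_eig_zero then show ?case by (simp add: ms gen_eig.gen_eig_zero)
    next
      case (gen_eig_step w)
      have wV: "\<rho> x w - b *s w \<in> V"
        using md x gen_eig_step.prems by (intro subspace_diff subspace_scale) auto
      have wg: "w \<in> gen_eig (\<rho> x) b" using gen_eig_step.hyps by (rule gen_eig.gen_eig_step)
      have "\<rho> x (\<rho> u w) - (a + b) *s \<rho> u w = \<rho> (x \<cdot> u - a *s u) w + \<rho> u (\<rho> x w - b *s w)"
        using md(5)[OF x \<open>u \<in> A\<close> gen_eig_step.prems] by (simp add: ms algebra_simps)
      also have "\<dots> \<in> gen_eig (\<rho> x) (a + b)"
        using \<open>\<And>w. _ \<Longrightarrow> _ \<Longrightarrow> _ \<Longrightarrow> \<rho> (x \<cdot> u - a *s u) w \<in> _\<close>[OF Au wg gen_eig_step.prems]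
          gen_eig_step.IH[OF wV]
        by (rule subspace_add[OF subspace_gen_eig[OF md(2)]])
      finally show ?case by (rule gen_eig.gen_eig_step)
    qed
  qed
qed

text \<open>For \<open>x \<in> K\<close> let \<open>y\<close> act as the conjugate of the eigenvalue on each generalised eigenspace of
  \<open>x\<close>. The trace of \<open>x y\<close> is the sum of the squared moduli of the eigenvalues of \<open>x\<close>. On the other
  hand \<open>[K, y] \<subseteq> K\<close> and \<open>x\<close> is a sum of commutators \<open>[u, v]\<close> of elements of \<open>K\<close>, so that the trace
  of \<open>x y\<close> is a sum of traces of \<open>u [v, y]\<close>, all of which vanish.\<close>

lemma cartan_nilpotent:
  assumes K: "subalgebra K" "br_span K K = K" and V: "module_on K \<rho> V"
    and tr: "\<And>x y. x \<in> K \<Longrightarrow> y \<in> K \<Longrightarrow> trace_on V (\<lambda>v. \<rho> x (\<rho> y v)) = 0" and x: "x \<in> K"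
  shows "V \<subseteq> gen_eig (\<rho> x) 0"
proof -
  note ms = module_simps[OF V] and md = module_onD[OF V]
  have sK: "subspace K" and KK: "\<And>a b. a \<in> K \<Longrightarrow> b \<in> K \<Longrightarrow> a \<cdot> b \<in> K"
    using K by (auto simp: subalgebra_def)
  have xV: "\<forall>v\<in>V. \<rho> x v \<in> V" using md(4)[OF x] by blast
  obtain C a y where C: "C \<subseteq> V" "independent C" "span C = V" and y: "endo y"
    and Ca': "\<forall>b\<in>C. b \<in> gen_eig (\<rho> x) (a b) \<and> representation C (\<rho> x b) b = a b"
    and ye': "\<forall>c. \<forall>v\<in>V. v \<in> gen_eig (\<rho> x) c \<longrightarrow> y v = cnj c *s v"
    using conjugate_operator[OF md(2) md(1) xV] by (elim exE conjE) (rule that)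
  note Ca = Ca'[rule_format] and ye = ye'[rule_format]
  have yV: "y v \<in> V" if "v \<in> V" for v
  proof (rule endo_span_subset[OF y _ md(1)])
    show "v \<in> span C" using that C by simp
    fix b assume "b \<in> C"
    then have "b \<in> V" "y b = cnj (a b) *s b" using C(1) Ca[of b] ye[of b "a b"] by auto
    then show "y b \<in> V" using md(1) by (simp add: subspace_scale)
  qed
  \<comment> \<open>If \<open>u\<close> has eigenvalue \<open>\<alpha>\<close> under
    \<open>x\<close>, it raises eigenvalues on \<open>V\<close> by \<open>\<alpha>\<close>, so its
    commutator with \<open>y\<close> is \<open>- cnj \<alpha>\<close> times \<open>u\<close>. Such
    \<open>u\<close> span \<open>K\<close>.\<close>
  have comm: "\<exists>v'\<in>K. \<forall>w\<in>V. \<rho> v (y w) - y (\<rho> v w) = \<rho> v' w" if "v \<in> K" for v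
  proof -
    have "v \<in> span (\<Union>c. gen_eig (\<lambda>z. x \<cdot> z) c \<inter> K)"
      using that KK[OF x] by (intro gen_eig_span linear_br_right sK) auto
    then show ?thesis
    proof (induction rule: span_induct_alt)
      case base
      show ?case by (rule bexI[of _ 0]) (auto simp: ms endo_zero[OF y] subspace_0[OF sK])
    next
      case (step k u v)
      then obtain \<alpha> where u: "u \<in> gen_eig (\<lambda>z. x \<cdot> z) \<alpha>" "u \<in> K" by auto
      have "\<rho> u (y w) - y (\<rho> u w) - (- cnj \<alpha>) *s \<rho> u w \<in> {0}" if "w \<in> V" for w
      proof (rule endo_span_subset[where f = "\<lambda>w. \<rho> u (y w) - y (\<rho> u w) - (- cnj \<alpha>) *s \<rho> u w"])
        show "w \<in> span C" using that C by simp
        show "endo (\<lambda>w. \<rho> u (y w) - y (\<rho> u w) - (- cnj \<alpha>) *s \<rho> u w)"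
          by (intro endo_minus endo_scaled endo_comp[OF md(2) y] endo_comp[OF y md(2)] md)
        fix b assume b: "b \<in> C"
        then have "b \<in> V" using C by auto
        have "\<rho> u b \<in> gen_eig (\<rho> x) (\<alpha> + a b)"
          using gen_eig_module_shift[OF V x _ sK u] KK[OF x] Ca[OF b] \<open>b \<in> V\<close> by blast
        then have "y (\<rho> u b) = cnj (\<alpha> + a b) *s \<rho> u b" using u \<open>b \<in> V\<close> md(4) ye by blast
        moreover have "y b = cnj (a b) *s b" using ye Ca[OF b] \<open>b \<in> V\<close> by blast
        ultimately show "\<rho> u (y b) - y (\<rho> u b) - (- cnj \<alpha>) *s \<rho> u b \<in> {0}"
          by (simp add: ms algebra_simps)
      qed simp
      moreover obtain v' where v': "v' \<in> K" "\<forall>w\<in>V. \<rho> v (y w) - y (\<rho> v w) = \<rho> v' w"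
        using step by blast
      ultimately have "\<rho> (k *s u + v) (y w) - y (\<rho> (k *s u + v) w)
          = \<rho> (k *s (- cnj \<alpha>) *s u + v') w" if "w \<in> V" for w
      proof -
        have "\<rho> (k *s u + v) (y w) - y (\<rho> (k *s u + v) w)
            = k *s (\<rho> u (y w) - y (\<rho> u w)) + (\<rho> v (y w) - y (\<rho> v w))"
          by (simp add: ms endo_add[OF y] endo_scale[OF y] algebra_simps)
        also have "\<rho> u (y w) - y (\<rho> u w) = (- cnj \<alpha>) *s \<rho> u w"
          using \<open>\<And>w. w \<in> V \<Longrightarrow> _ \<in> {0}\<close>[OF that] by (simp add: eq_neg_iff_add_eq_0)
        also have "\<rho> v (y w) - y (\<rho> v w) = \<rho> v' w" using v' that by blast
        finally show ?thesis by (simp add: ms)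
      qed
      moreover have "k *s (- cnj \<alpha>) *s u + v' \<in> K"
        using sK u v' by (intro subspace_add subspace_scale) auto
      ultimately show ?case by blast
    qed
  qed
  have zero: "trace_on V (\<lambda>v. \<rho> z (y v)) = 0" if "z \<in> K" for z
  proof -
    have "z \<in> span {u \<cdot> v |u v. u \<in> K \<and> v \<in> K}" using that K(2) by (simp add: br_span_def)
    then show ?thesis
    proof (induction rule: span_induct_alt)
      case base
      have "trace_on V (\<lambda>v. 0 *s v) = 0" by (subst trace_on_scalar[OF md(1)]) simp
      then show ?case by (simp add: ms)
    next
      case (step k z z')
      then obtain u v where uv: "z = u \<cdot> v" "u \<in> K" "v \<in> K" by auto
      obtain v' where v': "v' \<in> K" "\<And>w. w \<in> V \<Longrightarrow> \<rho> v (y w) - y (\<rho> v w) = \<rho> v' w"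
        using comm[OF uv(3)] by blast
      have "trace_on V (\<lambda>w. \<rho> z (y w)) = trace_on V (\<lambda>w. \<rho> u (\<rho> v (y w)) - \<rho> v (\<rho> u (y w)))"
        using uv yV md by (intro trace_on_cong) auto
      also have "\<dots> = trace_on V (\<lambda>w. \<rho> u (\<rho> v (y w))) - trace_on V (\<lambda>w. \<rho> v (\<rho> u (y w)))"
        by (rule trace_on_diff[OF md(1)])
      also have "trace_on V (\<lambda>w. \<rho> v (\<rho> u (y w))) = trace_on V (\<lambda>w. \<rho> u (y (\<rho> v w)))"
        using md uv yV by (intro trace_on_comm[of V "\<rho> v" "\<lambda>w. \<rho> u (y w)"] endo_comp[OF md(2) y]) auto
      also have "trace_on V (\<lambda>w. \<rho> u (\<rho> v (y w))) - trace_on V (\<lambda>w. \<rho> u (y (\<rho> v w)))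
          = trace_on V (\<lambda>w. \<rho> u (\<rho> v (y w)) - \<rho> u (y (\<rho> v w)))"
        by (rule trace_on_diff[OF md(1), symmetric])
      also have "\<dots> = trace_on V (\<lambda>w. \<rho> u (\<rho> v' w))"
        using v' by (intro trace_on_cong[OF md(1)]) (simp add: ms[symmetric])
      also have "\<dots> = 0" using tr uv v' by blast
      finally have "trace_on V (\<lambda>w. \<rho> z (y w)) = 0" .
      then show ?case
        by (simp add: ms trace_on_add[OF md(1)] trace_on_scale[OF md(1)] step)
    qed
  qed
  have fin: "finite C" using C(2) by (rule finiteI_independent)
  have "0 = trace_on V (\<lambda>v. \<rho> x (y v))" using zero[OF x] by simp
  also have "\<dots> = (\<Sum>b\<in>C. representation C (\<rho> x (y b)) b)"
    using C md yV x by (intro trace_on_basis endo_comp[OF md(2) y]) auto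
  \<comment> \<open>In the triangular basis the diagonal entries of \<open>x\<close> are the
    eigenvalues \<open>a b\<close>, and \<open>y\<close> contributes their conjugates.\<close>
  also have "\<dots> = (\<Sum>b\<in>C. complex_of_real ((cmod (a b))\<^sup>2))"
  proof (rule sum.cong[OF refl])
    fix b assume b: "b \<in> C"
    then have "b \<in> V" using C by auto
    have "\<rho> x (y b) = cnj (a b) *s \<rho> x b" using ye Ca[OF b] \<open>b \<in> V\<close> ms(5) by metis
    moreover have "\<rho> x b \<in> span C" using md(4)[OF x \<open>b \<in> V\<close>] C by simp
    ultimately have "representation C (\<rho> x (y b)) b = cnj (a b) * a b"
      using Ca[OF b] by (simp add: representation_scale[OF C(2)])
    then show "representation C (\<rho> x (y b)) b = complex_of_real ((cmod (a b))\<^sup>2)"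
      using complex_norm_square[of "a b"] by (simp add: mult.commute)
  qed
  also have "\<dots> = complex_of_real (\<Sum>b\<in>C. (cmod (a b))\<^sup>2)" by simp
  finally have "(\<Sum>b\<in>C. (cmod (a b))\<^sup>2) = 0" by (metis of_real_eq_0_iff)
  then have "\<forall>b\<in>C. a b = 0" using sum_nonneg_eq_0_iff[OF fin, of "\<lambda>b. (cmod (a b))\<^sup>2"] by simp
  then have "C \<subseteq> gen_eig (\<rho> x) 0" using Ca by fastforce
  then show ?thesis using span_minimal[OF _ subspace_gen_eig[OF md(2)]] C(3) by blast
qed

subsection \<open>Semisimple subalgebras\<close>

lemma ideal_subalgebra: "two_sided_ideal A I \<Longrightarrow> subalgebra I"
  by (auto simp: two_sided_ideal_def subalgebra_def)

lemma lie_subset: "lie_subalgebra S \<Longrightarrow> subalgebra D \<Longrightarrow> D \<subseteq> S \<Longrightarrow> lie_subalgebra D"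
  by (auto simp: lie_subalgebra_def)

text \<open>The derived series stabilises for reasons of dimension, at a nonzero term because
  \<open>I\<close> is not solvable.\<close>

lemma perfect_core:
  assumes I: "two_sided_ideal A I" and ns: "\<not> solvable I"
  shows "\<exists>D. subalgebra D \<and> D \<subseteq> I \<and> D \<noteq> {0} \<and> br_span D D = D"
proof -
  let ?P = "\<lambda>D. \<exists>n. D = derived_series I n"
  have idl: "two_sided_ideal A D" if "?P D" for D using that ideal_derived_series[OF I] by blast
  have "?P I" by (rule exI[of _ 0]) simp
  then have "\<exists>D. ?P D \<and> (\<forall>D'. ?P D' \<longrightarrow> D' \<subseteq> D \<longrightarrow> D' = D)"
    by (rule ex_minimal_subspace) (use idl in \<open>auto simp: two_sided_ideal_def\<close>)
  then obtain D where D: "?P D" and min: "\<And>D'. ?P D' \<Longrightarrow> D' \<subseteq> D \<Longrightarrow> D' = D"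
    by (elim exE conjE) blast
  then obtain n where n: "D = derived_series I n" by blast
  have sub: "subalgebra D" using idl[OF D] by (rule ideal_subalgebra)
  then have "br_span D D \<subseteq> D" by (intro br_span_least) (auto simp: subalgebra_def)
  moreover have "?P (br_span D D)" by (rule exI[of _ "Suc n"]) (simp add: n)
  ultimately have "br_span D D = D" using min by blast
  moreover have "D \<noteq> {0}" using ns n by (auto simp: solvable_def)
  moreover have "derived_series I m \<subseteq> I" for m
  proof (induction m)
    case (Suc m)
    have "br_span I I \<subseteq> I" using I by (intro br_span_least) (auto simp: two_sided_ideal_def)
    then show ?case using br_span_mono[OF Suc Suc] by simp
  qed simp
  ultimately show ?thesis using sub n by blast
qed

lemma semisimple_solvable_ideal:
  assumes S: "semisimple_lie_subalgebra S" and I: "two_sided_ideal S I" "solvable I"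
  shows "I = {0}"
proof -
  have "subspace S" using S by (auto simp: semisimple_lie_subalgebra_def lie_subalgebra_def subalgebra_def)
  from solvable_ideal_le_radical[OF this I] have "I \<subseteq> {0}"
    using S by (simp add: semisimple_lie_subalgebra_def)
  moreover have "0 \<in> I" using I by (simp add: two_sided_ideal_def subspace_0)
  ultimately show ?thesis by blast
qed

definition trace_form :: "('a \<Rightarrow> 'a \<Rightarrow> 'a) \<Rightarrow> 'a set \<Rightarrow> 'a \<Rightarrow> 'a \<Rightarrow> complex" where
  "trace_form \<rho> V x y = trace_on V (\<lambda>v. \<rho> x (\<rho> y v))"

lemma trace_form_bilinear:
  assumes V: "module_on A \<rho> V" shows "bilinear_form (trace_form \<rho> V)"
  by (rule bilinear_formI)
    (simp_all add: trace_form_def module_simps[OF V] trace_on_add trace_on_scale module_onD(1)[OF V])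

lemma trace_form_sym:
  assumes V: "module_on A \<rho> V" and "x \<in> A" "y \<in> A"
  shows "trace_form \<rho> V x y = trace_form \<rho> V y x"
  unfolding trace_form_def
  using trace_on_comm[OF module_onD(1,2)[OF V] _ module_onD(2)[OF V]] module_onD(4)[OF V] assms(2,3)
  by blast

text \<open>Both sides expand into traces of triple products that agree by cyclicity.\<close>

lemma trace_form_invariant:
  assumes V: "module_on A \<rho> V" and xyz: "x \<in> A" "y \<in> A" "z \<in> A"
  shows "trace_form \<rho> V (x \<cdot> y) z = trace_form \<rho> V x (y \<cdot> z)"
proof -
  note ms = module_simps[OF V] and md = module_onD[OF V]
  have "trace_form \<rho> V (x \<cdot> y) z = trace_on V (\<lambda>v. \<rho> x (\<rho> y (\<rho> z v)) - \<rho> y (\<rho> x (\<rho> z v)))"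
    unfolding trace_form_def by (rule trace_on_cong[OF md(1)]) (simp add: md xyz)
  also have "\<dots> = trace_on V (\<lambda>v. \<rho> x (\<rho> y (\<rho> z v))) - trace_on V (\<lambda>v. \<rho> y (\<rho> x (\<rho> z v)))"
    by (rule trace_on_diff[OF md(1)])
  also have "trace_on V (\<lambda>v. \<rho> y (\<rho> x (\<rho> z v))) = trace_on V (\<lambda>v. \<rho> x (\<rho> z (\<rho> y v)))"
    using xyz md by (intro trace_on_comm[of V "\<rho> y" "\<lambda>v. \<rho> x (\<rho> z v)"] endo_comp[OF md(2) md(2)]) auto
  also have "trace_on V (\<lambda>v. \<rho> x (\<rho> y (\<rho> z v))) - trace_on V (\<lambda>v. \<rho> x (\<rho> z (\<rho> y v)))
      = trace_on V (\<lambda>v. \<rho> x (\<rho> y (\<rho> z v)) - \<rho> x (\<rho> z (\<rho> y v)))"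
    by (rule trace_on_diff[OF md(1), symmetric])
  also have "\<dots> = trace_form \<rho> V x (y \<cdot> z)"
    unfolding trace_form_def by (rule trace_on_cong[OF md(1)]) (simp add: md xyz ms)
  finally show ?thesis .
qed

text \<open>The source of all nondegeneracy below. On the perfect core \<open>D\<close> of a nonzero
  isotropic ideal, \<open>cartan_nilpotent\<close> makes the action on \<open>V\<close> nilpotent;
  faithfulness transfers this to the adjoint action, and Engel makes \<open>D\<close> solvable,
  contradicting perfection.\<close>

lemma semisimple_isotropic_ideal:
  assumes S: "semisimple_lie_subalgebra S" and V: "module_on S \<rho> V" and I: "two_sided_ideal S I"
    and faithful: "\<And>x. x \<in> I \<Longrightarrow> (\<And>v. v \<in> V \<Longrightarrow> \<rho> x v = 0) \<Longrightarrow> x = 0"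
    and iso: "\<And>x y. x \<in> I \<Longrightarrow> y \<in> I \<Longrightarrow> trace_form \<rho> V x y = 0"
  shows "I = {0}"
proof (rule ccontr)
  assume "I \<noteq> {0}"
  then have "\<not> solvable I" using semisimple_solvable_ideal[OF S I] by blast
  from perfect_core[OF I this] obtain D where D: "subalgebra D" "D \<subseteq> I" "D \<noteq> {0}" "br_span D D = D"
    by blast
  have DS: "D \<subseteq> S" using D I by (auto simp: two_sided_ideal_def)
  have VD: "module_on D \<rho> V" using module_on_subset[OF V DS] .
  note md = module_onD[OF VD]
  have sD: "subspace D" and DD: "\<And>a b. a \<in> D \<Longrightarrow> b \<in> D \<Longrightarrow> a \<cdot> b \<in> D"
    using D by (auto simp: subalgebra_def)
  have nil: "V \<subseteq> gen_eig (\<rho> x) 0" if "x \<in> D" for x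
    using cartan_nilpotent[OF D(1,4) VD _ that] iso D(2) unfolding trace_form_def by blast
  have "D \<subseteq> gen_eig (\<lambda>y. x \<cdot> y) 0" if x: "x \<in> D" for x
  proof
    fix y assume "y \<in> D"
    then have "y \<in> span (\<Union>c. gen_eig (\<lambda>y. x \<cdot> y) c \<inter> D)"
      using gen_eig_span[OF linear_br_right sD] DD[OF x] by blast
    moreover have "gen_eig (\<lambda>y. x \<cdot> y) c \<inter> D \<subseteq> gen_eig (\<lambda>y. x \<cdot> y) 0" for c
    proof (cases "c = 0")
      case False
      \<comment> \<open>An eigenvector \<open>y\<close> for \<open>c\<close> would carry the
        generalised eigenspace for 0, which is all of \<open>V\<close>, into the one for
        \<open>c\<close>; so it acts as zero.\<close>
      have "y = 0" if y: "y \<in> gen_eig (\<lambda>y. x \<cdot> y) c" "y \<in> D" for y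
      proof (rule faithful)
        show "y \<in> I" using y D by blast
        fix v assume v: "v \<in> V"
        have "\<rho> y v \<in> gen_eig (\<rho> x) (c + 0)"
          using gen_eig_module_shift[OF VD x _ sD y] DD[OF x] nil[OF x] v by blast
        moreover have yv: "\<rho> y v \<in> V" using md(4) y v by blast
        ultimately have "\<rho> y v \<in> gen_eig_others (\<rho> x) V 0"
          unfolding gen_eig_others_def using False by (intro span_base) auto
        moreover have "\<rho> y v \<in> gen_eig (\<rho> x) 0" using nil[OF x] yv by blast
        ultimately show "\<rho> y v = 0"
          using gen_eig_independent[OF md(2) md(1)] md(4)[OF x] by blast
      qed
      then show ?thesis using gen_eig_zero by blast
    qed simp
    then have "span (\<Union>c. gen_eig (\<lambda>y. x \<cdot> y) c \<inter> D) \<subseteq> gen_eig (\<lambda>y. x \<cdot> y) 0"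
      by (intro span_minimal subspace_gen_eig linear_br_right) blast
    ultimately show "y \<in> gen_eig (\<lambda>y. x \<cdot> y) 0" by blast
  qed
  moreover have "lie_subalgebra D"
    using lie_subset[OF _ D(1) DS] S by (simp add: semisimple_lie_subalgebra_def)
  ultimately have "solvable D" using engel_solvable by blast
  then show False using D derived_series_perfect[OF D(4)] by (auto simp: solvable_def)
qed

section \<open>Killing form, complements of ideals, perfectness\<close>

abbreviation killing :: "'a set \<Rightarrow> 'a \<Rightarrow> 'a \<Rightarrow> complex" where
  "killing S \<equiv> trace_form (\<cdot>) S"

context
  fixes S assumes S: "semisimple_lie_subalgebra S"
begin

lemma semisimpleD:
  shows S_lie: "lie_subalgebra S" and S_sub: "subspace S"
    and S_mult: "a \<in> S \<Longrightarrow> b \<in> S \<Longrightarrow> a \<cdot> b \<in> S"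
    and S_anti: "a \<in> S \<Longrightarrow> b \<in> S \<Longrightarrow> a \<cdot> b = - (b \<cdot> a)"
proof -
  show L: "lie_subalgebra S" using S by (simp add: semisimple_lie_subalgebra_def)
  then show "subspace S" "a \<in> S \<Longrightarrow> b \<in> S \<Longrightarrow> a \<cdot> b \<in> S"
    by (auto simp: lie_subalgebra_def subalgebra_def)
  show "a \<in> S \<Longrightarrow> b \<in> S \<Longrightarrow> a \<cdot> b = - (b \<cdot> a)" by (rule lie_anticomm[OF L])
qed

lemma S_idealI:
  assumes "subspace I" "I \<subseteq> S" "\<And>s x. s \<in> S \<Longrightarrow> x \<in> I \<Longrightarrow> s \<cdot> x \<in> I"
  shows "two_sided_ideal S I"
proof -
  have "x \<cdot> s \<in> I" if "s \<in> S" "x \<in> I" for s x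
    using assms S_anti[of x s] subspace_neg[OF assms(1)] that by auto
  then show ?thesis using assms by (auto simp: two_sided_ideal_def)
qed

lemma adjoint_module: "module_on S (\<cdot>) S"
  by (rule left_mult_module[OF S_sub S_mult])

lemma S_center: "z \<in> S \<Longrightarrow> (\<And>s. s \<in> S \<Longrightarrow> z \<cdot> s = 0) \<Longrightarrow> z = 0"
proof -
  let ?Z = "{z \<in> S. \<forall>s\<in>S. z \<cdot> s = 0}"
  have sub: "subspace ?Z" using S_sub by (auto simp: subspace_def br_simps)
  have "two_sided_ideal S ?Z"
  proof (rule S_idealI[OF sub])
    fix s x assume sx: "s \<in> S" "x \<in> ?Z"
    then have "s \<cdot> x = 0" using S_anti[of s x] by simp
    then show "s \<cdot> x \<in> ?Z" using subspace_0[OF sub] by (simp only:)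
  qed auto
  moreover have "derived_series ?Z 1 \<subseteq> {0}"
    using br_span_least[of ?Z ?Z "{0}"] by auto
  then have "solvable ?Z" using solvableI[OF subspace_0[OF sub] _ solvable_zero] by blast
  ultimately have "?Z = {0}" by (rule semisimple_solvable_ideal[OF S])
  then show "z \<in> S \<Longrightarrow> (\<And>s. s \<in> S \<Longrightarrow> z \<cdot> s = 0) \<Longrightarrow> z = 0" by blast
qed

text \<open>The intersection of \<open>I\<close> with its Killing orthogonal is isotropic, hence
  zero, the adjoint module being faithful. The form is then nondegenerate on \<open>I\<close>, which
  gives the decomposition.\<close>

lemma ideal_complement:
  assumes I: "two_sided_ideal S I"
  defines "J \<equiv> {x \<in> S. \<forall>y\<in>I. killing S x y = 0}"
  shows "two_sided_ideal S J" "I \<inter> J = {0}" "s \<in> S \<Longrightarrow> \<exists>i\<in>I. \<exists>j\<in>J. s = i + j"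
proof -
  note b = trace_form_bilinear[OF adjoint_module]
  note bs = bilinear_form_simps[OF b]
  have I': "subspace I" "I \<subseteq> S" "\<And>s x. s \<in> S \<Longrightarrow> x \<in> I \<Longrightarrow> s \<cdot> x \<in> I \<and> x \<cdot> s \<in> I"
    using I by (auto simp: two_sided_ideal_def)
  have sJ: "subspace J" using S_sub by (auto simp: J_def subspace_def bs)
  have JS: "J \<subseteq> S" by (auto simp: J_def)
  show J: "two_sided_ideal S J"
  proof (rule S_idealI[OF sJ JS])
    fix s x assume sx: "s \<in> S" "x \<in> J"
    have "killing S (s \<cdot> x) y = 0" if "y \<in> I" for y
    proof -
      have "killing S (s \<cdot> x) y = - killing S (x \<cdot> s) y"
        using S_anti[of s x] sx JS by (simp add: bs subset_iff)
      also have "killing S (x \<cdot> s) y = killing S x (s \<cdot> y)"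
        using sx JS that I' by (intro trace_form_invariant[OF adjoint_module]) auto
      also have "\<dots> = 0" using sx I' that by (auto simp: J_def)
      finally show ?thesis by simp
    qed
    then show "s \<cdot> x \<in> J" using S_mult sx JS by (auto simp: J_def)
  qed
  show IJ: "I \<inter> J = {0}"
  proof (rule semisimple_isotropic_ideal[OF S adjoint_module])
    show "two_sided_ideal S (I \<inter> J)"
      using I J by (auto simp: two_sided_ideal_def subspace_inter)
    show "killing S x y = 0" if "x \<in> I \<inter> J" "y \<in> I \<inter> J" for x y
      using that by (auto simp: J_def)
    show "x = 0" if "x \<in> I \<inter> J" "\<And>v. v \<in> S \<Longrightarrow> x \<cdot> v = 0" for x
      using that I' S_center by blast
  qed
  have nd: "y = 0" if y: "y \<in> I" "\<And>x. x \<in> I \<Longrightarrow> killing S x y = 0" for y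
  proof -
    have "killing S y x = 0" if "x \<in> I" for x
      using y(2)[OF that] trace_form_sym[OF adjoint_module, of x y] y(1) that I' by auto
    then have "y \<in> I \<inter> J" using y(1) I' by (auto simp: J_def)
    then show ?thesis using IJ by blast
  qed
  assume s: "s \<in> S"
  obtain i where i: "i \<in> I" "\<forall>y\<in>I. killing S (s - i) y = 0"
    using orthogonal_complement[OF b I'(1) nd] by blast
  have "s - i \<in> J" using i s I' S_sub by (auto simp: J_def subspace_diff)
  then show "\<exists>i\<in>I. \<exists>j\<in>J. s = i + j" using i(1) by (metis add.commute diff_add_cancel)
qed

text \<open>If \<open>x\<close> is Killing orthogonal to all brackets, invariance puts every
  \<open>x \<cdot> s\<close> into the radical of the Killing form, so \<open>x\<close> is central
  and zero. The complement of the derived algebra is thus zero.\<close>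

lemma S_perfect: "br_span S S = S"
proof -
  let ?D = "br_span S S"
  have SS: "two_sided_ideal S S" using S_sub S_mult by (simp add: two_sided_ideal_def)
  have D: "two_sided_ideal S ?D" using SS by (rule ideal_derived)
  define J where "J = {x \<in> S. \<forall>y\<in>?D. killing S x y = 0}"
  note J = ideal_complement[OF D, folded J_def]
  have "x = 0" if x: "x \<in> J" for x
  proof (rule S_center)
    show xS: "x \<in> S" using x by (simp add: J_def)
    fix s assume s: "s \<in> S"
    have "killing S (x \<cdot> s) t = 0" if t: "t \<in> S" for t
      using trace_form_invariant[OF adjoint_module xS s t] x br_spanI[OF s t] by (simp add: J_def)
    then have "x \<cdot> s \<in> S \<inter> {x \<in> S. \<forall>y\<in>S. killing S x y = 0}" using S_mult[OF xS s] by simp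
    then show "x \<cdot> s = 0" using ideal_complement(2)[OF SS] by blast
  qed
  then have "S \<subseteq> ?D" using J(3) by force
  moreover have "?D \<subseteq> S" using D by (simp add: two_sided_ideal_def)
  ultimately show ?thesis by blast
qed

subsection \<open>Whitehead's first lemma\<close>

text \<open>On the complement \<open>J\<close> of the kernel of the action the trace form is
  nondegenerate, giving a Casimir operator \<open>c\<close> that commutes with \<open>S\<close> and
  has trace \<open>dim J\<close>. For \<open>J\<close> nonzero it is invertible, and the required
  \<open>v\<close> is the preimage of \<open>u\<close> under \<open>c\<close>.\<close>

lemma whitehead_irreducible:
  assumes V: "module_on S \<rho> V" and irr: "irreducible_module S \<rho> V"
    and nu: "endo \<nu>" "\<And>x. x \<in> S \<Longrightarrow> \<nu> x \<in> V"
    and coc: "\<And>x y. x \<in> S \<Longrightarrow> y \<in> S \<Longrightarrow> \<nu> (x \<cdot> y) = \<rho> x (\<nu> y) - \<rho> y (\<nu> x)"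
  shows "\<exists>v\<in>V. \<forall>x\<in>S. \<nu> x = \<rho> x v"
proof -
  note ms = module_simps[OF V] and md = module_onD[OF V]
  note b = trace_form_bilinear[OF V]
  note bs = bilinear_form_simps[OF b]
  let ?\<tau> = "trace_form \<rho> V"
  define I where "I = {x \<in> S. \<forall>v\<in>V. \<rho> x v = 0}"
  define J where "J = {x \<in> S. \<forall>y\<in>I. killing S x y = 0}"
  have I: "two_sided_ideal S I"
  proof (rule S_idealI)
    show "subspace I" using S_sub by (auto simp: I_def subspace_def ms)
    show "s \<cdot> x \<in> I" if "s \<in> S" "x \<in> I" for s x
      using that S_mult md(4,5) by (auto simp: I_def ms)
  qed (auto simp: I_def)
  note J = ideal_complement[OF I, folded J_def]
  have J': "subspace J" "J \<subseteq> S" "\<And>s x. s \<in> S \<Longrightarrow> x \<in> J \<Longrightarrow> s \<cdot> x \<in> J"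
    using J(1) by (auto simp: two_sided_ideal_def)
  have anti: "?\<tau> (s \<cdot> x) y = - ?\<tau> x (s \<cdot> y)" if "s \<in> S" "x \<in> S" "y \<in> S" for s x y
    using trace_form_invariant[OF V that(2,1,3)] S_anti[OF that(1,2)] by (simp add: bs)
  have nd: "y = 0" if y: "y \<in> J" "\<And>x. x \<in> J \<Longrightarrow> ?\<tau> x y = 0" for y
  proof -
    let ?R = "{y \<in> J. \<forall>x\<in>J. ?\<tau> y x = 0}"
    have "?R = {0}"
    proof (rule semisimple_isotropic_ideal[OF S V])
      show "two_sided_ideal S ?R"
      proof (rule S_idealI)
        show "subspace ?R" using J'(1) by (auto simp: subspace_def bs)
        fix s x assume sx: "s \<in> S" "x \<in> ?R"
        have "?\<tau> (s \<cdot> x) y = 0" if "y \<in> J" for y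
          using anti[of s x y] sx J'(2) J'(3)[of s y] that by auto
        then show "s \<cdot> x \<in> ?R" using J'(3) sx by auto
      qed (use J' in auto)
      show "?\<tau> x y = 0" if "x \<in> ?R" "y \<in> ?R" for x y using that by auto
      show "x = 0" if "x \<in> ?R" "\<And>v. v \<in> V \<Longrightarrow> \<rho> x v = 0" for x
      proof -
        have "x \<in> I \<inter> J" using that J' by (auto simp: I_def)
        then show ?thesis using J(2) by blast
      qed
    qed
    moreover have "?\<tau> y x = 0" if "x \<in> J" for x
      using trace_form_sym[OF V, of y x] y(1) y(2)[OF that] J'(2) that by auto
    then have "y \<in> ?R" using y(1) by blast
    ultimately show ?thesis by blast
  qed
  obtain E d where Ed: "dual_bases ?\<tau> J E d" using dual_bases_exist[OF b J'(1) nd] by blast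
  have E: "\<And>e. e \<in> E \<Longrightarrow> e \<in> J" "\<And>e. e \<in> E \<Longrightarrow> d e \<in> J" "finite E" "card E = dim J"
    "\<And>e. e \<in> E \<Longrightarrow> ?\<tau> e (d e) = 1"
    using Ed by (auto simp: dual_bases_def)
  have ES: "\<And>e. e \<in> E \<Longrightarrow> e \<in> S" "\<And>e. e \<in> E \<Longrightarrow> d e \<in> S" using E J' by auto
  have inv: "(\<Sum>e\<in>E. F (x \<cdot> e) (d e)) + (\<Sum>e\<in>E. F e (x \<cdot> d e)) = 0"
    if x: "x \<in> S" and F: "\<And>y. endo (\<lambda>x. F x y)" "\<And>x. endo (F x)" for x F
    using dual_bases_invariant[OF b Ed _ _ F, of "\<lambda>y. x \<cdot> y"] J' anti[OF x] x by blast
  define c where "c w = (\<Sum>e\<in>E. \<rho> e (\<rho> (d e) w))" for w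
  have c: "endo c" by (rule endoI) (simp_all add: c_def ms sum.distrib scale_sum_right)
  have cV: "c w \<in> V" if "w \<in> V" for w
    unfolding c_def using that ES md by (intro subspace_sum md) auto
  have c_comm: "\<rho> x (c w) = c (\<rho> x w)" if x: "x \<in> S" and w: "w \<in> V" for x w
  proof -
    have "\<rho> x (\<rho> e (\<rho> (d e) w)) = (\<rho> (x \<cdot> e) (\<rho> (d e) w) + \<rho> e (\<rho> (x \<cdot> d e) w)) + \<rho> e (\<rho> (d e) (\<rho> x w))"
      if "e \<in> E" for e
      using md(5)[OF x ES(1)[OF that] md(4)[OF ES(2)[OF that] w]] md(5)[OF x ES(2)[OF that] w]
      by (simp add: ms)
    then have "\<rho> x (c w) = ((\<Sum>e\<in>E. \<rho> (x \<cdot> e) (\<rho> (d e) w)) + (\<Sum>e\<in>E. \<rho> e (\<rho> (x \<cdot> d e) w))) + c (\<rho> x w)"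
      by (simp add: c_def endo_sum[OF md(2)] sum.distrib)
    also have "(\<Sum>e\<in>E. \<rho> (x \<cdot> e) (\<rho> (d e) w)) + (\<Sum>e\<in>E. \<rho> e (\<rho> (x \<cdot> d e) w)) = 0"
      by (rule inv[OF x, of "\<lambda>a b. \<rho> a (\<rho> b w)"]) (auto intro: endoI simp: ms)
    finally show ?thesis by simp
  qed
  \<comment> \<open>The Casimir sum with its second action replaced by the cocycle; invariance turns
    \<open>\<rho> x u\<close> into \<open>c (\<nu> x)\<close>.\<close>
  define u where "u = (\<Sum>e\<in>E. \<rho> e (\<nu> (d e)))"
  have uV: "u \<in> V" unfolding u_def using ES md nu by (intro subspace_sum md) auto
  have u: "\<rho> x u = c (\<nu> x)" if x: "x \<in> S" for x
  proof -
    have "\<rho> x (\<rho> e (\<nu> (d e))) = (\<rho> (x \<cdot> e) (\<nu> (d e)) + \<rho> e (\<nu> (x \<cdot> d e))) + \<rho> e (\<rho> (d e) (\<nu> x))"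
      if "e \<in> E" for e
      using md(5)[OF x ES(1)[OF that] nu(2)[OF ES(2)[OF that]]] coc[OF x ES(2)[OF that]]
      by (simp add: ms)
    then have "\<rho> x u = ((\<Sum>e\<in>E. \<rho> (x \<cdot> e) (\<nu> (d e))) + (\<Sum>e\<in>E. \<rho> e (\<nu> (x \<cdot> d e)))) + c (\<nu> x)"
      by (simp add: c_def u_def endo_sum[OF md(2)] sum.distrib)
    also have "(\<Sum>e\<in>E. \<rho> (x \<cdot> e) (\<nu> (d e))) + (\<Sum>e\<in>E. \<rho> e (\<nu> (x \<cdot> d e))) = 0"
      by (rule inv[OF x, of "\<lambda>a b. \<rho> a (\<nu> b)"])
        (auto intro: endoI simp: ms endo_add[OF nu(1)] endo_scale[OF nu(1)])
    finally show ?thesis by simp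
  qed
  show ?thesis
  proof (cases "J = {0}")
    \<comment> \<open>The action is trivial and the Casimir operator useless; but then the cocycle
      kills brackets, and \<open>S\<close> is perfect.\<close>
    case True
    then have "I = S" using J(3) I by (force simp: two_sided_ideal_def)
    then have \<rho>0: "\<rho> x v = 0" if "x \<in> S" "v \<in> V" for x v using that by (auto simp: I_def)
    have "\<nu> x \<in> {0}" if "x \<in> S" for x
    proof (rule endo_span_subset[OF nu(1)])
      show "x \<in> span {a \<cdot> b |a b. a \<in> S \<and> b \<in> S}" using that S_perfect by (simp add: br_span_def)
      show "\<nu> y \<in> {0}" if "y \<in> {a \<cdot> b |a b. a \<in> S \<and> b \<in> S}" for y
        using that coc nu(2) \<rho>0 by auto
    qed simp
    then show ?thesis using subspace_0[OF md(1)] ms(6) by (intro bexI[of _ 0]) auto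
  next
    case False
    \<comment> \<open>Schur's argument: the kernel of \<open>c\<close> is a submodule, and it is not
      \<open>V\<close> since the trace of \<open>c\<close> is nonzero.\<close>
    let ?N = "{v \<in> V. c v \<in> {0}}"
    have "submodule S \<rho> ?N"
      unfolding submodule_def
    proof (intro conjI ballI)
      show "subspace ?N" by (rule endo_vimage_subspace[OF c md(1)]) simp
      show "\<rho> x v \<in> ?N" if "x \<in> S" "v \<in> ?N" for x v
        using that md(4) c_comm[of x v] ms(6)[of x] by auto
    qed
    then have "?N = {0} \<or> ?N = V" using irr by (auto simp: irreducible_module_def)
    moreover have "?N \<noteq> V"
    proof
      assume "?N = V"
      then have "trace_on V c = trace_on V (\<lambda>v. 0 *s v)"
        by (intro trace_on_cong[OF md(1)]) auto
      then have "trace_on V c = 0" using trace_on_scalar[OF md(1), of 0] by simp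
      moreover have tr_sum: "trace_on V (\<lambda>w. \<Sum>e\<in>F. \<rho> e (\<rho> (d e) w)) = (\<Sum>e\<in>F. ?\<tau> e (d e))"
        if "finite F" for F
        using that
      proof induction
        case empty
        then show ?case using trace_on_scalar[OF md(1), of 0] by simp
      next
        case (insert e F)
        then show ?case by (simp add: trace_on_add[OF md(1)] trace_form_def)
      qed
      have "trace_on V c = (\<Sum>e\<in>E. ?\<tau> e (d e))"
        using tr_sum[OF E(3)] by (simp add: c_def[abs_def])
      then have "trace_on V c = of_nat (dim J)" using E by simp
      ultimately have "dim J = 0" by simp
      then show False using False J'(1) by (auto simp: subspace_0)
    qed
    ultimately have ker: "\<And>v. v \<in> V \<Longrightarrow> c v = 0 \<Longrightarrow> v = 0" by blast
    then have "c ` V = V" using cV by (intro endo_inj_imp_surj[OF c md(1)]) auto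
    then obtain v where v: "v \<in> V" "c v = u" using uV by (metis imageE)
    have "\<nu> x = \<rho> x v" if x: "x \<in> S" for x
    proof -
      have "c (\<nu> x - \<rho> x v) = 0" using u[OF x] c_comm[OF x v(1)] v(2) by (simp add: endo_diff[OF c])
      moreover have "\<nu> x - \<rho> x v \<in> V" by (rule subspace_diff[OF md(1) nu(2)[OF x] md(4)[OF x v(1)]])
      ultimately have "\<nu> x - \<rho> x v = 0" using ker by blast
      then show ?thesis by simp
    qed
    then show ?thesis using v by blast
  qed
qed

text \<open>Requires the cocycle identity only modulo \<open>W\<close>, which is all that the defect
  of an automorphism satisfies.\<close>

lemma whitehead_quotient:
  assumes V: "module_on S \<rho> V" and W: "maximal_submodule S \<rho> V W"
    and nu: "endo \<nu>" "\<And>x. x \<in> S \<Longrightarrow> \<nu> x \<in> V"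
    and coc: "\<And>x y. x \<in> S \<Longrightarrow> y \<in> S \<Longrightarrow> \<nu> (x \<cdot> y) - (\<rho> x (\<nu> y) - \<rho> y (\<nu> x)) \<in> W"
  shows "\<exists>v\<in>V. \<forall>x\<in>S. \<nu> x - \<rho> x v \<in> W"
proof -
  obtain p where p: "endo p" "module_on S (\<lambda>x v. p (\<rho> x v)) (p ` V)"
    "irreducible_module S (\<lambda>x v. p (\<rho> x v)) (p ` V)"
    and p0: "\<forall>v. p v = 0 \<longleftrightarrow> v \<in> W" and pp: "\<forall>x\<in>S. \<forall>v. p (\<rho> x (p v)) = p (\<rho> x v)"
    using quotient_module[OF V W] by (elim exE conjE) (rule that)
  have "\<exists>v\<in>p ` V. \<forall>x\<in>S. p (\<nu> x) = p (\<rho> x v)"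
  proof (rule whitehead_irreducible[OF p(2,3)])
    show "endo (\<lambda>x. p (\<nu> x))" by (rule endo_comp[OF p(1) nu(1)])
    show "p (\<nu> x) \<in> p ` V" if "x \<in> S" for x using nu(2)[OF that] by blast
    fix x y assume xy: "x \<in> S" "y \<in> S"
    have "p (\<nu> (x \<cdot> y) - (\<rho> x (\<nu> y) - \<rho> y (\<nu> x))) = 0" using coc[OF xy] p0 by blast
    then show "p (\<nu> (x \<cdot> y)) = p (\<rho> x (p (\<nu> y))) - p (\<rho> y (p (\<nu> x)))"
      using pp xy by (simp add: endo_diff[OF p(1)])
  qed
  then obtain v where v: "v \<in> V" "\<forall>x\<in>S. p (\<nu> x) = p (\<rho> x (p v))" by blast
  then have "p (\<nu> x - \<rho> x v) = 0" if "x \<in> S" for x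
    using that pp by (simp add: endo_diff[OF p(1)])
  then show ?thesis using v(1) p0 by blast
qed

end

subsection \<open>Exponentials of nilpotent derivations\<close>

lemma funpow_nilpotent_mono:
  fixes f :: "'a \<Rightarrow> 'a"
  assumes "\<And>x. (f ^^ n) x = 0" "n \<le> k" shows "(f ^^ k) x = 0"
proof -
  have "f ^^ k = f ^^ n \<circ> f ^^ (k - n)" using assms(2) by (simp flip: funpow_add)
  then show ?thesis by (simp add: assms(1))
qed

text \<open>Uniqueness of limits turns the exponential into a finite sum; everything after this is
  algebra. Any bound on the nilpotency exponent may be used.\<close>

lemma lin_exp_nilpotent:
  assumes nil: "\<And>x. (f ^^ n) x = 0"
  shows "lin_exp f x = (\<Sum>k<n. (1 / fact k) *s (f ^^ k) x)"
proof -
  have "vec_sums (\<lambda>k. (1 / fact k) *s (f ^^ k) x) (\<Sum>k<n. (1 / fact k) *s (f ^^ k) x)"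
    unfolding vec_sums_def
  proof (intro allI impI)
    fix \<phi> assume "Vector_Spaces.linear scale ((*) :: complex \<Rightarrow> _) \<phi>"
    then interpret P: Vector_Spaces.linear scale "(*)" \<phi> .
    have "(\<lambda>k. \<phi> ((1 / fact k) *s (f ^^ k) x)) sums (\<Sum>k<n. \<phi> ((1 / fact k) *s (f ^^ k) x))"
      by (rule sums_finite) (auto simp: funpow_nilpotent_mono[OF nil] P.zero)
    then show "(\<lambda>k. \<phi> ((1 / fact k) *s (f ^^ k) x)) sums \<phi> (\<Sum>k<n. (1 / fact k) *s (f ^^ k) x)"
      by (simp only: P.sum)
  qed
  then show ?thesis
    unfolding lin_exp_def by (intro the_equality) (auto intro: vec_sums_unique)
qed

lemma lin_exp_endo:
  assumes f: "endo f" and nil: "\<And>x. (f ^^ n) x = 0"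
  shows "endo (lin_exp f)"
proof -
  have "lin_exp f = (\<lambda>x. \<Sum>k<n. (1 / fact k) *s (f ^^ k) x)"
    by (rule ext) (rule lin_exp_nilpotent[OF nil])
  moreover have "endo (\<lambda>x. \<Sum>k<n. (1 / fact k) *s (f ^^ k) x)"
    by (rule endoI) (simp_all add: endo_add[OF endo_funpow[OF f]] endo_scale[OF endo_funpow[OF f]]
        scale_right_distrib sum.distrib scale_sum_right mult.commute)
  ultimately show ?thesis by simp
qed

text \<open>The Leibniz rule for divided powers, where dividing by factorials removes the binomial
  coefficients.\<close>

lemma derivation_divided_power:
  assumes f: "derivation f"
  defines "D \<equiv> \<lambda>k x. (1 / fact k) *s (f ^^ k) x"
  shows "D k (x \<cdot> y) = (\<Sum>i\<le>k. D i x \<cdot> D (k - i) y)"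
proof (induction k)
  case 0 show ?case by (simp add: D_def)
next
  case (Suc k)
  have lin: "endo f" and der: "\<And>a b. f (a \<cdot> b) = f a \<cdot> b + a \<cdot> f b"
    using f by (auto simp: derivation_def)
  have fD: "f (D i u) = of_nat (Suc i) *s D (Suc i) u" for i u
    by (simp add: D_def endo_scale[OF lin] del: of_nat_Suc)
  let ?F = "\<lambda>i. D i x \<cdot> D (Suc k - i) y"
  have "of_nat (Suc k) *s D (Suc k) (x \<cdot> y) = f (D k (x \<cdot> y))" by (simp only: fD)
  also have "\<dots> = (\<Sum>i\<le>k. f (D i x) \<cdot> D (k - i) y) + (\<Sum>i\<le>k. D i x \<cdot> f (D (k - i) y))"
    by (simp add: Suc endo_sum[OF lin] der sum.distrib)
  also have "(\<Sum>i\<le>k. f (D i x) \<cdot> D (k - i) y) = (\<Sum>i\<le>k. of_nat (Suc i) *s ?F (Suc i))"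
    by (simp only: fD br_simps diff_Suc_Suc)
  \<comment> \<open>The added term \<open>i = 0\<close> has coefficient zero, as has
    \<open>i = Suc k\<close> in the second sum. The weights \<open>i\<close> and
    \<open>Suc k - i\<close> then add up to \<open>Suc k\<close>, which is cancelled at the
    end.\<close>
  also have "\<dots> = (\<Sum>i\<le>Suc k. of_nat i *s ?F i)"
    by (simp only: sum.atMost_Suc_shift) simp
  also have "(\<Sum>i\<le>k. D i x \<cdot> f (D (k - i) y)) = (\<Sum>i\<le>k. of_nat (Suc k - i) *s ?F i)"
    by (rule sum.cong) (simp_all only: fD br_simps atMost_iff Suc_diff_le)
  also have "\<dots> = (\<Sum>i\<le>Suc k. of_nat (Suc k - i) *s ?F i)" by simp
  also have "(\<Sum>i\<le>Suc k. of_nat i *s ?F i) + (\<Sum>i\<le>Suc k. of_nat (Suc k - i) *s ?F i)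
      = (\<Sum>i\<le>Suc k. of_nat (Suc k) *s ?F i)"
    unfolding sum.distrib[symmetric]
    by (rule sum.cong) (simp_all only: scale_left_distrib[symmetric] of_nat_add[symmetric]
        atMost_iff le_add_diff_inverse)
  also have "\<dots> = of_nat (Suc k) *s (\<Sum>i\<le>Suc k. ?F i)" by (simp only: scale_sum_right)
  finally have "of_nat (Suc k) *s D (Suc k) (x \<cdot> y) = of_nat (Suc k) *s (\<Sum>i\<le>Suc k. ?F i)" .
  then show ?case by (simp only: scale_cancel_left) (simp del: of_nat_Suc)
qed

lemma lin_exp_mult:
  assumes f: "derivation f" and nil: "\<And>x. (f ^^ n) x = 0"
  shows "lin_exp f (x \<cdot> y) = lin_exp f x \<cdot> lin_exp f y"
proof -
  define D where "D = (\<lambda>k x. (1 / fact k) *s (f ^^ k) x)"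
  have D0: "D k u = 0" if "n \<le> k" for k u
    using funpow_nilpotent_mono[OF nil that] by (simp add: D_def)
  \<comment> \<open>With \<open>n + n\<close> terms the triangle of index pairs contains the full
    square below \<open>n\<close>, outside which all products vanish.\<close>
  have "lin_exp f (x \<cdot> y) = (\<Sum>k<n + n. D k (x \<cdot> y))"
    unfolding D_def by (rule lin_exp_nilpotent) (rule funpow_nilpotent_mono[OF nil], simp)
  also have "\<dots> = (\<Sum>k<n + n. \<Sum>i\<le>k. D i x \<cdot> D (k - i) y)"
    using derivation_divided_power[OF f] by (simp only: D_def)
  also have "\<dots> = (\<Sum>(i, j)\<in>{(i, j). i + j < n + n}. D i x \<cdot> D j y)"
    by (rule sum.triangle_reindex[symmetric])
  also have "\<dots> = (\<Sum>(i, j)\<in>{..<n} \<times> {..<n}. D i x \<cdot> D j y)"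
  proof (rule sum.mono_neutral_right)
    show "finite {(i, j). i + j < n + n}"
      by (rule finite_subset[of _ "{..<n + n} \<times> {..<n + n}"]) auto
    have "D i x \<cdot> D j y = 0" if "\<not> (i < n \<and> j < n)" for i j
      using that D0[of i x] D0[of j y] by (auto simp: br_simps not_less)
    then show "\<forall>p\<in>{(i, j). i + j < n + n} - {..<n} \<times> {..<n}. (case p of (i, j) \<Rightarrow> D i x \<cdot> D j y) = 0"
      by auto
  qed auto
  also have "\<dots> = (\<Sum>i<n. \<Sum>j<n. D i x \<cdot> D j y)" by (simp add: sum.cartesian_product)
  also have "\<dots> = (\<Sum>i<n. D i x \<cdot> (\<Sum>j<n. D j y))"
    by (simp only: endo_sum[OF linear_br_right])
  also have "\<dots> = (\<Sum>i<n. D i x) \<cdot> (\<Sum>j<n. D j y)"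
    by (rule endo_sum[OF linear_br_left, symmetric])
  also have "\<dots> = lin_exp f x \<cdot> lin_exp f y"
    by (simp add: D_def lin_exp_nilpotent[OF nil])
  finally show ?thesis .
qed

subsection \<open>The nilpotent part of the radical\<close>

abbreviation radical :: "'a set" where
  "radical \<equiv> solvable_radical UNIV"

text \<open>Plays the part of the nilradical: it acts as zero on the factors of a composition
  series. The kernel is included so that \<open>ideal_above_kernel\<close> handles products on the
  other side.\<close>

definition radical_commutator :: "'a set" where
  "radical_commutator = {x + n |x n. x \<in> br_span UNIV radical \<and> n \<in> leibniz_kernel}"

lemma left_mult_derivation: "derivation (\<lambda>x. z \<cdot> x)"
  unfolding derivation_def by (intro conjI allI linear_br_right leibniz)

lemma radical_ideal:
  shows radical_subspace: "subspace radical"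
    and radical_mult: "b \<in> radical \<Longrightarrow> a \<cdot> b \<in> radical" "b \<in> radical \<Longrightarrow> b \<cdot> a \<in> radical"
    and radical_two_sided: "two_sided_ideal UNIV radical" and radical_solvable: "solvable radical"
  using radical_maximal[OF subspace_UNIV] by (auto simp: maximal_solvable_ideal_def two_sided_ideal_def)

lemma kernel_le_radical: "leibniz_kernel \<subseteq> radical"
proof (rule solvable_ideal_le_radical[OF subspace_UNIV])
  show "two_sided_ideal UNIV leibniz_kernel"
    using kernel_mult_left kernel_mult_right subspace_kernel
    by (simp add: two_sided_ideal_def subspace_0)
  have "derived_series leibniz_kernel 1 \<subseteq> {0}"
    using br_span_least[of leibniz_kernel leibniz_kernel "{0}"] by (auto simp: kernel_mult_left)
  then show "solvable leibniz_kernel"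
    using solvableI[OF subspace_0[OF subspace_kernel] _ solvable_zero] by blast
qed

lemma subspace_radical_commutator: "subspace radical_commutator"
  unfolding radical_commutator_def by (intro subspace_sums subspace_br_span subspace_kernel)

lemma kernel_le_radical_commutator: "leibniz_kernel \<subseteq> radical_commutator"
  unfolding radical_commutator_def using subspace_0[OF subspace_br_span] by force

lemma radical_commutator_le_radical: "radical_commutator \<subseteq> radical"
proof -
  have "br_span UNIV radical \<subseteq> radical"
    by (rule br_span_least) (auto simp: radical_subspace radical_mult)
  then show ?thesis
    using kernel_le_radical subspace_add[OF radical_subspace] by (auto simp: radical_commutator_def)
qed

lemma mult_radical: "b \<in> radical \<Longrightarrow> a \<cdot> b \<in> radical_commutator"
  unfolding radical_commutator_def
  using br_spanI[of a UNIV b radical] subspace_0[OF subspace_kernel] by force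

text \<open>Above the kernel left and right products differ only by sign.\<close>

lemma ideal_above_kernel:
  assumes "subspace I" "leibniz_kernel \<subseteq> I" "a \<cdot> x \<in> I" shows "x \<cdot> a \<in> I"
proof -
  have "(x \<cdot> a + a \<cdot> x) - a \<cdot> x \<in> I"
    using assms kernel_sym[of x a] by (intro subspace_diff) auto
  then show ?thesis by simp
qed

lemma radical_commutator_ideal:
  assumes "z \<in> radical_commutator"
  shows "a \<cdot> z \<in> radical_commutator" "z \<cdot> a \<in> radical_commutator"
proof -
  show 1: "a \<cdot> z \<in> radical_commutator"
    using assms radical_commutator_le_radical mult_radical by blast
  show "z \<cdot> a \<in> radical_commutator"
    using ideal_above_kernel[OF subspace_radical_commutator kernel_le_radical_commutator 1] .
qed

lemma radical_mult_left: "b \<in> radical \<Longrightarrow> b \<cdot> a \<in> radical_commutator"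
  by (rule ideal_above_kernel[OF subspace_radical_commutator kernel_le_radical_commutator mult_radical])

text \<open>The radical acts by scalars on the irreducible factor of \<open>V\<close> by
  \<open>W\<close>, so \<open>a \<cdot> b\<close> with \<open>b\<close> radical acts as a commutator
  with a scalar, that is, as zero.\<close>

lemma radical_commutator_lowers:
  assumes W: "maximal_submodule UNIV (\<cdot>) V W" and V: "submodule UNIV (\<cdot>) V"
    and z: "z \<in> radical_commutator" and v: "v \<in> V"
  shows "z \<cdot> v \<in> W"
proof -
  have sW: "subspace W" "\<And>a w. w \<in> W \<Longrightarrow> a \<cdot> w \<in> W"
    using W by (auto simp: maximal_submodule_def submodule_def)
  have sV: "subspace V" "\<And>a v. v \<in> V \<Longrightarrow> a \<cdot> v \<in> V" using V by (auto simp: submodule_def)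
  have mod: "module_on UNIV (\<cdot>) V" by (rule left_mult_module[OF sV])
  obtain x n where xn: "z = x + n" "x \<in> br_span UNIV radical" "n \<in> leibniz_kernel"
    using z by (auto simp: radical_commutator_def)
  have "x \<cdot> v \<in> W"
  proof (rule endo_span_subset[OF linear_br_left _ sW(1) xn(2)[unfolded br_span_def]])
    fix y assume "y \<in> {a \<cdot> a' |a a'. a \<in> UNIV \<and> a' \<in> radical}"
    then obtain a b where y: "y = a \<cdot> b" "b \<in> radical" by auto
    obtain c where c: "\<forall>v\<in>V. b \<cdot> v - c *s v \<in> W"
      using solvable_ideal_scalar_quotient[OF mod W radical_two_sided radical_solvable y(2)] by blast
    have "y \<cdot> v = a \<cdot> (b \<cdot> v - c *s v) - (b \<cdot> (a \<cdot> v) - c *s (a \<cdot> v))"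
      by (simp add: y br_br_left br_simps)
    also have "\<dots> \<in> W"
      by (rule subspace_diff[OF sW(1) sW(2)]) (use c v sV(2)[OF v] in auto)
    finally show "y \<cdot> v \<in> W" .
  qed
  then show ?thesis by (simp add: xn br_simps kernel_mult_left)
qed

text \<open>One application kills each factor of a composition series, whose length therefore bounds
  the exponent.\<close>

lemma radical_commutator_nilpotent:
  assumes z: "z \<in> radical_commutator"
  shows "\<exists>n. \<forall>v. ((\<lambda>x. z \<cdot> x) ^^ n) v = 0"
proof -
  have "\<exists>n. \<forall>v\<in>V. ((\<lambda>x. z \<cdot> x) ^^ n) v = 0" if "submodule UNIV (\<cdot>) V" for V
    using that
  proof (induction "dim V" arbitrary: V rule: less_induct)
    case less
    show ?case
    proof (cases "V = {0}")
      case True then show ?thesis by (intro exI[of _ 0]) simp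
    next
      case False
      have sV: "subspace V" using less.prems by (simp add: submodule_def)
      have "submodule UNIV (\<cdot>) {0}" by (simp add: submodule_def br_simps)
      moreover have "{0} \<subset> V" using False subspace_0[OF sV] by blast
      ultimately obtain W where W: "maximal_submodule UNIV (\<cdot>) V W"
        using ex_maximal_submodule[of UNIV "(\<cdot>)" "{0}" V] by blast
      then have sub: "submodule UNIV (\<cdot>) W" "W \<subset> V" by (auto simp: maximal_submodule_def)
      then have "dim W < dim V" using sV by (metis dim_psubset span_eq_iff submodule_def)
      from less.hyps[OF this sub(1)] obtain n where n: "\<forall>v\<in>W. ((\<lambda>x. z \<cdot> x) ^^ n) v = 0" by blast
      have "((\<lambda>x. z \<cdot> x) ^^ Suc n) v = 0" if "v \<in> V" for v
        using n radical_commutator_lowers[OF W less.prems z that] by (simp only: funpow_Suc_right comp_apply)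
      then show ?thesis by blast
    qed
  qed
  from this[of UNIV] show ?thesis by (simp add: submodule_def)
qed

abbreviation exp_left :: "'a \<Rightarrow> 'a \<Rightarrow> 'a" where
  "exp_left z \<equiv> lin_exp (\<lambda>x. z \<cdot> x)"

lemma exp_left:
  assumes z: "z \<in> radical_commutator"
  shows exp_left_endo: "endo (exp_left z)"
    and exp_left_mult: "exp_left z (x \<cdot> y) = exp_left z x \<cdot> exp_left z y"
    and exp_left_diff: "exp_left z x - x \<in> radical_commutator"
proof -
  obtain n where n: "\<And>v. ((\<lambda>x. z \<cdot> x) ^^ n) v = 0" using radical_commutator_nilpotent[OF z] by blast
  show "endo (exp_left z)" by (rule lin_exp_endo[OF linear_br_right n])
  show "exp_left z (x \<cdot> y) = exp_left z x \<cdot> exp_left z y"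
    by (rule lin_exp_mult[OF left_mult_derivation n])
  have "exp_left z x = (\<Sum>k<Suc n. (1 / fact k) *s ((\<lambda>x. z \<cdot> x) ^^ k) x)"
    by (rule lin_exp_nilpotent) (rule funpow_nilpotent_mono[OF n], simp)
  then have "exp_left z x - x = (\<Sum>k<n. (1 / fact (Suc k)) *s (z \<cdot> ((\<lambda>x. z \<cdot> x) ^^ k) x))"
    by (simp add: sum.lessThan_Suc_shift del: sum.lessThan_Suc fact_Suc)
  also have "\<dots> \<in> radical_commutator"
    using radical_commutator_ideal(2)[OF z]
    by (intro subspace_sum subspace_scale subspace_radical_commutator)
  finally show "exp_left z x - x \<in> radical_commutator" .
qed

text \<open>First-order expansion on the factor of \<open>I\<close> by \<open>I'\<close>.
  Differences of powers start with \<open>z' \<cdot> x\<close>; each later one is a sum of products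
  of \<open>I\<close> with \<open>radical_commutator\<close>, which lie in \<open>I'\<close> in
  either order.\<close>

lemma exp_left_add:
  assumes z: "z \<in> radical_commutator" and z': "z' \<in> I" and I: "I \<subseteq> radical_commutator"
    and sI: "submodule UNIV (\<cdot>) I" and I': "maximal_submodule UNIV (\<cdot>) I I'" "leibniz_kernel \<subseteq> I'"
  shows "exp_left (z + z') x - exp_left z x - z' \<cdot> x \<in> I'"
proof -
  let ?J = radical_commutator
  let ?L = "\<lambda>k. ((\<lambda>x. z \<cdot> x) ^^ k) x" and ?L' = "\<lambda>k. ((\<lambda>x. (z + z') \<cdot> x) ^^ k) x"
  have sI': "subspace I'" "I' \<subseteq> I" using I' by (auto simp: maximal_submodule_def submodule_def)
  have subI: "subspace I" "\<And>a u. u \<in> I \<Longrightarrow> a \<cdot> u \<in> I" using sI by (auto simp: submodule_def)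
  have zz: "z + z' \<in> ?J" using z z' I by (intro subspace_add subspace_radical_commutator) auto
  have JI: "j \<cdot> i \<in> I'" if "j \<in> ?J" "i \<in> I" for i j
    by (rule radical_commutator_lowers[OF I'(1) sI that])
  have L'J: "?L' (Suc k) \<in> ?J" for k
    using radical_commutator_ideal(2)[OF zz] by simp
  define d where "d k = ?L' k - ?L k" for k
  have d0: "d 0 = 0" and d1: "d (Suc 0) = z' \<cdot> x" by (simp_all add: d_def br_simps)
  have dS: "d (Suc (Suc k)) \<in> I'" if "d (Suc k) \<in> I" for k
  proof -
    have "d (Suc (Suc k)) = z \<cdot> d (Suc k) + z' \<cdot> ?L' (Suc k)"
      by (simp add: d_def br_simps)
    also have "z' \<cdot> ?L' (Suc k) \<in> I'"
      by (rule ideal_above_kernel[OF sI'(1) I'(2) JI[OF L'J z']])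
    then have "z \<cdot> d (Suc k) + z' \<cdot> ?L' (Suc k) \<in> I'"
      using JI[OF z that] by (intro subspace_add sI')
    finally show ?thesis .
  qed
  have dI: "d (Suc k) \<in> I" for k
  proof (induction k)
    case 0
    show ?case unfolding d1
      using ideal_above_kernel[OF subI(1) _ subI(2)[OF z']] I'(2) sI'(2) by blast
  next
    case (Suc k) then show ?case using dS sI'(2) by blast
  qed
  obtain m where m: "\<And>v. ((\<lambda>x. z \<cdot> x) ^^ m) v = 0" using radical_commutator_nilpotent[OF z] by blast
  obtain m' where m': "\<And>v. ((\<lambda>x. (z + z') \<cdot> x) ^^ m') v = 0"
    using radical_commutator_nilpotent[OF zz] by blast
  \<comment> \<open>Exceeds both nilpotency bounds and leaves room to split off the terms of index 0
    and 1.\<close>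
  let ?n = "Suc (Suc (m + m'))"
  have "exp_left (z + z') x = (\<Sum>k<?n. (1 / fact k) *s ?L' k)"
    by (rule lin_exp_nilpotent) (rule funpow_nilpotent_mono[OF m'], simp)
  moreover have "exp_left z x = (\<Sum>k<?n. (1 / fact k) *s ?L k)"
    by (rule lin_exp_nilpotent) (rule funpow_nilpotent_mono[OF m], simp)
  ultimately have "exp_left (z + z') x - exp_left z x = (\<Sum>k<?n. (1 / fact k) *s d k)"
    by (simp only: d_def scale_right_diff_distrib sum_subtractf)
  also have "\<dots> = z' \<cdot> x + (\<Sum>k<m + m'. (1 / fact (Suc (Suc k))) *s d (Suc (Suc k)))"
    by (simp add: sum.lessThan_Suc_shift d0 d1 del: sum.lessThan_Suc fact_Suc)
  finally have "exp_left (z + z') x - exp_left z x - z' \<cdot> x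
      = (\<Sum>k<m + m'. (1 / fact (Suc (Suc k))) *s d (Suc (Suc k)))" by (simp only: add_diff_cancel_left')
  also have "\<dots> \<in> I'" using dS[OF dI] by (intro subspace_sum subspace_scale sI')
  finally show ?thesis .
qed

subsection \<open>Conjugacy of Levi subalgebras\<close>

text \<open>\<open>P\<close> is the quotient map by the radical realised inside \<open>S\<close>; it
  is multiplicative because the radical is an ideal. Closeness of \<open>v\<close> to
  \<open>S\<close> is measured by \<open>v - P v\<close>.\<close>

lemma levi_projection:
  assumes S: "levi_subalgebra S"
  shows "\<exists>P. endo P \<and> (\<forall>v. P v \<in> S \<and> v - P v \<in> radical) \<and> (\<forall>s\<in>S. P s = s) \<and>
    (\<forall>b\<in>radical. P b = 0) \<and> (\<forall>x y. P (x \<cdot> y) = P x \<cdot> P y)"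
proof -
  have S': "radical \<inter> S = {0}" "{b + s |b s. b \<in> radical \<and> s \<in> S} = UNIV"
    "semisimple_lie_subalgebra S"
    using S by (auto simp: levi_subalgebra_def)
  note sS = S_sub[OF S'(3)] and SS = S_mult[OF S'(3)]
  have "\<exists>b\<in>radical. \<exists>s\<in>S. v = b + s" for v
  proof -
    have "v \<in> {b + s |b s. b \<in> radical \<and> s \<in> S}" unfolding S'(2) by simp
    then show ?thesis by blast
  qed
  from direct_sum_projection[OF radical_subspace sS S'(1) this]
  obtain P where P: "endo P" "\<And>v. P v \<in> S" "\<And>v. v - P v \<in> radical" by blast
  have zero: "x = 0" if "x \<in> S" "x \<in> radical" for x using that S'(1) by blast
  have Ps: "P s = s" if "s \<in> S" for s
    using zero[OF subspace_diff[OF sS that P(2)] P(3)] by simp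
  have Pb: "P b = 0" if "b \<in> radical" for b
  proof (rule zero[OF P(2)])
    have "b - (b - P b) \<in> radical" by (rule subspace_diff[OF radical_subspace that P(3)])
    then show "P b \<in> radical" by simp
  qed
  have "P (x \<cdot> y) = P x \<cdot> P y" for x y
  proof -
    have "x \<cdot> y - P x \<cdot> P y = (x - P x) \<cdot> y + P x \<cdot> (y - P y)" by (simp add: br_simps)
    also have "\<dots> \<in> radical"
      using P(3) by (intro subspace_add radical_subspace radical_mult)
    finally have "P (x \<cdot> y - P x \<cdot> P y) = 0" by (rule Pb)
    then show ?thesis using Ps[OF SS[OF P(2) P(2)]] by (simp add: endo_diff[OF P(1)])
  qed
  then show ?thesis using P Ps Pb by blast
qed

text \<open>Induction along a maximal chain of ideals between the kernel and the nilpotent part of the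
  radical: on each factor the nilpotent part acts trivially, so that the defect is a cocycle of
  \<open>S\<^sub>1\<close> and can be removed by changing \<open>z\<close>. Correcting \<open>z\<close> itself, instead of composing
  exponentials, avoids the Baker-Campbell-Hausdorff formula.\<close>

lemma levi_conjugate_modulo_kernel:
  assumes S1: "levi_subalgebra S\<^sub>1"
    and P: "endo P" "\<And>v. P v \<in> S\<^sub>2" "\<And>v. v - P v \<in> radical" "\<And>s. s \<in> S\<^sub>2 \<Longrightarrow> P s = s"
      "\<And>b. b \<in> radical \<Longrightarrow> P b = 0" "\<And>x y. P (x \<cdot> y) = P x \<cdot> P y"
  shows "\<exists>z\<in>radical_commutator. \<forall>s\<in>S\<^sub>1. exp_left z s - P (exp_left z s) \<in> leibniz_kernel"
proof -
  let ?J = radical_commutator and ?N = leibniz_kernel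
  have ss: "semisimple_lie_subalgebra S\<^sub>1"
    and sum: "{b + s |b s. b \<in> radical \<and> s \<in> S\<^sub>1} = UNIV"
    using S1 by (auto simp: levi_subalgebra_def)
  let ?R = "\<lambda>z I. \<forall>s\<in>S\<^sub>1. exp_left z s - P (exp_left z s) \<in> I"
  let ?Q = "\<lambda>I. submodule UNIV (\<cdot>) I \<and> ?N \<subseteq> I \<and> I \<subseteq> ?J \<and> (\<exists>z\<in>?J. ?R z I)"
  have "?Q ?J"
  proof (intro conjI bexI[of _ 0] ballI)
    show "submodule UNIV (\<cdot>) ?J"
      using subspace_radical_commutator radical_commutator_ideal(1) by (simp add: submodule_def)
    show "?N \<subseteq> ?J" by (rule kernel_le_radical_commutator)
    show "0 \<in> ?J" by (rule subspace_0[OF subspace_radical_commutator])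
    \<comment> \<open>The chain starts with \<open>z = 0\<close>. As \<open>S\<^sub>1\<close> is
      perfect, only products need checking, and for these multiplicativity of \<open>P\<close>
      exhibits a factor in the radical.\<close>
    fix s assume "s \<in> S\<^sub>1"
    then have s: "s \<in> span {a \<cdot> b |a b. a \<in> S\<^sub>1 \<and> b \<in> S\<^sub>1}"
      using S_perfect[OF ss] by (simp add: br_span_def)
    have e: "endo (\<lambda>s. s - P s)" by (rule endo_minus[OF linear_ident P(1)])
    have "s - P s \<in> ?J"
    proof (rule endo_span_subset[OF e _ subspace_radical_commutator s])
      fix y assume "y \<in> {a \<cdot> b |a b. a \<in> S\<^sub>1 \<and> b \<in> S\<^sub>1}"
      then obtain a b where y: "y = a \<cdot> b" by auto
      have "y - P y = (a - P a) \<cdot> b + P a \<cdot> (b - P b)" by (simp add: y P(6) br_simps)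
      also have "\<dots> \<in> ?J"
        using P(3) by (intro subspace_add subspace_radical_commutator mult_radical radical_mult_left)
      finally show "y - P y \<in> ?J" .
    qed
    moreover have "exp_left 0 s = s"
      using lin_exp_nilpotent[where f = "\<lambda>x. 0 \<cdot> x" and n = 1 and x = s] by (simp add: br_simps)
    ultimately show "exp_left 0 s - P (exp_left 0 s) \<in> ?J" by simp
  qed auto
  then have "\<exists>I. ?Q I \<and> (\<forall>I'. ?Q I' \<longrightarrow> I' \<subseteq> I \<longrightarrow> I' = I)"
    by (rule ex_minimal_subspace) (auto simp: submodule_def)
  then obtain I where I: "?Q I" and min: "\<And>I'. ?Q I' \<Longrightarrow> I' \<subseteq> I \<Longrightarrow> I' = I"
    by (elim exE conjE) blast
  have "I = ?N"
  proof (rule ccontr)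
    assume "I \<noteq> ?N"
    have sub: "submodule UNIV (\<cdot>) I" and NI: "?N \<subseteq> I" and IJ: "I \<subseteq> ?J" using I by auto
    obtain z where z: "z \<in> ?J" "?R z I" using I by blast
    have "submodule UNIV (\<cdot>) ?N" using subspace_kernel kernel_mult_right by (simp add: submodule_def)
    moreover have "?N \<subset> I" using NI \<open>I \<noteq> ?N\<close> by blast
    ultimately obtain I' where I': "maximal_submodule UNIV (\<cdot>) I I'" and NI': "?N \<subseteq> I'"
      using ex_maximal_submodule[of UNIV "(\<cdot>)" ?N I] by blast
    have sI: "subspace I" "\<And>a i. i \<in> I \<Longrightarrow> a \<cdot> i \<in> I" using sub by (auto simp: submodule_def)
    have sI': "subspace I'" "I' \<subset> I" "submodule UNIV (\<cdot>) I'" "\<And>a i. i \<in> I' \<Longrightarrow> a \<cdot> i \<in> I'"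
      using I' by (auto simp: maximal_submodule_def submodule_def)
    have JI: "j \<cdot> i \<in> I'" if "j \<in> ?J" "i \<in> I" for i j
      by (rule radical_commutator_lowers[OF I' sub that])
    have mod: "module_on S\<^sub>1 (\<cdot>) I" by (rule left_mult_module[OF sI])
    have mod': "module_on UNIV (\<cdot>) I" by (rule left_mult_module[OF sI])
    \<comment> \<open>Whitehead's lemma needs the factor irreducible over \<open>S\<^sub>1\<close>,
      not just over the whole algebra; it is, since the radical acts on it by scalars.\<close>
    have max: "maximal_submodule S\<^sub>1 (\<cdot>) I I'"
      unfolding maximal_submodule_def
    proof (intro conjI allI impI)
      show "submodule S\<^sub>1 (\<cdot>) I'" using sI' by (simp add: submodule_def)
      show "I' \<subset> I" by (rule sI')
      fix U assume U: "submodule S\<^sub>1 (\<cdot>) U" "I' \<subseteq> U" "U \<subseteq> I"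
      have "submodule UNIV (\<cdot>) U"
        unfolding submodule_def
      proof (intro conjI ballI)
        show sU: "subspace U" using U by (simp add: submodule_def)
        fix a u assume u: "u \<in> U"
        have "a \<in> {b + s |b s. b \<in> radical \<and> s \<in> S\<^sub>1}" using sum by simp
        then obtain b s where a: "a = b + s" "b \<in> radical" "s \<in> S\<^sub>1" by blast
        obtain c where "\<forall>v\<in>I. b \<cdot> v - c *s v \<in> I'"
          using solvable_ideal_scalar_quotient[OF mod' I' radical_two_sided radical_solvable a(2)] by blast
        then have "b \<cdot> u - c *s u \<in> U" using u U by blast
        moreover have "s \<cdot> u \<in> U" using U u a by (simp add: submodule_def)
        ultimately have "(b \<cdot> u - c *s u) + c *s u + s \<cdot> u \<in> U"
          using u by (intro subspace_add subspace_scale sU)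
        then show "a \<cdot> u \<in> U" by (simp add: a br_simps)
      qed
      then show "U = I' \<or> U = I" using I' U by (auto simp: maximal_submodule_def)
    qed
    let ?\<phi> = "exp_left z"
    define \<nu> where "\<nu> s = ?\<phi> s - P (?\<phi> s)" for s
    have \<nu>: "endo \<nu>"
      unfolding \<nu>_def[abs_def] by (intro endo_minus exp_left_endo[OF z(1)] endo_comp[OF P(1)])
    have \<nu>I: "\<nu> s \<in> I" if "s \<in> S\<^sub>1" for s using z(2) that by (simp add: \<nu>_def)
    have coc: "\<nu> (s \<cdot> t) - (s \<cdot> \<nu> t - t \<cdot> \<nu> s) \<in> I'" if st: "s \<in> S\<^sub>1" "t \<in> S\<^sub>1" for s t
    proof -
      \<comment> \<open>Expand after writing \<open>P (?\<phi> s)\<close> as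
        \<open>?\<phi> s - \<nu> s\<close>. Modulo \<open>I'\<close> one may replace
        \<open>?\<phi> s\<close> by \<open>s\<close>, reverse products with a sign, and drop
        \<open>\<nu> s \<cdot> \<nu> t\<close>.\<close>
      have "\<nu> (s \<cdot> t) = ?\<phi> s \<cdot> \<nu> t + \<nu> s \<cdot> ?\<phi> t - \<nu> s \<cdot> \<nu> t"
        by (simp add: \<nu>_def exp_left_mult[OF z(1)] P(6) br_simps)
      then have "\<nu> (s \<cdot> t) - (s \<cdot> \<nu> t - t \<cdot> \<nu> s) =
          (?\<phi> s - s) \<cdot> \<nu> t + (\<nu> s \<cdot> ?\<phi> t + ?\<phi> t \<cdot> \<nu> s) - (?\<phi> t - t) \<cdot> \<nu> s - \<nu> s \<cdot> \<nu> t"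
        by (simp add: br_simps)
      also have "\<dots> \<in> I'"
      proof (intro subspace_diff[OF sI'(1)])
        have "(?\<phi> s - s) \<cdot> \<nu> t \<in> I'" by (rule JI[OF exp_left_diff[OF z(1)] \<nu>I[OF st(2)]])
        moreover have "\<nu> s \<cdot> ?\<phi> t + ?\<phi> t \<cdot> \<nu> s \<in> I'" using kernel_sym NI' by blast
        ultimately show "(?\<phi> s - s) \<cdot> \<nu> t + (\<nu> s \<cdot> ?\<phi> t + ?\<phi> t \<cdot> \<nu> s) \<in> I'"
          by (rule subspace_add[OF sI'(1)])
        show "(?\<phi> t - t) \<cdot> \<nu> s \<in> I'" by (rule JI[OF exp_left_diff[OF z(1)] \<nu>I[OF st(1)]])
        show "\<nu> s \<cdot> \<nu> t \<in> I'" using JI \<nu>I st IJ by blast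
      qed
      finally show ?thesis .
    qed
    obtain z' where z': "z' \<in> I" "\<forall>s\<in>S\<^sub>1. \<nu> s - s \<cdot> z' \<in> I'"
      using whitehead_quotient[OF ss mod max \<nu> \<nu>I coc] by blast
    have zz: "z + z' \<in> ?J" using z(1) z'(1) IJ by (intro subspace_add subspace_radical_commutator) auto
    have "?R (z + z') I'"
    proof
      fix s assume s: "s \<in> S\<^sub>1"
      let ?\<psi> = "exp_left (z + z') s"
      \<comment> \<open>To first order \<open>z'\<close> adds \<open>z' \<cdot> s\<close>, which is
        \<open>- (s \<cdot> z')\<close> modulo the kernel and cancels the coboundary.\<close>
      have "?\<psi> - P (?\<phi> s) = (?\<psi> - ?\<phi> s - z' \<cdot> s) + (\<nu> s - s \<cdot> z') + (s \<cdot> z' + z' \<cdot> s)"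
        by (simp add: \<nu>_def)
      also have "\<dots> \<in> I'"
      proof (rule subspace_add[OF sI'(1) subspace_add[OF sI'(1)]])
        show "?\<psi> - ?\<phi> s - z' \<cdot> s \<in> I'" by (rule exp_left_add[OF z(1) z'(1) IJ sub I' NI'])
        show "\<nu> s - s \<cdot> z' \<in> I'" using z'(2) s by blast
        show "s \<cdot> z' + z' \<cdot> s \<in> I'" using kernel_sym NI' by blast
      qed
      finally have *: "?\<psi> - P (?\<phi> s) \<in> I'" .
      \<comment> \<open>The estimate was against the old projection. Since \<open>P\<close> kills
        the radical and fixes \<open>S\<^sub>2\<close>, old and new projections coincide.\<close>
      then have "?\<psi> - P (?\<phi> s) \<in> radical"
        using sI'(2) IJ radical_commutator_le_radical by blast
      then have "P (?\<psi> - P (?\<phi> s)) = 0" by (rule P(5))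
      then have "P ?\<psi> = P (?\<phi> s)" using P(4)[OF P(2)] by (simp add: endo_diff[OF P(1)])
      with * show "?\<psi> - P ?\<psi> \<in> I'" by simp
    qed
    then have "?Q I'" using sI' NI' IJ zz by blast
    from min[OF this] sI' show False by blast
  qed
  then show ?thesis using I by blast
qed

lemma levi_conjugate:
  assumes BN: "br_span radical leibniz_kernel = {0}"
    and S1: "levi_subalgebra S\<^sub>1" and S2: "levi_subalgebra S\<^sub>2"
  shows "\<exists>f. derivation f \<and> lin_exp f ` S\<^sub>1 = S\<^sub>2"
proof -
  let ?J = radical_commutator and ?N = leibniz_kernel
  have BN0: "b \<cdot> n = 0" if "b \<in> radical" "n \<in> ?N" for b n
    using br_spanI[OF that] BN by simp
  obtain P where P: "endo P" "\<And>v. P v \<in> S\<^sub>2" "\<And>v. v - P v \<in> radical" "\<And>s. s \<in> S\<^sub>2 \<Longrightarrow> P s = s"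
      "\<And>b. b \<in> radical \<Longrightarrow> P b = 0" "\<And>x y. P (x \<cdot> y) = P x \<cdot> P y"
    using levi_projection[OF S2] by metis
  obtain P1 where P1: "endo P1" "\<And>v. P1 v \<in> S\<^sub>1" "\<And>v. v - P1 v \<in> radical"
      "\<And>s. s \<in> S\<^sub>1 \<Longrightarrow> P1 s = s" "\<And>b. b \<in> radical \<Longrightarrow> P1 b = 0" "\<And>x y. P1 (x \<cdot> y) = P1 x \<cdot> P1 y"
    using levi_projection[OF S1] by metis
  obtain z where z: "z \<in> ?J" "\<forall>s\<in>S\<^sub>1. exp_left z s - P (exp_left z s) \<in> ?N"
    using levi_conjugate_modulo_kernel[OF S1 P] by blast
  let ?\<phi> = "exp_left z"
  have JB: "?J \<subseteq> radical" by (rule radical_commutator_le_radical)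
  define \<nu> where "\<nu> s = ?\<phi> s - P (?\<phi> s)" for s
  have \<nu>: "endo \<nu>"
    unfolding \<nu>_def[abs_def] by (intro endo_minus exp_left_endo[OF z(1)] endo_comp[OF P(1)])
  have \<nu>N: "\<nu> s \<in> ?N" if "s \<in> S\<^sub>1" for s using z(2) that by (simp add: \<nu>_def)
  \<comment> \<open>In the expansion the middle term is radical times kernel, zero by the hypothesis
    \<open>BN\<close>; the last has a kernel element on the left.\<close>
  have \<nu>_mult: "\<nu> (s \<cdot> t) = s \<cdot> \<nu> t" if st: "s \<in> S\<^sub>1" "t \<in> S\<^sub>1" for s t
  proof -
    have "\<nu> (s \<cdot> t) = s \<cdot> \<nu> t + (?\<phi> s - s) \<cdot> \<nu> t + \<nu> s \<cdot> (?\<phi> t - \<nu> t)"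
      by (simp add: \<nu>_def exp_left_mult[OF z(1)] P(6) br_simps)
    moreover have "(?\<phi> s - s) \<cdot> \<nu> t = 0"
      using exp_left_diff[OF z(1)] JB \<nu>N[OF st(2)] by (intro BN0) auto
    ultimately show ?thesis using kernel_mult_left[OF \<nu>N[OF st(1)]] by simp
  qed
  \<comment> \<open>The sign makes \<open>?\<phi> s + g s\<close> equal to
    \<open>P (?\<phi> s)\<close> on \<open>S\<^sub>1\<close>; composing with \<open>P1\<close>
    extends the map by zero to the radical.\<close>
  define g where "g v = - \<nu> (P1 v)" for v
  have g: "endo g"
    by (rule endoI) (simp_all add: g_def endo_add[OF \<nu>] endo_scale[OF \<nu>] endo_add[OF P1(1)] endo_scale[OF P1(1)])
  have gN: "g v \<in> ?N" for v unfolding g_def by (rule subspace_neg[OF subspace_kernel \<nu>N[OF P1(2)]])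
  have gB: "g b = 0" if "b \<in> radical" for b using P1(5)[OF that] by (simp add: g_def endo_zero[OF \<nu>])
  have gg: "g (g v) = 0" for v using gB gN kernel_le_radical by blast
  have zB: "z \<in> radical" using z(1) JB by blast
  have gz: "g (z \<cdot> v) = 0" for v by (rule gB) (rule radical_mult(2)[OF zB])
  have zg: "z \<cdot> g v = 0" for v by (rule BN0[OF zB gN])
  have g_mult: "g (a \<cdot> b) = g a \<cdot> b + a \<cdot> g b" for a b
  proof -
    have "(a - P1 a) \<cdot> \<nu> (P1 b) = 0" by (rule BN0[OF P1(3) \<nu>N[OF P1(2)]])
    then have "a \<cdot> \<nu> (P1 b) = P1 a \<cdot> \<nu> (P1 b)" by (simp add: br_simps)
    then show ?thesis
      by (simp add: kernel_mult_left[OF gN]) (simp add: g_def P1(6) \<nu>_mult[OF P1(2) P1(2)] br_simps)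
  qed
  define f where "f v = z \<cdot> v + g v" for v
  have f: "derivation f"
    unfolding derivation_def
  proof (intro conjI allI)
    show "endo f" unfolding f_def[abs_def] by (rule endo_plus[OF linear_br_right g])
    show "f (a \<cdot> b) = f a \<cdot> b + a \<cdot> f b" for a b
      by (simp add: f_def g_mult br_simps leibniz[of z a b])
  qed
  \<comment> \<open>From the square on, all terms containing \<open>g\<close> vanish by
    \<open>gz\<close>, \<open>zg\<close> and \<open>gg\<close>, so \<open>g\<close> survives only in
    the linear term of the exponential.\<close>
  have f_pow: "(f ^^ Suc (Suc k)) v = ((\<lambda>x. z \<cdot> x) ^^ Suc (Suc k)) v" for k v
  proof (induction k)
    case 0 show ?case by (simp add: f_def br_simps endo_add[OF g] gz zg gg)
  next
    case (Suc k)
    have "(f ^^ Suc (Suc (Suc k))) v = f (((\<lambda>x. z \<cdot> x) ^^ Suc (Suc k)) v)"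
      by (simp only: funpow.simps(2)[of "Suc (Suc k)" f] comp_apply Suc)
    also have "\<dots> = ((\<lambda>x. z \<cdot> x) ^^ Suc (Suc (Suc k))) v" by (simp add: f_def gz)
    finally show ?case .
  qed
  obtain n where n: "\<And>v. ((\<lambda>x. z \<cdot> x) ^^ n) v = 0" using radical_commutator_nilpotent[OF z(1)] by blast
  \<comment> \<open>The bound is raised to at least two, where \<open>f_pow\<close> begins to
    apply.\<close>
  have nil: "((\<lambda>x. z \<cdot> x) ^^ Suc (Suc n)) v = 0" for v by (rule funpow_nilpotent_mono[OF n]) simp
  have "(f ^^ Suc (Suc n)) v = 0" for v using nil f_pow by simp
  then have "lin_exp f v = (\<Sum>k<Suc (Suc n). (1 / fact k) *s (f ^^ k) v)" for v
    by (rule lin_exp_nilpotent)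
  also have "\<dots> v = (\<Sum>k<Suc (Suc n). (1 / fact k) *s ((\<lambda>x. z \<cdot> x) ^^ k) v) + g v" for v
    by (simp only: sum.lessThan_Suc_shift f_pow) (simp add: f_def)
  also have "(\<Sum>k<Suc (Suc n). (1 / fact k) *s ((\<lambda>x. z \<cdot> x) ^^ k) v) = ?\<phi> v" for v
    by (rule lin_exp_nilpotent[OF nil, symmetric])
  finally have exp_f: "lin_exp f v = ?\<phi> v + g v" for v .
  have exp_f1: "lin_exp f s = P (?\<phi> s)" if "s \<in> S\<^sub>1" for s
    using P1(4)[OF that] by (simp add: exp_f g_def \<nu>_def)
  have "lin_exp f ` S\<^sub>1 = S\<^sub>2"
  proof (intro equalityI subsetI)
    show "t \<in> S\<^sub>2" if "t \<in> lin_exp f ` S\<^sub>1" for t using that exp_f1 P(2) by auto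
    fix t assume t: "t \<in> S\<^sub>2"
    \<comment> \<open>The preimage of \<open>t\<close> is \<open>P1 t\<close>: both
      \<open>?\<phi>\<close> and \<open>P1\<close> move vectors by radical elements only, and
      \<open>P\<close> kills these.\<close>
    have "P (?\<phi> (P1 t) - P1 t) = 0" using exp_left_diff[OF z(1)] JB by (intro P(5)) auto
    then have "P (?\<phi> (P1 t)) = P (P1 t)" by (simp add: endo_diff[OF P(1)])
    also have "\<dots> = P t" using P(5)[OF P1(3)[of t]] by (simp add: endo_diff[OF P(1)])
    also have "\<dots> = t" by (rule P(4)[OF t])
    finally have "lin_exp f (P1 t) = t" using exp_f1[OF P1(2)] by simp
    then show "t \<in> lin_exp f ` S\<^sub>1" using P1(2) by (metis imageI)
  qed
  then show ?thesis using f by blast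
qed

end

theorem theorem2:
  fixes scale :: "complex \<Rightarrow> 'a::ab_group_add \<Rightarrow> 'a"
    and Basis :: "'a set"
    and br :: "'a \<Rightarrow> 'a \<Rightarrow> 'a"
    and N B S\<^sub>1 S\<^sub>2 :: "'a set"
  assumes M: "left_leibniz_algebra scale Basis br"
    and N: "N = left_leibniz_algebra.leibniz_kernel scale br"
    and B: "B = left_leibniz_algebra.solvable_radical scale br UNIV"
    and BN: "left_leibniz_algebra.br_span scale br B N = {0}"
    and S1: "left_leibniz_algebra.levi_subalgebra scale br S\<^sub>1"
    and S2: "left_leibniz_algebra.levi_subalgebra scale br S\<^sub>2"
  shows "\<exists>f. left_leibniz_algebra.derivation scale br f \<and>
             left_leibniz_algebra.lin_exp scale f ` S\<^sub>1 = S\<^sub>2"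
  using left_leibniz_algebra.levi_conjugate[OF M BN[unfolded N B] S1 S2] .

end
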